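(* Let $Z = \{(P_i \times Q_j; m_{ij}) \mid 1\le i\le a,\ 1\le j\le b\} \subseteq \mathbb{P}^1\times\mathbb{P}^1$ be an arithmetically Cohen-Macaulay (ACM) set of fat points. For any $P_i \times Q_j \in \operatorname{Supp}(Z)$, let $$Y = m_{1j}(P_1 \times Q_j) + \cdots + m_{ij}(P_i \times Q_j) + \cdots + m_{aj}(P_a \times Q_j)$$ be all the fat points of $Z$ whose support has $Q_j$ as its second coordinate, and let $$W = m_{i1}(P_i \times Q_1) + \cdots + m_{ij}(P_i \times Q_j) + \cdots + m_{ib}(P_i \times Q_b)$$ be all the fat points of $Z$ whose support has $P_i$ as its first coordinate. Set $$a_{\ell} = \sum_{s=1}^a (m_{sj} - \ell)_+ \quad\text{and}\quad b_{\ell} = \sum_{p=1}^b (m_{ip} - \ell)_+ \qquad \text{for } \ell = 0,\ldots,m_{ij}-1.$$ Then $$\deg_Z(P_i \times Q_j) = \{(a_{m_{ij}-1-\ell}-1,\; b_{\ell}-1) \mid \ell = 0,\ldots,m_{ij}-1\}.$$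
   Context: Let $k$ be an algebraically closed field of characteristic zero and $R = k[x_0,x_1,y_0,y_1]$ with the $\mathbb{N}^2$-grading $\deg x_i = (1,0)$, $\deg y_i = (0,1)$; $R$ is the coordinate ring of $\mathbb{P}^1\times\mathbb{P}^1$. Write $(n)_+ = \max\{0,n\}$. Fat points: let $X \subset \mathbb{P}^1\times\mathbb{P}^1$ be a finite set of distinct points, let $P_1,\ldots,P_a$ be the distinct first coordinates occurring in $X$ and $Q_1,\ldots,Q_b$ the distinct second coordinates occurring in $X$. Let $L_{P_i}$ be the form of degree $(1,0)$ vanishing at all points with first coordinate $P_i$, $L_{Q_j}$ the form of degree $(0,1)$ vanishing at all points with second coordinate $Q_j$, and $I_{P_i\times Q_j} = (L_{P_i},L_{Q_j})$. For $1\le i\le a$, $1\le j\le b$, let $m_{ij}$ be a positive integer if $P_i\times Q_j\in X$ and $m_{ij}=0$ otherwise. The set of fat points (fat point scheme) $Z = \{(P_i\times Q_j;m_{ij})\}$, also written $\sum m_{ij}(P_i\times Q_j)$, is the subscheme defined by the saturated bihomogeneous ideal $I_Z = \bigcap_{i,j} I_{P_i\times Q_j}^{m_{ij}}$, where $I^0 := (1)$; $m_{ij}$ is the multiplicity of $P_i\times Q_j$, and $\operatorname{Supp}(Z) = X$. $Z$ is arithmetically Cohen-Macaulay (ACM) if $R/I_Z$ is Cohen-Macaulay. Separators: let $P\in\operatorname{Supp}(Z)$ have multiplicity $m$, and let $Z'$ be the scheme obtained from $Z$ by replacing the multiplicity $m$ of $P$ by $m-1$. A separator of $P$ of multiplicity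 $m$ is a bihomogeneous form $F$ with $F\in I_P^{m-1}\setminus I_P^{m}$ and $F \in I_{P'}^{m'}$ for every other point $P'\in \operatorname{Supp}(Z)$, where $m'$ is the multiplicity of $P'$. A set $\{F_1,\ldots,F_p\}$ of bihomogeneous forms is a set of minimal separators of $P$ of multiplicity $m$ if $I_{Z'}/I_Z = (\overline{F}_1,\ldots,\overline{F}_p)$ as an ideal of $R/I_Z$ and there is no set $\{G_1,\ldots,G_q\}$ with $q<p$ and $I_{Z'}/I_Z = (\overline{G}_1,\ldots,\overline{G}_q)$. The degree of the minimal separators of $P$ of multiplicity $m$ is $\deg_Z(P) = (\deg F_1,\ldots,\deg F_p)$, with $\deg F_i\in\mathbb{N}^2$, where $F_1,\ldots,F_p$ is any set of minimal separators of $P$ of multiplicity $m$; it is regarded as an unordered collection (multiset) of $p$ bidegrees. *)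

theory Defs
  imports
    "HOL-Library.Poly_Mapping"
    "HOL-Library.Extended_Nat"
    "HOL-Library.Multiset"
    "HOL-Computational_Algebra.Computational_Algebra"
    "HOL-Algebra.Algebra"
    "HOL-Algebra.Algebraic_Closure_Type"
begin

section \<open>Cohen-Macaulay rings\<close>

text \<open>
  The second condition says that the i-th element is a non-zero-divisor on the quotient by
  the ideal generated by its predecessors.
\<close>

definition regular_sequence :: "('a, 'b) ring_scheme \<Rightarrow> 'a list \<Rightarrow> bool" where
  "regular_sequence A rs \<longleftrightarrow>
     set rs \<subseteq> carrier A \<and>
     (\<forall>i<length rs. \<forall>y\<in>carrier A.
        rs ! i \<otimes>\<^bsub>A\<^esub> y \<in> genideal A (set (take i rs)) \<longrightarrow> y \<in> genideal A (set (take i rs))) \<and>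
     genideal A (set rs) \<noteq> carrier A"

definition grade :: "('a, 'b) ring_scheme \<Rightarrow> 'a set \<Rightarrow> enat" where
  "grade A I = (SUP rs\<in>{rs. regular_sequence A rs \<and> set rs \<subseteq> I}. enat (length rs))"

definition height :: "('a, 'b) ring_scheme \<Rightarrow> 'a set \<Rightarrow> enat" where
  "height A I =
     (SUP ps\<in>{ps. ps \<noteq> [] \<and> (\<forall>p\<in>set ps. primeideal p A) \<and> sorted_wrt (\<subset>) ps \<and> last ps = I}.
        enat (length ps - 1))"

text \<open>
  Kaplansky's definition (Commutative Rings, Section 3-1).  For a maximal ideal M of a
  Noetherian ring A, the grade of M is the depth of the localization of A at M and the height
  of M is its dimension, so this agrees with the definition by localizations.
\<close>

definition cohen_macaulay :: "('a, 'b) ring_scheme \<Rightarrow> bool" where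
  "cohen_macaulay A \<longleftrightarrow>
     cring A \<and> noetherian_ring A \<and> (\<forall>M. maximalideal M A \<longrightarrow> grade A M = height A M)"


section \<open>The bigraded coordinate ring of P1 x P1\<close>

datatype var = X0 | X1 | Y0 | Y1

type_synonym 'k bipoly = "(var \<Rightarrow>\<^sub>0 nat) \<Rightarrow>\<^sub>0 'k"

abbreviation coord_ring :: "'k::field bipoly ring" where
  "coord_ring \<equiv> ring_of_type_algebra"

definition monom_bidegree :: "(var \<Rightarrow>\<^sub>0 nat) \<Rightarrow> nat \<times> nat" where
  "monom_bidegree t =
     (Poly_Mapping.lookup t X0 + Poly_Mapping.lookup t X1,
      Poly_Mapping.lookup t Y0 + Poly_Mapping.lookup t Y1)"

definition bihomogeneous :: "'k::field bipoly \<Rightarrow> bool" where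
  "bihomogeneous F \<longleftrightarrow> (\<exists>d. \<forall>t\<in>Poly_Mapping.keys F. monom_bidegree t = d)"

text \<open>Only meaningful for nonzero bihomogeneous F.\<close>

definition bidegree :: "'k::field bipoly \<Rightarrow> nat \<times> nat" where
  "bidegree F = (THE d. \<forall>t\<in>Poly_Mapping.keys F. monom_bidegree t = d)"


section \<open>Fat points\<close>

text \<open>
  Points of the projective line are given by homogeneous coordinates, i.e. by nonzero pairs,
  two of which denote the same point iff they are proportional.
\<close>

definition same_point :: "'k::field \<times> 'k \<Rightarrow> 'k \<times> 'k \<Rightarrow> bool" where
  "same_point p q \<longleftrightarrow> (\<exists>c. c \<noteq> 0 \<and> q = (c * fst p, c * snd p))"

text \<open>
  The parameters \<open>a b P Q m\<close> describe the scheme with multiplicity \<open>m i j\<close> at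
  \<open>P i \<times> Q j\<close>, for i in \<open>{1..a}\<close> and j in \<open>{1..b}\<close>; values outside these ranges are
  irrelevant.  The last two conditions say that each \<open>P i\<close> and each \<open>Q j\<close> occurs as a
  coordinate of a point of the support.
\<close>

definition fat_points ::
  "nat \<Rightarrow> nat \<Rightarrow> (nat \<Rightarrow> 'k::field \<times> 'k) \<Rightarrow> (nat \<Rightarrow> 'k \<times> 'k) \<Rightarrow> (nat \<Rightarrow> nat \<Rightarrow> nat) \<Rightarrow> bool" where
  "fat_points a b P Q m \<longleftrightarrow>
     (\<forall>i\<in>{1..a}. P i \<noteq> (0, 0)) \<and>
     (\<forall>j\<in>{1..b}. Q j \<noteq> (0, 0)) \<and>
     (\<forall>i\<in>{1..a}. \<forall>i'\<in>{1..a}. i \<noteq> i' \<longrightarrow> \<not> same_point (P i) (P i')) \<and>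
     (\<forall>j\<in>{1..b}. \<forall>j'\<in>{1..b}. j \<noteq> j' \<longrightarrow> \<not> same_point (Q j) (Q j')) \<and>
     (\<forall>i\<in>{1..a}. \<exists>j\<in>{1..b}. m i j > 0) \<and>
     (\<forall>j\<in>{1..b}. \<exists>i\<in>{1..a}. m i j > 0)"

text \<open>
  Up to a scalar, the unique form of degree (1,0), resp. (0,1), vanishing where the first,
  resp. second, coordinate is p.
\<close>

definition form_x :: "'k::field \<times> 'k \<Rightarrow> 'k bipoly" where
  "form_x p = Poly_Mapping.single (Poly_Mapping.single X0 1) (snd p)
            - Poly_Mapping.single (Poly_Mapping.single X1 1) (fst p)"

definition form_y :: "'k::field \<times> 'k \<Rightarrow> 'k bipoly" where
  "form_y p = Poly_Mapping.single (Poly_Mapping.single Y0 1) (snd p)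
            - Poly_Mapping.single (Poly_Mapping.single Y1 1) (fst p)"

definition point_ideal :: "'k::field \<times> 'k \<Rightarrow> 'k \<times> 'k \<Rightarrow> 'k bipoly set" where
  "point_ideal p q = genideal coord_ring {form_x p, form_y q}"

text \<open>The power is the ideal power, whose zeroth value is the unit ideal.\<close>

definition fat_ideal ::
  "nat \<Rightarrow> nat \<Rightarrow> (nat \<Rightarrow> 'k::field \<times> 'k) \<Rightarrow> (nat \<Rightarrow> 'k \<times> 'k) \<Rightarrow> (nat \<Rightarrow> nat \<Rightarrow> nat) \<Rightarrow> 'k bipoly set" where
  "fat_ideal a b P Q m =
     (\<Inter>i\<in>{1..a}. \<Inter>j\<in>{1..b}. point_ideal (P i) (Q j) [^]\<^bsub>ideals_set coord_ring\<^esub> m i j)"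

definition ACM ::
  "nat \<Rightarrow> nat \<Rightarrow> (nat \<Rightarrow> 'k::field \<times> 'k) \<Rightarrow> (nat \<Rightarrow> 'k \<times> 'k) \<Rightarrow> (nat \<Rightarrow> nat \<Rightarrow> nat) \<Rightarrow> bool" where
  "ACM a b P Q m \<longleftrightarrow> cohen_macaulay (coord_ring Quot fat_ideal a b P Q m)"


section \<open>Minimal separators\<close>

definition lower_mult :: "(nat \<Rightarrow> nat \<Rightarrow> nat) \<Rightarrow> nat \<Rightarrow> nat \<Rightarrow> nat \<Rightarrow> nat \<Rightarrow> nat" where
  "lower_mult m i j = m(i := (m i)(j := m i j - 1))"

text \<open>
  The residue classes of the elements of \<open>G\<close> generate the ideal \<open>I\<^sub>Z\<^sub>' / I\<^sub>Z\<close> of the quotient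
  ring, where Z' is Z with the multiplicity at \<open>P i \<times> Q j\<close> lowered by one.
\<close>

definition generates_separators ::
  "nat \<Rightarrow> nat \<Rightarrow> (nat \<Rightarrow> 'k::field \<times> 'k) \<Rightarrow> (nat \<Rightarrow> 'k \<times> 'k) \<Rightarrow> (nat \<Rightarrow> nat \<Rightarrow> nat) \<Rightarrow>
   nat \<Rightarrow> nat \<Rightarrow> 'k bipoly set \<Rightarrow> bool" where
  "generates_separators a b P Q m i j G \<longleftrightarrow>
     (let I = fat_ideal a b P Q m; I' = fat_ideal a b P Q (lower_mult m i j) in
      (\<lambda>F. I +>\<^bsub>coord_ring\<^esub> F) ` I' =
      genideal (coord_ring Quot I) ((\<lambda>F. I +>\<^bsub>coord_ring\<^esub> F) ` G))"

definition minimal_separators ::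
  "nat \<Rightarrow> nat \<Rightarrow> (nat \<Rightarrow> 'k::field \<times> 'k) \<Rightarrow> (nat \<Rightarrow> 'k \<times> 'k) \<Rightarrow> (nat \<Rightarrow> nat \<Rightarrow> nat) \<Rightarrow>
   nat \<Rightarrow> nat \<Rightarrow> 'k bipoly set \<Rightarrow> bool" where
  "minimal_separators a b P Q m i j Fs \<longleftrightarrow>
     finite Fs \<and> (\<forall>F\<in>Fs. bihomogeneous F) \<and>
     generates_separators a b P Q m i j Fs \<and>
     \<not> (\<exists>G. finite G \<and> card G < card Fs \<and> generates_separators a b P Q m i j G)"

text \<open>
  The degree of the minimal separators is \<open>D\<close>: minimal separators exist, and \<open>D\<close> is the
  multiset of bidegrees of any set of them.
\<close>

definition has_separator_degree ::
  "nat \<Rightarrow> nat \<Rightarrow> (nat \<Rightarrow> 'k::field \<times> 'k) \<Rightarrow> (nat \<Rightarrow> 'k \<times> 'k) \<Rightarrow> (nat \<Rightarrow> nat \<Rightarrow> nat) \<Rightarrow>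
   nat \<Rightarrow> nat \<Rightarrow> (nat \<times> nat) multiset \<Rightarrow> bool" where
  "has_separator_degree a b P Q m i j D \<longleftrightarrow>
     (\<exists>Fs. minimal_separators a b P Q m i j Fs) \<and>
     (\<forall>Fs. minimal_separators a b P Q m i j Fs \<longrightarrow> image_mset bidegree (mset_set Fs) = D)"

end

theory Submission
  imports Defs
begin

text \<open>
  Write \<open>A\<close> and \<open>B\<close> for the forms of degree (1,0) and (0,1) through the point
  \<open>P i \<times> Q j\<close>, let \<open>M + 1\<close> be its multiplicity, and let \<open>L s\<close>, \<open>B p\<close> be the forms of the
  other lines of the grid.  An element of \<open>I\<^sub>Z\<^sub>'\<close> is determined modulo \<open>I\<^sub>Z\<close> by its class in
  \<open>(A, B)\<^sup>M / (A, B)\<^sup>M\<^sup>+\<^sup>1\<close>.  As \<open>A, B\<close> is a regular sequence, this is a free module over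
  \<open>R / (A, B)\<close>, a polynomial ring in one variable \<open>x\<close> of degree (1,0) and one variable \<open>y\<close> of
  degree (0,1), with basis the monomials \<open>A\<^sup>l B\<^sup>M\<^sup>-\<^sup>l\<close> (lemma \<open>quasi_regular\<close>).

  The fat points on the line \<open>B = 0\<close> force the coefficient of \<open>A\<^sup>l B\<^sup>M\<^sup>-\<^sup>l\<close> to be divisible
  modulo \<open>(A, B)\<close> by the product over \<open>s \<noteq> i\<close> of the \<open>L s\<close> with exponents \<open>m s j - (M - l)\<close>;
  those on \<open>A = 0\<close> give divisibility by the \<open>B p\<close> with exponents \<open>m i p - l\<close>, for \<open>p \<noteq> j\<close>
  (lemma \<open>leading_coefficient_divisible\<close>).  These two products become a power of \<open>x\<close> and a power
  of \<open>y\<close>, so their product divides as well.  Hence \<open>I\<^sub>Z\<^sub>' / I\<^sub>Z\<close> lies in the free module on the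
  classes of \<open>A\<^sup>l B\<^sup>M\<^sup>-\<^sup>l\<close> times these products of lines (constant \<open>separator\<close>), and it is
  equal to it as soon as these products lie in \<open>I\<^sub>Z\<^sub>'\<close>.  That is the numerical condition
  \<open>m s p \<le> (m s j - (M - l)) + (m i p - l)\<close> with truncated subtraction.  The minimal number of
  generators of a free module and the degrees of a minimal homogeneous set of generators are then
  read off modulo \<open>x\<close> and \<open>y\<close>; the degree of the l-th basis element is the pair in the theorem.

  The numerical condition is where the Cohen-Macaulay property enters.  Encode the multiplicities
  in a 0-1 matrix with rows \<open>(i, v)\<close>, columns \<open>(j, u)\<close> and entry 1 iff \<open>u + v < m i j\<close>; the
  condition says that the rows are nested.  At the irrelevant maximal ideal the height is at least
  two, which gives a regular sequence of length two there, consisting of arbitrary, not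
  necessarily homogeneous, elements (lemma \<open>cohen_macaulay_regular_pair_of_forms\<close>).  A socle
  argument moves regularity to general linear forms \<open>x\<close> and \<open>y\<close> of degrees (1,0) and (0,1):
  \<open>x\<close> is a non-zero-divisor modulo \<open>I\<^sub>Z + (y)\<close> (lemma \<open>depth_condI_regular_sequence\<close>).  Now
  let \<open>d\<close> be the largest of the sums \<open>\<Sum>j. m s j\<close>.  For a form \<open>\<nu>\<close> of degree (0,1)
  independent of \<open>y\<close>, a power of \<open>x\<close> times \<open>\<nu>\<^sup>d\<close> lies in \<open>I\<^sub>Z + (y)\<close>, and hence so does \<open>\<nu>\<^sup>d\<close>.
  Setting the first two variables to zero turns this into a polynomial \<open>\<nu>\<^sup>d - y w\<close>
  divisible by every \<open>B p\<close> to the power \<open>Max s. m s p\<close>, so that \<open>d\<close> is at least the sum of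
  these maxima, as one sees modulo \<open>y\<close>.  So the index \<open>r\<close> with the largest sum
  dominates all the others entrywise.  Lowering every \<open>m r p\<close> by one removes the row \<open>(r, 0)\<close>
  from the matrix and preserves the regularity (lemma \<open>depth_cond_remove_row\<close>), so nestedness
  follows by induction.
\<close>

section \<open>Ideals, zero divisors and powers of an ideal with two generators\<close>

definition ring_ideal :: "'a::comm_ring_1 set \<Rightarrow> bool" where
  "ring_ideal I \<longleftrightarrow> 0 \<in> I \<and> (\<forall>x\<in>I. \<forall>y\<in>I. x + y \<in> I) \<and> (\<forall>r. \<forall>x\<in>I. r * x \<in> I)"

definition nzd_mod :: "'a::comm_ring_1 \<Rightarrow> 'a set \<Rightarrow> bool" where
  "nzd_mod c I \<longleftrightarrow> (\<forall>z. c * z \<in> I \<longrightarrow> z \<in> I)"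

text \<open>
  The ideal \<open>I + (c)\<close>.
\<close>

definition adjoin :: "'a::comm_ring_1 set \<Rightarrow> 'a \<Rightarrow> 'a set" where
  "adjoin I c = {z. \<exists>w. z - c * w \<in> I}"

definition span2 :: "'a::comm_ring_1 \<Rightarrow> 'a \<Rightarrow> 'a set" where
  "span2 U V = {U * u + V * v | u v. True}"

text \<open>
  The n-th power of the ideal generated by \<open>A\<close> and \<open>B\<close>.  Only the monomial \<open>B ^ n\<close> is split off
  at each step, so that a member is a multiple of \<open>A\<close> up to the single term \<open>B ^ n * G\<close>; this is
  what makes the inductions on \<open>n\<close> below short.
\<close>

primrec pair_power :: "'a::comm_ring_1 \<Rightarrow> 'a \<Rightarrow> nat \<Rightarrow> 'a set" where
  "pair_power A B 0 = UNIV"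
| "pair_power A B (Suc n) = {A * F + B ^ Suc n * G | F G. F \<in> pair_power A B n}"

definition regular_pair :: "'a::idom \<Rightarrow> 'a \<Rightarrow> bool" where
  "regular_pair A B \<longleftrightarrow> A \<noteq> 0 \<and> B \<noteq> 0 \<and> (\<forall>z. A dvd B * z \<longrightarrow> A dvd z)"

lemma ring_idealI:
  "\<lbrakk>0 \<in> I; \<And>x y. \<lbrakk>x \<in> I; y \<in> I\<rbrakk> \<Longrightarrow> x + y \<in> I; \<And>r x. x \<in> I \<Longrightarrow> r * x \<in> I\<rbrakk> \<Longrightarrow> ring_ideal I"
  by (simp add: ring_ideal_def)

lemma
  assumes "ring_ideal I"
  shows ideal_zero: "0 \<in> I"
    and ideal_add: "\<lbrakk>x \<in> I; y \<in> I\<rbrakk> \<Longrightarrow> x + y \<in> I"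
    and ideal_mult_left: "x \<in> I \<Longrightarrow> r * x \<in> I"
    and ideal_mult_right: "x \<in> I \<Longrightarrow> x * r \<in> I"
    and ideal_uminus: "x \<in> I \<Longrightarrow> - x \<in> I"
    and ideal_diff: "\<lbrakk>x \<in> I; y \<in> I\<rbrakk> \<Longrightarrow> x - y \<in> I"
proof -
  show 1: "0 \<in> I" "\<lbrakk>x \<in> I; y \<in> I\<rbrakk> \<Longrightarrow> x + y \<in> I" "x \<in> I \<Longrightarrow> r * x \<in> I" for x y r
    using assms by (auto simp: ring_ideal_def)
  show "x \<in> I \<Longrightarrow> x * r \<in> I" using 1(3)[of x r] by (simp add: mult.commute)
  show 2: "x \<in> I \<Longrightarrow> - x \<in> I" for x using 1(3)[of x "-1"] by simp
  show "\<lbrakk>x \<in> I; y \<in> I\<rbrakk> \<Longrightarrow> x - y \<in> I" using 1(2)[of x "-y"] 2[of y] by simp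
qed

lemma ideal_sum:
  assumes "ring_ideal I" "\<And>s. s \<in> S \<Longrightarrow> f s \<in> I"
  shows "sum f S \<in> I"
  using assms(2) by (induction S rule: infinite_finite_induct)
    (auto intro: ideal_zero[OF assms(1)] ideal_add[OF assms(1)])

lemma nzd_modI: "(\<And>z. c * z \<in> I \<Longrightarrow> z \<in> I) \<Longrightarrow> nzd_mod c I"
  unfolding nzd_mod_def by blast

lemma nzd_modD: "\<lbrakk>nzd_mod c I; c * z \<in> I\<rbrakk> \<Longrightarrow> z \<in> I"
  unfolding nzd_mod_def by blast

lemma nzd_mod_mult: "\<lbrakk>nzd_mod c I; nzd_mod d I\<rbrakk> \<Longrightarrow> nzd_mod (c * d) I"
  by (rule nzd_modI) (metis mult.assoc nzd_modD)

lemma nzd_mod_one: "nzd_mod 1 I"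
  by (rule nzd_modI) simp

lemma nzd_mod_power: "nzd_mod c I \<Longrightarrow> nzd_mod (c ^ k) I"
  by (induction k) (simp_all add: nzd_mod_one nzd_mod_mult)

lemma nzd_mod_prod:
  assumes "\<And>s. s \<in> S \<Longrightarrow> nzd_mod (f s) I"
  shows "nzd_mod (\<Prod>s\<in>S. f s ^ n s) I"
  using assms
  by (induction S rule: infinite_finite_induct)
    (simp_all add: nzd_mod_one nzd_mod_mult nzd_mod_power)

lemma span2E:
  assumes "x \<in> span2 U V"
  obtains u v where "x = U * u + V * v"
  using assms by (auto simp: span2_def)

lemma span2I: "U * u + V * v \<in> span2 U V"
  by (auto simp: span2_def)

lemma ring_ideal_span2: "ring_ideal (span2 U V)"
proof (rule ring_idealI)
  show "0 \<in> span2 U V" using span2I[of U 0 V 0] by simp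
next
  fix x y assume "x \<in> span2 U V" "y \<in> span2 U V"
  then obtain a b c d where "x = U * a + V * b" "y = U * c + V * d" by (metis span2E)
  then have "x + y = U * (a + c) + V * (b + d)" by (simp add: algebra_simps)
  then show "x + y \<in> span2 U V" by (simp only: span2I)
next
  fix r x assume "x \<in> span2 U V"
  then obtain a b where "x = U * a + V * b" by (rule span2E)
  then have "r * x = U * (r * a) + V * (r * b)" by (simp add: algebra_simps)
  then show "r * x \<in> span2 U V" by (simp only: span2I)
qed

lemma span2_iff_dvd: "z \<in> span2 U V \<longleftrightarrow> (\<exists>v. U dvd z - V * v)"
proof
  assume "z \<in> span2 U V"
  then obtain u v where "z = U * u + V * v" by (rule span2E)
  then show "\<exists>v. U dvd z - V * v" by (intro exI[of _ v]) simp
next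
  assume "\<exists>v. U dvd z - V * v"
  then obtain u v where "z - V * v = U * u" unfolding dvd_def by blast
  then have "z = U * u + V * v" by (simp add: algebra_simps)
  then show "z \<in> span2 U V" by (simp only: span2I)
qed

lemma span2_left: "U * u \<in> span2 U V"
  unfolding span2_iff_dvd by (intro exI[of _ 0]) simp

lemma span2_right: "V * v \<in> span2 U V"
  unfolding span2_iff_dvd by (intro exI[of _ v]) simp

text \<open>
  With a zero first generator the statements below about \<open>span2\<close> become statements about
  divisibility.
\<close>

lemma span2_zero_left: "z \<in> span2 0 V \<longleftrightarrow> V dvd z"
  unfolding span2_def dvd_def by auto

lemma span2_commute: "span2 U V = span2 V U"
proof -
  have "span2 U V \<subseteq> span2 V U" for U V :: 'a
    using span2I by (metis add.commute span2E subsetI)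
  then show ?thesis by (simp add: subset_antisym)
qed

lemma span2_mono:
  assumes "U' dvd U" "V' dvd V"
  shows "span2 U V \<subseteq> span2 U' V'"
proof
  fix x assume "x \<in> span2 U V"
  then obtain u v where x: "x = U * u + V * v" by (rule span2E)
  obtain k l where "U = U' * k" "V = V' * l" using assms by (auto elim!: dvdE)
  then have "x = U' * (k * u) + V' * (l * v)" by (simp add: x mult.assoc)
  then show "x \<in> span2 U' V'" by (simp add: span2I)
qed

lemma span2_mult:
  assumes "x \<in> span2 U V" "y \<in> span2 U W"
  shows "x * y \<in> span2 U (V * W)"
proof -
  obtain a b c d where "x = U * a + V * b" "y = U * c + W * d"
    using assms by (metis span2E)
  then have "x * y = U * (a * y + V * b * c) + (V * W) * (b * d)" by (simp add: algebra_simps)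
  then show ?thesis by (simp only: span2I)
qed

lemma adjoinI: "z - c * w \<in> I \<Longrightarrow> z \<in> adjoin I c"
  unfolding adjoin_def by (rule CollectI) (rule exI)

lemma adjoinE:
  assumes "z \<in> adjoin I c"
  obtains w where "z - c * w \<in> I"
  using assms unfolding adjoin_def by blast

lemma ring_ideal_adjoin:
  assumes I: "ring_ideal I"
  shows "ring_ideal (adjoin I c)"
proof (rule ring_idealI)
  show "0 \<in> adjoin I c"
    using adjoinI[of 0 c 0 I] ideal_zero[OF I] by simp
next
  fix x y assume "x \<in> adjoin I c" "y \<in> adjoin I c"
  then obtain u v where "x - c * u \<in> I" "y - c * v \<in> I" by (metis adjoinE)
  then have "(x - c * u) + (y - c * v) \<in> I" by (rule ideal_add[OF I])
  then show "x + y \<in> adjoin I c"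
    by (intro adjoinI[of _ _ "u + v"]) (simp add: algebra_simps)
next
  fix r x assume "x \<in> adjoin I c"
  then obtain u where "x - c * u \<in> I" by (rule adjoinE)
  then have "r * (x - c * u) \<in> I" by (rule ideal_mult_left[OF I])
  then show "r * x \<in> adjoin I c"
    by (intro adjoinI[of _ _ "r * u"]) (simp add: algebra_simps)
qed

lemma subset_adjoin: "I \<subseteq> adjoin I c"
  using adjoinI[of _ c 0 I] by auto

lemma adjoin_gen: "ring_ideal I \<Longrightarrow> c * w \<in> adjoin I c"
  by (rule adjoinI[of _ _ w]) (simp add: ideal_zero)

lemma pair_power_SucE:
  assumes "x \<in> pair_power A B (Suc n)"
  obtains F G where "x = A * F + B ^ Suc n * G" "F \<in> pair_power A B n"
  using assms by auto

lemma pair_power_SucI: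
  "F \<in> pair_power A B n \<Longrightarrow> A * F + B ^ Suc n * G \<in> pair_power A B (Suc n)"
  by auto

lemma ring_ideal_pair_power: "ring_ideal (pair_power A B n)"
proof (induction n)
  case 0
  show ?case by (simp add: ring_ideal_def)
next
  case (Suc n)
  note I = Suc
  show ?case
  proof (rule ring_idealI)
    show "0 \<in> pair_power A B (Suc n)"
      using pair_power_SucI[OF ideal_zero[OF I], of 0] by simp
  next
    fix x y assume "x \<in> pair_power A B (Suc n)" "y \<in> pair_power A B (Suc n)"
    then obtain F G F' G' where "x = A * F + B ^ Suc n * G" "y = A * F' + B ^ Suc n * G'"
      and F: "F \<in> pair_power A B n" "F' \<in> pair_power A B n"
      by (elim pair_power_SucE) blast
    then have "x + y = A * (F + F') + B ^ Suc n * (G + G')" by (simp add: algebra_simps)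
    then show "x + y \<in> pair_power A B (Suc n)"
      using pair_power_SucI[OF ideal_add[OF I F]] by simp
  next
    fix r x assume "x \<in> pair_power A B (Suc n)"
    then obtain F G where "x = A * F + B ^ Suc n * G" and F: "F \<in> pair_power A B n"
      by (rule pair_power_SucE)
    then have "r * x = A * (r * F) + B ^ Suc n * (r * G)" by (simp add: algebra_simps)
    then show "r * x \<in> pair_power A B (Suc n)"
      using pair_power_SucI[OF ideal_mult_left[OF I F]] by simp
  qed
qed

lemma pair_power_mult_left: "F \<in> pair_power A B n \<Longrightarrow> A * F \<in> pair_power A B (Suc n)"
  using pair_power_SucI[of F A B n 0] by simp

lemma power_right_in_pair_power: "B ^ n * G \<in> pair_power A B n"
proof (cases n)
  case (Suc k)
  have "B ^ n * G = A * 0 + B ^ Suc k * G" by (simp add: Suc)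
  then show ?thesis
    using pair_power_SucI[OF ideal_zero[OF ring_ideal_pair_power], of A B k G] by (simp add: Suc)
qed simp

lemma pair_power_mult_right: "F \<in> pair_power A B n \<Longrightarrow> B * F \<in> pair_power A B (Suc n)"
proof (induction n arbitrary: F)
  case 0
  show ?case using pair_power_SucI[of 0 A B 0 F] by simp
next
  case (Suc n)
  from Suc.prems obtain F' G where F: "F = A * F' + B ^ Suc n * G" "F' \<in> pair_power A B n"
    by (rule pair_power_SucE)
  have "B * F = A * (B * F') + B ^ Suc (Suc n) * G" by (simp add: F algebra_simps)
  then show ?case using pair_power_SucI[OF Suc.IH[OF F(2)], of G] by simp
qed

text \<open>
  The recursion treats the two generators differently, but the ideal does not depend on their
  order.  This lets every result about one ruling be used for the other.
\<close>

lemma pair_power_commute: "pair_power A B n = pair_power B A n"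
proof -
  have sub: "pair_power A B n \<subseteq> pair_power B A n" for A B :: 'a
  proof (induction n)
    case (Suc n)
    show ?case
    proof
      fix x assume "x \<in> pair_power A B (Suc n)"
      then obtain F G where x: "x = A * F + B ^ Suc n * G" "F \<in> pair_power A B n"
        by (rule pair_power_SucE)
      have "A * F \<in> pair_power B A (Suc n)"
        using x Suc by (intro pair_power_mult_right) auto
      moreover have "B ^ Suc n * G \<in> pair_power B A (Suc n)"
        unfolding power_Suc mult.assoc
      proof (rule pair_power_mult_left)
        have "B ^ n * G \<in> pair_power A B n" by (rule power_right_in_pair_power)
        then show "B ^ n * G \<in> pair_power B A n" using Suc by auto
      qed
      ultimately show "x \<in> pair_power B A (Suc n)"
        unfolding x(1) by (rule ideal_add[OF ring_ideal_pair_power])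
    qed
  qed simp
  show ?thesis using sub[of A B] sub[of B A] by auto
qed

lemma pair_power_Suc_subset: "pair_power A B (Suc n) \<subseteq> pair_power A B n"
proof
  fix x assume "x \<in> pair_power A B (Suc n)"
  then obtain F G where "x = A * F + B ^ Suc n * G" and F: "F \<in> pair_power A B n"
    by (rule pair_power_SucE)
  then have x: "x = A * F + B ^ n * (B * G)" by (simp add: mult_ac)
  show "x \<in> pair_power A B n"
    unfolding x
    by (intro ideal_add[OF ring_ideal_pair_power] power_right_in_pair_power
        ideal_mult_left[OF ring_ideal_pair_power] F)
qed

lemma pair_power_antimono: "k \<le> n \<Longrightarrow> pair_power A B n \<subseteq> pair_power A B k"
  using lift_Suc_antimono_le[of "pair_power A B" k n] pair_power_Suc_subset by blast

lemma monomial_in_pair_power: "n \<le> l + k \<Longrightarrow> A ^ l * B ^ k * G \<in> pair_power A B n"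
proof -
  have "A ^ l * B ^ k * G \<in> pair_power A B (l + k)"
  proof (induction l)
    case 0
    then show ?case by (simp add: power_right_in_pair_power)
  next
    case (Suc l)
    then show ?case using pair_power_mult_left[OF Suc] by (simp add: mult.assoc)
  qed
  moreover assume "n \<le> l + k"
  ultimately show ?thesis using pair_power_antimono by blast
qed

lemma pair_power_subset_span2: "pair_power A B n \<subseteq> span2 A (B ^ n)"
proof (cases n)
  case 0
  then show ?thesis using span2_right[of "B ^ 0" _ A] by auto
qed (auto simp: span2_def)

lemma pair_power_one: "pair_power A B (Suc 0) = span2 A B"
  by (auto simp: span2_def)

lemma pair_power_mult_span2:
  assumes "F \<in> pair_power A B n" "G \<in> span2 A B"
  shows "F * G \<in> pair_power A B (Suc n)"
proof -
  obtain u v where G: "G = A * u + B * v" using assms(2) by (rule span2E)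
  have "F * G = A * (u * F) + B * (v * F)" by (simp add: G algebra_simps)
  then show ?thesis
    by (simp only:) (intro ideal_add[OF ring_ideal_pair_power] pair_power_mult_left
        pair_power_mult_right ideal_mult_left[OF ring_ideal_pair_power] assms(1))
qed

lemma pair_power_expansion:
  "F \<in> pair_power A B n \<Longrightarrow> \<exists>H. F = (\<Sum>l\<le>n. A ^ l * B ^ (n - l) * H l)"
proof (induction n arbitrary: F)
  case 0
  then show ?case by (auto intro: exI[of _ "\<lambda>_. F"])
next
  case (Suc n)
  from Suc.prems obtain F' G where F: "F = A * F' + B ^ Suc n * G" "F' \<in> pair_power A B n"
    by (rule pair_power_SucE)
  obtain H where H: "F' = (\<Sum>l\<le>n. A ^ l * B ^ (n - l) * H l)" using Suc.IH[OF F(2)] by blast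
  have "F = (\<Sum>l\<le>Suc n. A ^ l * B ^ (Suc n - l) * case_nat G H l)"
    unfolding sum.atMost_Suc_shift F(1) H by (simp add: sum_distrib_left mult.assoc add.commute)
  then show ?case by blast
qed

lemma regular_pairI:
  "\<lbrakk>A \<noteq> 0; B \<noteq> 0; \<And>z. A dvd B * z \<Longrightarrow> A dvd z\<rbrakk> \<Longrightarrow> regular_pair A B"
  unfolding regular_pair_def by blast

lemma regular_pairD:
  assumes "regular_pair A B"
  shows "A \<noteq> 0" "B \<noteq> 0" "A dvd B * z \<Longrightarrow> A dvd z"
  using assms unfolding regular_pair_def by blast+

context
  fixes A B :: "'a::idom"
  assumes reg: "regular_pair A B"
begin

text \<open>
  In a domain a regular sequence of length two may be permuted: if \<open>A z = B w\<close> then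
  \<open>w = A w'\<close>, and cancelling \<open>A\<close> gives \<open>z = B w'\<close>.
\<close>

lemma regular_pair_swap: "regular_pair B A"
proof (rule regular_pairI)
  show "B \<noteq> 0" "A \<noteq> 0" using regular_pairD[OF reg] by blast+
  fix z assume "B dvd A * z"
  then obtain w where w: "A * z = B * w" by (elim dvdE)
  then have "A dvd B * w" by (metis dvd_triv_left)
  then have "A dvd w" by (rule regular_pairD(3)[OF reg])
  then obtain w' where "w = A * w'" by (elim dvdE)
  then have "z = B * w'" using w regular_pairD(1)[OF reg] by (simp add: mult.left_commute)
  then show "B dvd z" by simp
qed

lemma regular_pair_dvd_power_mult: "A dvd B ^ n * z \<Longrightarrow> A dvd z"
proof (induction n)
  case (Suc n)
  from Suc.prems have "A dvd B * (B ^ n * z)" by (simp add: mult.assoc)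
  then have "A dvd B ^ n * z" by (rule regular_pairD(3)[OF reg])
  then show ?case by (rule Suc.IH)
qed simp

lemma regular_pair_power_dvd_mult: "A ^ n dvd B * z \<Longrightarrow> A ^ n dvd z"
proof (induction n arbitrary: z)
  case (Suc n)
  from Suc.prems have "A dvd B * z" by (metis dvd_mult_left power_Suc)
  then obtain z' where z: "z = A * z'" using regular_pairD(3)[OF reg] by (metis dvdE)
  have "A * A ^ n dvd A * (B * z')" using Suc.prems by (simp add: z mult.left_commute)
  then have "A ^ n dvd B * z'" using regular_pairD(1)[OF reg] by simp
  then have "A ^ n dvd z'" by (rule Suc.IH)
  then show ?case by (simp add: z)
qed simp

text \<open>
  In \<open>A v = A F + B ^ Suc n G\<close> the element \<open>A\<close> must divide \<open>G\<close>, so that \<open>A\<close> can be cancelled.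
  For a fat point this says that taking the colon by a line through the point lowers its
  multiplicity by one.
\<close>

lemma pair_power_cancel: "A * v \<in> pair_power A B (Suc n) \<Longrightarrow> v \<in> pair_power A B n"
proof -
  assume "A * v \<in> pair_power A B (Suc n)"
  then obtain F G where v: "A * v = A * F + B ^ Suc n * G" "F \<in> pair_power A B n"
    by (rule pair_power_SucE)
  have "B ^ Suc n * G = A * (v - F)" using v(1) by (simp add: algebra_simps)
  then have "A dvd B ^ Suc n * G" by simp
  then obtain G' where G: "G = A * G'"
    using regular_pair_dvd_power_mult by (metis dvdE)
  have "A * v = A * (F + B ^ n * (B * G'))" using v(1) by (simp add: G algebra_simps)
  then have "v = F + B ^ n * (B * G')" using regular_pairD(1)[OF reg] by simp
  then show "v \<in> pair_power A B n"
    using v(2) by (auto intro: ideal_add[OF ring_ideal_pair_power] power_right_in_pair_power)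
qed

lemma nzd_mod_span2_power:
  assumes "nzd_mod C (span2 A B)"
  shows "nzd_mod C (span2 A (B ^ n))"
proof (induction n)
  case 0
  show ?case using span2_right[of "1::'a"] by (intro nzd_modI) simp
next
  case (Suc n)
  show ?case
  proof (rule nzd_modI)
    fix z assume z: "C * z \<in> span2 A (B ^ Suc n)"
    have "C * z \<in> span2 A (B ^ n)" using z span2_mono[of A A "B ^ n" "B ^ Suc n"] by auto
    then have "z \<in> span2 A (B ^ n)" using Suc by (rule nzd_modD[rotated])
    then obtain u g where zg: "z = A * u + B ^ n * g" by (rule span2E)
    obtain w where "A dvd C * z - B ^ Suc n * w" using z unfolding span2_iff_dvd by blast
    then have "A dvd (C * z - B ^ Suc n * w) - A * (C * u)" by (rule dvd_diff) simp
    also have "(C * z - B ^ Suc n * w) - A * (C * u) = B ^ n * (C * g - B * w)"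
      by (simp add: zg algebra_simps)
    finally have "A dvd C * g - B * w" by (rule regular_pair_dvd_power_mult)
    then have "C * g \<in> span2 A B" unfolding span2_iff_dvd by blast
    then have "g \<in> span2 A B" using assms by (rule nzd_modD[rotated])
    then obtain a b where "g = A * a + B * b" by (rule span2E)
    then have "z = A * (u + B ^ n * a) + B ^ Suc n * b" by (simp add: zg algebra_simps)
    then show "z \<in> span2 A (B ^ Suc n)" by (simp only: span2I)
  qed
qed

text \<open>
  Powers of an ideal generated by a regular sequence have the same non-zero-divisors as the ideal.
  By the previous lemma an element that \<open>C\<close> multiplies into the power is a multiple of \<open>A\<close> up to
  a multiple of \<open>B ^ Suc n\<close>, and cancelling \<open>A\<close> leads back to the exponent \<open>n\<close>.
\<close>

lemma nzd_mod_pair_power: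
  assumes "nzd_mod C (span2 A B)"
  shows "nzd_mod C (pair_power A B n)"
proof (induction n)
  case 0
  show ?case by (rule nzd_modI) simp
next
  case (Suc n)
  show ?case
  proof (rule nzd_modI)
    fix z assume z: "C * z \<in> pair_power A B (Suc n)"
    then have "C * z \<in> span2 A (B ^ Suc n)" using pair_power_subset_span2 by blast
    then have "z \<in> span2 A (B ^ Suc n)"
      by (rule nzd_modD[OF nzd_mod_span2_power[OF assms]])
    then obtain u g where zg: "z = A * u + B ^ Suc n * g" by (rule span2E)
    have "C * z - B ^ Suc n * (C * g) \<in> pair_power A B (Suc n)"
      by (intro ideal_diff[OF ring_ideal_pair_power] z power_right_in_pair_power)
    also have "C * z - B ^ Suc n * (C * g) = A * (C * u)" by (simp add: zg algebra_simps)
    finally have "C * u \<in> pair_power A B n" by (rule pair_power_cancel)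
    then have "u \<in> pair_power A B n" using Suc by (rule nzd_modD[rotated])
    then show "z \<in> pair_power A B (Suc n)" unfolding zg by (rule pair_power_SucI)
  qed
qed

text \<open>
  The monomials of degree \<open>n\<close> in a regular sequence are independent modulo the ideal: the
  associated graded ring is a polynomial ring.  Modulo \<open>A\<close> only the term with \<open>l = 0\<close> survives,
  which puts \<open>D 0\<close> into the ideal; after subtracting it one can cancel \<open>A\<close> and lower \<open>n\<close>.
\<close>

lemma quasi_regular:
  "\<lbrakk>(\<Sum>l\<le>n. A ^ l * B ^ (n - l) * D l) \<in> pair_power A B (Suc n); l \<le> n\<rbrakk> \<Longrightarrow> D l \<in> span2 A B"
proof (induction n arbitrary: D l)
  case 0
  then show ?case by (auto simp: span2_def)
next
  case (Suc n)
  let ?S = "\<Sum>l\<le>n. A ^ l * B ^ (n - l) * D (Suc l)"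
  have eq: "(\<Sum>l\<le>Suc n. A ^ l * B ^ (Suc n - l) * D l) = B ^ Suc n * D 0 + A * ?S"
    unfolding sum.atMost_Suc_shift by (simp add: sum_distrib_left mult.assoc)
  have mem: "B ^ Suc n * D 0 + A * ?S \<in> pair_power A B (Suc (Suc n))"
    using Suc.prems(1) unfolding eq .
  then obtain F G where FG: "B ^ Suc n * D 0 + A * ?S = A * F + B ^ Suc (Suc n) * G"
    by (rule pair_power_SucE)
  have "B ^ Suc n * (D 0 - B * G) = A * (F - ?S)" using FG by (simp add: algebra_simps)
  then have "A dvd B ^ Suc n * (D 0 - B * G)" by simp
  then have "A dvd D 0 - B * G" by (rule regular_pair_dvd_power_mult)
  then obtain e where e: "D 0 - B * G = A * e" by (elim dvdE)
  then have D0: "D 0 = A * e + B * G" by (simp add: algebra_simps)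
  have "B ^ Suc n * D 0 + A * ?S - B ^ Suc (Suc n) * G \<in> pair_power A B (Suc (Suc n))"
    by (intro ideal_diff[OF ring_ideal_pair_power] mem power_right_in_pair_power)
  also have "B ^ Suc n * D 0 + A * ?S - B ^ Suc (Suc n) * G = A * (B ^ Suc n * e + ?S)"
    by (simp add: D0 algebra_simps)
  finally have "B ^ Suc n * e + ?S \<in> pair_power A B (Suc n)" by (rule pair_power_cancel)
  then have "B ^ Suc n * e + ?S - B ^ Suc n * e \<in> pair_power A B (Suc n)"
    by (intro ideal_diff[OF ring_ideal_pair_power] power_right_in_pair_power)
  then have "?S \<in> pair_power A B (Suc n)" by simp
  then have IH: "D (Suc k) \<in> span2 A B" if "k \<le> n" for k
    using Suc.IH[of "\<lambda>l. D (Suc l)" k] that by blast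
  show ?case
  proof (cases l)
    case 0
    then show ?thesis using 0 D0 span2I[of A e B G] by simp
  next
    case (Suc k)
    then show ?thesis using IH Suc.prems(2) by simp
  qed
qed

end

lemma regular_pair_monomial_dvd:
  assumes "regular_pair A B" "A ^ e dvd h" "B ^ f dvd h"
  shows "A ^ e * B ^ f dvd h"
proof -
  obtain g where g: "h = B ^ f * g" using assms(3) by (elim dvdE)
  have "A ^ e dvd B ^ k * g \<Longrightarrow> A ^ e dvd g" for k
    by (induction k) (auto simp: mult.assoc dest: regular_pair_power_dvd_mult[OF assms(1)])
  then show ?thesis using assms(2) by (simp add: g mult.commute mult_dvd_mono)
qed

text \<open>
  A Chinese remainder statement for principal ideals modulo \<open>B\<close>: a common multiple of pairwise
  coprime powers is a multiple of their product.
\<close>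

lemma span2_prod_power:
  fixes L :: "'s \<Rightarrow> 'a::comm_ring_1"
  assumes "finite S"
    and "\<And>s t. \<lbrakk>s \<in> S; t \<in> S; s \<noteq> t\<rbrakk> \<Longrightarrow> nzd_mod (L s) (span2 B (L t ^ n t))"
    and "\<And>s. s \<in> S \<Longrightarrow> v \<in> span2 B (L s ^ n s)"
  shows "v \<in> span2 B (\<Prod>s\<in>S. L s ^ n s)"
  using assms
proof (induction S rule: finite_induct)
  case empty
  then show ?case using span2_right[of 1 v B] by simp
next
  case (insert t S)
  let ?\<Pi> = "\<Prod>s\<in>S. L s ^ n s"
  have "v \<in> span2 B ?\<Pi>" using insert by blast
  then obtain a w where v: "v = B * a + ?\<Pi> * w" by (rule span2E)
  have "v - B * a \<in> span2 B (L t ^ n t)"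
    by (intro ideal_diff[OF ring_ideal_span2] span2_left) (use insert in blast)
  then have "?\<Pi> * w \<in> span2 B (L t ^ n t)" by (simp add: v)
  moreover have "nzd_mod ?\<Pi> (span2 B (L t ^ n t))"
    by (rule nzd_mod_prod) (use insert in auto)
  ultimately have "w \<in> span2 B (L t ^ n t)" by (rule nzd_modD[rotated])
  then obtain c d where "w = B * c + L t ^ n t * d" by (rule span2E)
  then have "v = B * (a + ?\<Pi> * c) + (\<Prod>s\<in>insert t S. L s ^ n s) * d"
    using insert by (simp add: v algebra_simps)
  then show ?case by (simp only: span2I)
qed

text \<open>
  Geometrically, \<open>v\<close> vanishes to order \<open>n s\<close> at the points where the lines \<open>L s\<close> meet the line
  \<open>B = 0\<close>.  Restricting to that line shows that \<open>v\<close> is a multiple of the product of the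
  \<open>L s ^ n s\<close> modulo \<open>B\<close>; after subtracting this multiple one can divide by \<open>B\<close>, which lowers all
  orders by one, and repeat.
\<close>

lemma fat_line_expansion:
  fixes L :: "'s \<Rightarrow> 'a::idom"
  assumes fin: "finite S"
    and reg: "\<And>s. s \<in> S \<Longrightarrow> regular_pair B (L s)"
    and nzd: "\<And>s t. \<lbrakk>s \<in> S; t \<in> S; s \<noteq> t\<rbrakk> \<Longrightarrow> nzd_mod (L s) (span2 B (L t))"
    and v: "\<And>s. s \<in> S \<Longrightarrow> v \<in> pair_power B (L s) (n s)"
  shows "\<exists>G T. v = (\<Sum>u<N. B ^ u * (\<Prod>s\<in>S. L s ^ (n s - u)) * G u) + B ^ N * T"
  using v
proof (induction N arbitrary: v n)
  case 0
  then show ?case by (auto intro: exI[of _ v])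
next
  case (Suc N)
  let ?\<Pi> = "\<Prod>s\<in>S. L s ^ n s"
  have "v \<in> span2 B ?\<Pi>"
  proof (rule span2_prod_power[OF fin])
    show "nzd_mod (L s) (span2 B (L t ^ n t))" if "s \<in> S" "t \<in> S" "s \<noteq> t" for s t
      using nzd_mod_span2_power[OF reg nzd] that by blast
    show "v \<in> span2 B (L s ^ n s)" if "s \<in> S" for s
      using Suc.prems[OF that] pair_power_subset_span2 by blast
  qed
  then obtain v' g where v: "v = B * v' + ?\<Pi> * g" by (rule span2E)
  have "v' \<in> pair_power B (L s) (n s - 1)" if s: "s \<in> S" for s
  proof (cases "n s")
    case (Suc k)
    have "?\<Pi> = L s ^ n s * (\<Prod>s\<in>S - {s}. L s ^ n s)"
      using fin s by (rule prod.remove)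
    then have "?\<Pi> * g \<in> pair_power B (L s) (n s)"
      by (simp only: mult.assoc power_right_in_pair_power)
    then have "v - ?\<Pi> * g \<in> pair_power B (L s) (n s)"
      by (intro ideal_diff[OF ring_ideal_pair_power] Suc.prems s)
    then show ?thesis using pair_power_cancel[OF reg[OF s], of v' k] by (simp add: v Suc)
  qed simp
  from Suc.IH[OF this] obtain G T where
    v': "v' = (\<Sum>u<N. B ^ u * (\<Prod>s\<in>S. L s ^ (n s - 1 - u)) * G u) + B ^ N * T" by blast
  have "v = (\<Sum>u<Suc N. B ^ u * (\<Prod>s\<in>S. L s ^ (n s - u)) * case_nat g G u) + B ^ Suc N * T"
    unfolding sum.lessThan_Suc_shift v v'
    by (simp add: algebra_simps sum_distrib_left)
  then show ?case by blast
qed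

text \<open>
  The expansion along the line \<open>B = 0\<close> has the divisibility built in, and quasi-regularity shows
  that its coefficients agree with those of any other expansion at the point \<open>L i = B = 0\<close>.
\<close>

lemma leading_coefficient_divisible:
  fixes L :: "'s \<Rightarrow> 'a::idom"
  assumes fin: "finite S" and i: "i \<in> S" and ni: "n i = M"
    and reg: "\<And>s. s \<in> S \<Longrightarrow> regular_pair B (L s)"
    and nzd: "\<And>s t. \<lbrakk>s \<in> S; t \<in> S; s \<noteq> t\<rbrakk> \<Longrightarrow> nzd_mod (L s) (span2 B (L t))"
    and v: "\<And>s. s \<in> S \<Longrightarrow> v \<in> pair_power B (L s) (n s)"
    and H: "v = (\<Sum>u\<le>M. B ^ u * L i ^ (M - u) * H u)"
    and u: "u \<le> M"
  shows "\<exists>g. H u - (\<Prod>s\<in>S - {i}. L s ^ (n s - u)) * g \<in> span2 B (L i)"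
proof -
  let ?\<Phi> = "\<lambda>u. \<Prod>s\<in>S - {i}. L s ^ (n s - u)"
  have "\<exists>G T. v = (\<Sum>u<Suc M. B ^ u * (\<Prod>s\<in>S. L s ^ (n s - u)) * G u) + B ^ Suc M * T"
    by (rule fat_line_expansion[OF fin]) (fact reg nzd v)+
  then obtain G T where
    G: "v = (\<Sum>u<Suc M. B ^ u * (\<Prod>s\<in>S. L s ^ (n s - u)) * G u) + B ^ Suc M * T"
    by blast
  have \<Phi>: "(\<Prod>s\<in>S. L s ^ (n s - u)) = L i ^ (M - u) * ?\<Phi> u" for u
    using fin i ni by (simp add: prod.remove)
  have "(\<Sum>u\<le>M. B ^ u * L i ^ (M - u) * (H u - ?\<Phi> u * G u)) =
      v - (\<Sum>u<Suc M. B ^ u * (\<Prod>s\<in>S. L s ^ (n s - u)) * G u)"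
    unfolding \<Phi> H lessThan_Suc_atMost by (simp add: algebra_simps sum_subtractf)
  also have "\<dots> = B ^ Suc M * T" by (subst G) simp
  also have "\<dots> \<in> pair_power B (L i) (Suc M)"
    using power_right_in_pair_power[of B "Suc M" T "L i"] by (simp only: pair_power_commute[of B])
  finally have "H u - ?\<Phi> u * G u \<in> span2 B (L i)"
    by (rule quasi_regular[OF reg[OF i] _ u])
  then show ?thesis by blast
qed

declare pair_power.simps(2) [simp del]

section \<open>Regular sequences of length two\<close>

lemma nzd_mod_adjoin_power:
  assumes I: "ring_ideal I" and f: "nzd_mod f I" and g: "nzd_mod g (adjoin I f)"
  shows "nzd_mod g (adjoin I (f ^ k))"
proof (induction k)
  case 0
  show ?case using adjoin_gen[OF I, of 1] by (intro nzd_modI) simp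
next
  case (Suc k)
  show ?case
  proof (rule nzd_modI)
    fix z assume "g * z \<in> adjoin I (f ^ Suc k)"
    then obtain w where w: "g * z - f ^ Suc k * w \<in> I" by (rule adjoinE)
    then have "g * z \<in> adjoin I (f ^ k)"
      by (intro adjoinI[of _ _ "f * w"]) (simp add: mult_ac)
    then have "z \<in> adjoin I (f ^ k)" by (rule nzd_modD[OF Suc])
    then obtain u where u: "z - f ^ k * u \<in> I" by (rule adjoinE)
    have "(g * z - f ^ Suc k * w) - g * (z - f ^ k * u) \<in> I"
      by (intro ideal_diff[OF I] w ideal_mult_left[OF I] u)
    also have "(g * z - f ^ Suc k * w) - g * (z - f ^ k * u) = f ^ k * (g * u - f * w)"
      by (simp add: algebra_simps)
    finally have "g * u - f * w \<in> I" by (rule nzd_modD[OF nzd_mod_power[OF f]])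
    then have "u \<in> adjoin I f" by (rule nzd_modD[OF g adjoinI])
    then obtain u' where u': "u - f * u' \<in> I" by (rule adjoinE)
    have "(z - f ^ k * u) + f ^ k * (u - f * u') \<in> I"
      by (intro ideal_add[OF I] u ideal_mult_left[OF I] u')
    then show "z \<in> adjoin I (f ^ Suc k)"
      by (intro adjoinI[of _ _ u']) (simp add: algebra_simps)
  qed
qed

text \<open>
  If powers of both members of a regular sequence \<open>f, g\<close> multiply \<open>z\<close> into the ideal
  \<open>I + (h)\<close>, for a non-zero-divisor \<open>h\<close> modulo \<open>I\<close>, then \<open>z\<close> is already there.  In terms of
  local cohomology: depth two modulo \<open>I\<close> leaves no torsion after dividing by \<open>h\<close>.
  Writing \<open>f ^ k z = h w\<close> and \<open>g ^ l z = h w'\<close> modulo \<open>I\<close>, the relation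
  \<open>g ^ l w = f ^ k w'\<close> shows that \<open>w\<close> is a multiple of \<open>f ^ k\<close>, which is then cancelled.
\<close>

lemma regular_sequence_socle:
  assumes I: "ring_ideal I" and f: "nzd_mod f I" and g: "nzd_mod g (adjoin I f)"
    and h: "nzd_mod h I"
    and fz: "f ^ k * z \<in> adjoin I h" and gz: "g ^ l * z \<in> adjoin I h"
  shows "z \<in> adjoin I h"
proof -
  obtain w w' where w: "f ^ k * z - h * w \<in> I" and w': "g ^ l * z - h * w' \<in> I"
    using fz gz by (metis adjoinE)
  have "f ^ k * (g ^ l * z - h * w') - g ^ l * (f ^ k * z - h * w) \<in> I"
    by (intro ideal_diff[OF I] ideal_mult_left[OF I] w w')
  also have "f ^ k * (g ^ l * z - h * w') - g ^ l * (f ^ k * z - h * w) =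
      h * (g ^ l * w - f ^ k * w')"
    by (simp add: algebra_simps)
  finally have "g ^ l * w - f ^ k * w' \<in> I" by (rule nzd_modD[OF h])
  then have "g ^ l * w \<in> adjoin I (f ^ k)" by (rule adjoinI)
  then have "w \<in> adjoin I (f ^ k)"
    by (rule nzd_modD[OF nzd_mod_power[OF nzd_mod_adjoin_power[OF I f g]]])
  then obtain w'' where w'': "w - f ^ k * w'' \<in> I" by (rule adjoinE)
  have "(f ^ k * z - h * w) + h * (w - f ^ k * w'') \<in> I"
    by (intro ideal_add[OF I] ideal_mult_left[OF I] w w'')
  also have "(f ^ k * z - h * w) + h * (w - f ^ k * w'') = f ^ k * (z - h * w'')"
    by (simp add: algebra_simps)
  finally have "z - h * w'' \<in> I" by (rule nzd_modD[OF nzd_mod_power[OF f]])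
  then show ?thesis by (rule adjoinI)
qed

lemma ring_ideal_radical:
  assumes I: "ring_ideal I"
  shows "ring_ideal {c. \<exists>k. c ^ k \<in> I}"
proof (rule ring_idealI)
  show "0 \<in> {c. \<exists>k. c ^ k \<in> I}" using ideal_zero[OF I] by (auto intro: exI[of _ 1])
next
  fix c d assume "c \<in> {c. \<exists>k. c ^ k \<in> I}" "d \<in> {c. \<exists>k. c ^ k \<in> I}"
  then obtain k l where c: "c ^ k \<in> I" and d: "d ^ l \<in> I" by blast
  have "of_nat (k + l choose i) * c ^ i * d ^ (k + l - i) \<in> I" for i
  proof (cases "k \<le> i")
    case True
    then have "c ^ i = c ^ k * c ^ (i - k)" by (simp flip: power_add)
    then have "c ^ i \<in> I" using ideal_mult_right[OF I c] by simp
    then show ?thesis by (intro ideal_mult_right[OF I] ideal_mult_left[OF I])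
  next
    case False
    then have "d ^ (k + l - i) = d ^ l * d ^ (k - i)"
      by (simp add: add.commute flip: power_add)
    then have "d ^ (k + l - i) \<in> I" using ideal_mult_right[OF I d] by simp
    then show ?thesis by (intro ideal_mult_left[OF I])
  qed
  then have "(c + d) ^ (k + l) \<in> I"
    unfolding binomial_ring by (intro ideal_sum[OF I])
  then show "c + d \<in> {c. \<exists>k. c ^ k \<in> I}" by blast
next
  fix r c assume "c \<in> {c. \<exists>k. c ^ k \<in> I}"
  then obtain k where "c ^ k \<in> I" by blast
  then have "(r * c) ^ k \<in> I" using ideal_mult_left[OF I] by (simp add: power_mult_distrib)
  then show "r * c \<in> {c. \<exists>k. c ^ k \<in> I}" by blast
qed

lemma ring_ideal_colon:
  assumes I: "ring_ideal I"
  shows "ring_ideal {c. c * z \<in> I}"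
  by (rule ring_idealI)
    (simp_all add: ideal_zero[OF I] ideal_add[OF I] ideal_mult_left[OF I] distrib_right mult.assoc)

text \<open>
  An element of every \<open>(x, L s)\<close> has a power in \<open>(x, \<Prod>s. L s ^ n s)\<close>: multiply out and
  collect the terms divisible by \<open>x\<close>.
\<close>

lemma power_in_span2_prod:
  assumes "\<And>s. s \<in> S \<Longrightarrow> c \<in> span2 x (L s)"
  shows "c ^ (\<Sum>s\<in>S. n s) \<in> span2 x (\<Prod>s\<in>S. L s ^ n s)"
proof -
  have one: "(1 :: 'b) \<in> span2 x 1" using span2_right[of 1 1] by simp
  have pow: "c ^ k \<in> span2 x (l ^ k)" if "c \<in> span2 x l" for l k
    by (induction k) (simp_all add: one span2_mult that)
  show ?thesis
    using assms
    by (induction S rule: infinite_finite_induct) (simp_all add: one span2_mult pow power_add)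
qed

section \<open>Substitutions in the coordinate ring\<close>

text \<open>
  A linear order on the variables extends to the monomials, and leading monomials show that the
  coordinate ring is a domain.
\<close>

instantiation var :: linorder
begin

primrec var_rank :: "var \<Rightarrow> nat" where
  "var_rank X0 = 0"
| "var_rank X1 = 1"
| "var_rank Y0 = 2"
| "var_rank Y1 = 3"

definition less_eq_var :: "var \<Rightarrow> var \<Rightarrow> bool" where
  "less_eq_var v w \<longleftrightarrow> var_rank v \<le> var_rank w"

definition less_var :: "var \<Rightarrow> var \<Rightarrow> bool" where
  "less_var v w \<longleftrightarrow> var_rank v < var_rank w"

instance
proof
  fix v w :: var
  show "v \<le> w \<Longrightarrow> w \<le> v \<Longrightarrow> v = w"
    by (cases v; cases w) (simp_all add: less_eq_var_def)
qed (auto simp: less_eq_var_def less_var_def)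

end

lemma UNIV_var: "(UNIV :: var set) = {X0, X1, Y0, Y1}"
  using var.exhaust by auto

instance var :: finite
  by standard (simp add: UNIV_var)

definition const :: "'k::field \<Rightarrow> 'k bipoly" where
  "const c = Poly_Mapping.single 0 c"

definition variable :: "var \<Rightarrow> 'k::field bipoly" where
  "variable v = Poly_Mapping.single (Poly_Mapping.single v 1) 1"

definition const_term :: "'k::field bipoly \<Rightarrow> 'k" where
  "const_term F = Poly_Mapping.lookup F 0"

text \<open>
  The k-algebra endomorphism of the coordinate ring that sends each variable \<open>v\<close> to \<open>h v\<close>.
  All restrictions to points and lines below are of this form, with image a smaller polynomial
  ring inside the same ring.
\<close>

definition subst :: "(var \<Rightarrow> 'k::field bipoly) \<Rightarrow> 'k bipoly \<Rightarrow> 'k bipoly" where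
  "subst h F = (\<Sum>t\<in>Poly_Mapping.keys F.
     const (Poly_Mapping.lookup F t) * (\<Prod>v\<in>UNIV. h v ^ Poly_Mapping.lookup t v))"

lemma const_0 [simp]: "const 0 = 0"
  and const_1 [simp]: "const 1 = 1"
  and const_add: "const (c + d) = const c + const d"
  and const_mult: "const (c * d) = const c * const d"
  and const_eq_0_iff [simp]: "const c = 0 \<longleftrightarrow> c = 0"
  by (auto simp: const_def single_add mult_single
      dest: arg_cong[of "Poly_Mapping.single 0 c" 0 "\<lambda>p. Poly_Mapping.lookup p 0"])

lemma const_diff: "const (c - d) = const c - const d"
  by (simp add: const_def single_diff)

lemma const_power: "const (c ^ n) = const c ^ n"
  by (induction n) (simp_all add: const_mult)

lemma const_inverse: "c \<noteq> 0 \<Longrightarrow> const c * const (inverse c) = 1"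
  by (simp flip: const_mult)

lemma bipoly_eq_sum_monomials:
  fixes F :: "'k::field bipoly"
  shows "F = (\<Sum>t\<in>Poly_Mapping.keys F. Poly_Mapping.single t (Poly_Mapping.lookup F t))"
proof (rule poly_mapping_eqI)
  fix t
  have "(\<Sum>s\<in>Poly_Mapping.keys F. Poly_Mapping.lookup (Poly_Mapping.single s (Poly_Mapping.lookup F s)) t)
      = (\<Sum>s\<in>Poly_Mapping.keys F. if t = s then Poly_Mapping.lookup F s else 0)"
    by (intro sum.cong) (auto simp: lookup_single when_def)
  then show "Poly_Mapping.lookup F t =
      Poly_Mapping.lookup (\<Sum>t\<in>Poly_Mapping.keys F. Poly_Mapping.single t (Poly_Mapping.lookup F t)) t"
    by (simp add: lookup_sum sum.delta' in_keys_iff)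
qed

lemma subst_superset:
  assumes "finite S" "Poly_Mapping.keys F \<subseteq> S"
  shows "subst h F = (\<Sum>t\<in>S.
     const (Poly_Mapping.lookup F t) * (\<Prod>v\<in>UNIV. h v ^ Poly_Mapping.lookup t v))"
  unfolding subst_def
  by (rule sum.mono_neutral_left[OF assms]) (simp add: in_keys_iff)

lemma subst_add: "subst h (F + G) = subst h F + subst h G"
proof -
  let ?S = "Poly_Mapping.keys F \<union> Poly_Mapping.keys G"
  have "Poly_Mapping.keys (F + G) \<subseteq> ?S" by (rule keys_add)
  then show ?thesis
    by (simp add: subst_superset[of ?S] lookup_add const_add distrib_right sum.distrib)
qed

lemma subst_0 [simp]: "subst h 0 = 0"
  by (simp add: subst_def)

lemma subst_sum: "subst h (\<Sum>s\<in>S. F s) = (\<Sum>s\<in>S. subst h (F s))"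
  by (induction S rule: infinite_finite_induct) (simp_all add: subst_add)

lemma subst_single:
  "subst h (Poly_Mapping.single t c) = const c * (\<Prod>v\<in>UNIV. h v ^ Poly_Mapping.lookup t v)"
  by (simp add: subst_superset[of "{t}"])

lemma subst_mult: "subst h (F * G) = subst h F * subst h G"
proof -
  have single: "subst h (Poly_Mapping.single s c * Poly_Mapping.single t d) =
      subst h (Poly_Mapping.single s c) * subst h (Poly_Mapping.single t d)" for s t c d
    by (simp add: mult_single subst_single const_mult lookup_add power_add prod.distrib mult_ac)
  have "subst h (F * G) = subst h ((\<Sum>s\<in>Poly_Mapping.keys F. Poly_Mapping.single s (Poly_Mapping.lookup F s)) *
      (\<Sum>t\<in>Poly_Mapping.keys G. Poly_Mapping.single t (Poly_Mapping.lookup G t)))"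
    by (simp flip: bipoly_eq_sum_monomials)
  also have "\<dots> = subst h (\<Sum>s\<in>Poly_Mapping.keys F. Poly_Mapping.single s (Poly_Mapping.lookup F s)) *
      subst h (\<Sum>t\<in>Poly_Mapping.keys G. Poly_Mapping.single t (Poly_Mapping.lookup G t))"
    by (simp add: sum_product subst_sum single)
  finally show ?thesis by (simp flip: bipoly_eq_sum_monomials)
qed

lemma subst_const [simp]: "subst h (const c) = const c"
  by (simp add: const_def subst_single)

lemma subst_1 [simp]: "subst h 1 = 1"
  using subst_const[of h 1] by simp

lemma subst_uminus: "subst h (- F) = - subst h F"
  using subst_add[of h F "- F"] by (simp add: eq_neg_iff_add_eq_0 add.commute)

lemma subst_diff: "subst h (F - G) = subst h F - subst h G"
  using subst_add[of h F "- G"] by (simp add: subst_uminus)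

lemma subst_power: "subst h (F ^ n) = subst h F ^ n"
  by (induction n) (simp_all add: subst_mult)

lemma subst_prod: "subst h (\<Prod>s\<in>S. F s) = (\<Prod>s\<in>S. subst h (F s))"
  by (induction S rule: infinite_finite_induct) (simp_all add: subst_mult)

lemma subst_variable [simp]: "subst h (variable v) = h v"
proof -
  have "subst h (variable v) = (\<Prod>w\<in>UNIV. if w = v then h w else 1)"
    unfolding variable_def subst_single
    unfolding const_1 mult_1_left
    by (rule prod.cong) (auto simp: lookup_single when_def)
  also have "\<dots> = h v"
    by (simp add: prod.delta)
  finally show ?thesis .
qed

lemmas subst_simps = subst_add subst_mult subst_diff subst_uminus subst_power subst_prod subst_sum

lemma power_variable: "variable v ^ n = Poly_Mapping.single (Poly_Mapping.single v n) (1::'k::field)"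
proof (induction n)
  case (Suc n)
  then show ?case by (simp add: variable_def mult_single flip: single_add)
qed simp

lemma poly_mapping_var_expand:
  "Poly_Mapping.single X0 (Poly_Mapping.lookup t X0) + Poly_Mapping.single X1 (Poly_Mapping.lookup t X1) +
   Poly_Mapping.single Y0 (Poly_Mapping.lookup t Y0) + Poly_Mapping.single Y1 (Poly_Mapping.lookup t Y1) = t"
proof (rule poly_mapping_eqI)
  fix v :: var
  show "Poly_Mapping.lookup (Poly_Mapping.single X0 (Poly_Mapping.lookup t X0) +
   Poly_Mapping.single X1 (Poly_Mapping.lookup t X1) +
   Poly_Mapping.single Y0 (Poly_Mapping.lookup t Y0) +
   Poly_Mapping.single Y1 (Poly_Mapping.lookup t Y1)) v = Poly_Mapping.lookup t v"
    by (cases v) (simp_all add: lookup_add lookup_single)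
qed

lemma single_eq_const_mult_monomial:
  "Poly_Mapping.single t c = const c * (\<Prod>v\<in>UNIV. variable v ^ Poly_Mapping.lookup t v)"
proof -
  have "(\<Prod>v\<in>UNIV. variable v ^ Poly_Mapping.lookup t v) = Poly_Mapping.single t (1::'a)"
    by (simp add: UNIV_var power_variable mult_single poly_mapping_var_expand add.assoc[symmetric])
  then show ?thesis by (simp add: const_def mult_single)
qed

text \<open>
  If \<open>h\<close> moves each variable only within its class modulo \<open>I\<close>, the substitution does so for every
  polynomial.  This is how the kernels of the restriction maps are found.
\<close>

lemma subst_cong_mod:
  assumes I: "ring_ideal I" and h: "\<And>v. variable v - h v \<in> I"
  shows "F - subst h F \<in> I"
proof -
  have diff_prod: "\<lbrakk>a - b \<in> I; c - d \<in> I\<rbrakk> \<Longrightarrow> a * c - b * d \<in> I" for a b c d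
  proof -
    assume "a - b \<in> I" "c - d \<in> I"
    then have "(a - b) * c + b * (c - d) \<in> I"
      by (intro ideal_add[OF I] ideal_mult_left[OF I] ideal_mult_right[OF I])
    then show ?thesis by (simp add: algebra_simps)
  qed
  have pow: "variable v ^ n - h v ^ n \<in> I" for v n
    by (induction n) (simp_all add: ideal_zero[OF I] diff_prod h)
  have prod: "(\<Prod>v\<in>S. variable v ^ n v) - (\<Prod>v\<in>S. h v ^ n v) \<in> I" for S n
    by (induction S rule: infinite_finite_induct) (simp_all add: ideal_zero[OF I] diff_prod pow)
  have "F - subst h F = (\<Sum>t\<in>Poly_Mapping.keys F. const (Poly_Mapping.lookup F t) *
      ((\<Prod>v\<in>UNIV. variable v ^ Poly_Mapping.lookup t v) - (\<Prod>v\<in>UNIV. h v ^ Poly_Mapping.lookup t v)))"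
    by (subst bipoly_eq_sum_monomials[of F])
      (simp add: subst_def single_eq_const_mult_monomial right_diff_distrib sum_subtractf)
  then show ?thesis
    by (simp only:) (intro ideal_sum[OF I] ideal_mult_left[OF I] prod)
qed

lemma const_const_term: "const (const_term F) = subst (\<lambda>_. 0) F"
proof -
  have "const (Poly_Mapping.lookup F t) * (\<Prod>v\<in>UNIV. 0 ^ Poly_Mapping.lookup t v)
      = (if t = 0 then const (Poly_Mapping.lookup F t) else 0)" for t
  proof (cases "t = 0")
    case False
    then obtain v where "Poly_Mapping.lookup t v \<noteq> 0"
      by (metis poly_mapping_eqI lookup_zero)
    then have "(\<Prod>v\<in>UNIV. 0 ^ Poly_Mapping.lookup t v) = (0 :: 'a bipoly)"
      by (intro prod_zero) (auto intro!: bexI[of _ v])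
    then show ?thesis using False by simp
  qed simp
  then show ?thesis
    by (simp add: subst_def const_term_def in_keys_iff)
qed

lemma const_inject: "const c = const d \<longleftrightarrow> c = d"
  by (metis const_def lookup_single_eq)

lemma const_term_simps:
  "const_term (F + G) = const_term F + const_term G"
  "const_term (F - G) = const_term F - const_term G"
  "const_term (F * G) = const_term F * const_term G"
  "const_term (const c) = c"
  "const_term (\<Sum>s\<in>S. f s) = (\<Sum>s\<in>S. const_term (f s))"
  by (simp_all add: const_add const_diff const_mult const_const_term subst_simps flip: const_inject)
    (induction S rule: infinite_finite_induct;
     simp add: const_add const_const_term subst_simps)

lemma const_term_0 [simp]: "const_term 0 = 0"
  by (simp add: const_term_def)

lemma const_term_1 [simp]: "const_term 1 = 1"
  by (simp add: const_term_def lookup_one)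

lemma const_term_variable [simp]: "const_term (variable v) = 0"
  by (simp add: const_const_term flip: const_inject)

lemma ring_ideal_const_term: "ring_ideal {F. const_term F = 0}"
  by (rule ring_idealI) (simp_all add: const_term_simps)

lemma const_term_ideal_variables:
  assumes I: "ring_ideal I" and "\<And>v. variable v \<in> I" and "const_term F = 0"
  shows "F \<in> I"
proof -
  have "F - subst (\<lambda>_. 0) F \<in> I"
    using assms by (intro subst_cong_mod) simp_all
  then show ?thesis using assms(3) by (simp flip: const_const_term)
qed

text \<open>
  An element without constant term is not a unit, so its powers can be compared by divisibility.
\<close>

lemma power_dvd_power_const_term:
  assumes "F \<noteq> 0" "const_term F = 0" "F ^ m dvd F ^ n"
  shows "m \<le> n"
proof (rule ccontr)
  assume "\<not> m \<le> n"
  then obtain k where m: "m = n + Suc k" using less_natE by (metis add_Suc_right not_le)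
  obtain G where "F ^ n = F ^ m * G" using assms(3) by (elim dvdE)
  then have "F ^ n * 1 = F ^ n * (F * (F ^ k * G))" by (simp add: m power_add mult_ac)
  then have "1 = F * (F ^ k * G)" using assms(1) by (simp only: mult_cancel_left) simp
  then have "const_term 1 = const_term (F * (F ^ k * G))" by (rule arg_cong)
  then show False using assms(2) by (simp add: const_term_simps(3))
qed

section \<open>Linear forms and restriction to lines and points\<close>

lemma form_x_eq: "form_x p = const (snd p) * variable X0 - const (fst p) * variable X1"
  by (simp add: form_x_def const_def variable_def mult_single)

lemma form_y_eq: "form_y p = const (snd p) * variable Y0 - const (fst p) * variable Y1"
  by (simp add: form_y_def const_def variable_def mult_single)

lemma const_term_form [simp]: "const_term (form_x p) = 0" "const_term (form_y p) = 0"
  by (simp_all add: form_x_eq form_y_eq const_term_simps)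

text \<open>
  The determinant of the two coordinate vectors, which is zero exactly for proportional vectors.
\<close>

definition cross :: "'k::field \<times> 'k \<Rightarrow> 'k \<times> 'k \<Rightarrow> 'k" where
  "cross p q = fst p * snd q - snd p * fst q"

lemma cross_self [simp]: "cross p p = 0"
  by (simp add: cross_def)

lemma cross_swap: "cross p q = - cross q p"
  by (simp add: cross_def)

lemma cross_eq_0_swap: "cross p q = 0 \<longleftrightarrow> cross q p = 0"
  using cross_swap[of p q] by simp

lemma cross_nonzero:
  assumes "p \<noteq> (0, 0)" "q \<noteq> (0, 0)" "\<not> same_point p q"
  shows "cross p q \<noteq> 0"
proof
  assume 0: "cross p q = 0"
  obtain p0 p1 q0 q1 where pq: "p = (p0, p1)" "q = (q0, q1)" by fastforce
  have eq: "p0 * q1 = p1 * q0" using 0 by (simp add: cross_def pq)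
  have "same_point p q"
  proof (cases "p0 = 0")
    case True
    then have "p1 \<noteq> 0" "q0 = 0" using assms eq by (auto simp: pq)
    then show ?thesis
      using assms True by (auto simp: same_point_def pq intro!: exI[of _ "q1 / p1"])
  next
    case False
    have "q1 = q0 / p0 * p1" using eq False by (simp add: field_simps)
    moreover have "q0 \<noteq> 0" using eq False assms by (auto simp: pq)
    ultimately show ?thesis
      using False by (auto simp: same_point_def pq intro!: exI[of _ "q0 / p0"])
  qed
  with assms(3) show False by contradiction
qed

text \<open>
  A point \<open>e\<close> with \<open>cross p e = 1\<close> provides a linear form, \<open>form_x e\<close> or \<open>form_y e\<close>, that takes the
  value 1 at \<open>p\<close>.  It serves as the coordinate of the polynomial ring that remains after
  restricting to the line over \<open>p\<close>.
\<close>

lemma dual_point_exists: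
  assumes "p \<noteq> (0, 0)"
  shows "\<exists>e. cross p e = 1"
proof (cases "fst p = 0")
  case True
  then show ?thesis
    using assms by (intro exI[of _ "(- 1 / snd p, 0)"]) (auto simp: cross_def prod_eq_iff)
next
  case False
  then show ?thesis by (intro exI[of _ "(0, 1 / fst p)"]) (simp add: cross_def)
qed

lemma generic_point_exists:
  fixes P :: "nat \<Rightarrow> 'k::field_char_0 \<times> 'k"
  assumes "finite S" "\<And>i. i \<in> S \<Longrightarrow> P i \<noteq> (0, 0)"
  shows "\<exists>e. e \<noteq> (0, 0) \<and> (\<forall>i\<in>S. cross (P i) e \<noteq> 0)"
proof -
  obtain c where c: "c \<notin> (\<lambda>i. snd (P i) / fst (P i)) ` S"
    using ex_new_if_finite[OF infinite_UNIV_char_0] assms(1) by blast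
  have "cross (P i) (1, c) \<noteq> 0" if i: "i \<in> S" for i
  proof (cases "fst (P i) = 0")
    case True
    then show ?thesis using assms(2)[OF i] by (auto simp: cross_def prod_eq_iff)
  next
    case False
    have "c \<noteq> snd (P i) / fst (P i)" using c i by blast
    then show ?thesis using False by (auto simp: cross_def field_simps)
  qed
  then show ?thesis by (intro exI[of _ "(1, c)"]) simp
qed

text \<open>
  Restriction to the line where \<open>form_x p\<close> vanishes: the pair of variables is replaced by \<open>p\<close>
  times the coordinate \<open>form_x e\<close>, where \<open>cross p e = 1\<close>.  The maps for the other ruling and for
  a point are built in the same way.
\<close>

definition line_x :: "'k::field \<times> 'k \<Rightarrow> 'k \<times> 'k \<Rightarrow> 'k bipoly \<Rightarrow> 'k bipoly" where
  "line_x p e = subst (case_var (const (fst p) * form_x e) (const (snd p) * form_x e)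
     (variable Y0) (variable Y1))"

definition line_y :: "'k::field \<times> 'k \<Rightarrow> 'k \<times> 'k \<Rightarrow> 'k bipoly \<Rightarrow> 'k bipoly" where
  "line_y q f = subst (case_var (variable X0) (variable X1)
     (const (fst q) * form_y f) (const (snd q) * form_y f))"

definition at_point :: "'k::field \<times> 'k \<Rightarrow> 'k \<times> 'k \<Rightarrow> 'k \<times> 'k \<Rightarrow> 'k \<times> 'k \<Rightarrow> 'k bipoly \<Rightarrow> 'k bipoly" where
  "at_point p e q f = subst (case_var (const (fst p) * form_x e) (const (snd p) * form_x e)
     (const (fst q) * form_y f) (const (snd q) * form_y f))"

definition x_zero :: "'k::field bipoly \<Rightarrow> 'k bipoly" where
  "x_zero = subst (case_var 0 0 (variable Y0) (variable Y1))"

text \<open>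
  The action of the two-dimensional torus, which detects bidegrees as eigenvalues.
\<close>

definition scale :: "'k::field \<Rightarrow> 'k \<Rightarrow> 'k bipoly \<Rightarrow> 'k bipoly" where
  "scale c d = subst (case_var (const c * variable X0) (const c * variable X1)
     (const d * variable Y0) (const d * variable Y1))"

lemma
  shows line_x_form_x: "line_x p e (form_x r) = const (cross p r) * form_x e"
    and line_x_form_y: "line_x p e (form_y s) = form_y s"
    and line_y_form_y: "line_y q f (form_y s) = const (cross q s) * form_y f"
    and at_point_form_x: "at_point p e q f (form_x r) = const (cross p r) * form_x e"
    and at_point_form_y: "at_point p e q f (form_y s) = const (cross q s) * form_y f"
    and x_zero_form_x: "x_zero (form_x r) = 0"
    and x_zero_form_y: "x_zero (form_y s) = form_y s"
    and scale_form_x: "scale c d (form_x r) = const c * form_x r"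
    and scale_form_y: "scale c d (form_y s) = const d * form_y s"
  by (simp_all add: line_x_def line_y_def at_point_def x_zero_def scale_def form_x_eq form_y_eq
      subst_simps cross_def const_diff const_mult algebra_simps)

lemma variable_minus_dual_x:
  assumes "cross p e = 1"
  shows "variable X0 - const (fst p) * form_x e = form_x p * (- const (fst e))"
    and "variable X1 - const (snd p) * form_x e = form_x p * (- const (snd e))"
proof -
  have 1: "const (fst p) * const (snd e) - const (snd p) * const (fst e) = (1 :: 'a bipoly)"
    using assms by (simp add: cross_def flip: const_mult const_diff)
  have "variable X0 - const (fst p) * form_x e - form_x p * (- const (fst e)) =
      variable X0 * (1 - (const (fst p) * const (snd e) - const (snd p) * const (fst e)))"
    by (simp add: form_x_eq algebra_simps)
  then show "variable X0 - const (fst p) * form_x e = form_x p * (- const (fst e))"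
    by (simp only: 1 diff_self mult_zero_right right_minus_eq)
  have "variable X1 - const (snd p) * form_x e - form_x p * (- const (snd e)) =
      variable X1 * (1 - (const (fst p) * const (snd e) - const (snd p) * const (fst e)))"
    by (simp add: form_x_eq algebra_simps)
  then show "variable X1 - const (snd p) * form_x e = form_x p * (- const (snd e))"
    by (simp only: 1 diff_self mult_zero_right right_minus_eq)
qed

lemma variable_minus_dual_y:
  assumes "cross p e = 1"
  shows "variable Y0 - const (fst p) * form_y e = form_y p * (- const (fst e))"
    and "variable Y1 - const (snd p) * form_y e = form_y p * (- const (snd e))"
proof -
  have 1: "const (fst p) * const (snd e) - const (snd p) * const (fst e) = (1 :: 'a bipoly)"
    using assms by (simp add: cross_def flip: const_mult const_diff)
  have "variable Y0 - const (fst p) * form_y e - form_y p * (- const (fst e)) =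
      variable Y0 * (1 - (const (fst p) * const (snd e) - const (snd p) * const (fst e)))"
    by (simp add: form_y_eq algebra_simps)
  then show "variable Y0 - const (fst p) * form_y e = form_y p * (- const (fst e))"
    by (simp only: 1 diff_self mult_zero_right right_minus_eq)
  have "variable Y1 - const (snd p) * form_y e - form_y p * (- const (snd e)) =
      variable Y1 * (1 - (const (fst p) * const (snd e) - const (snd p) * const (fst e)))"
    by (simp add: form_y_eq algebra_simps)
  then show "variable Y1 - const (snd p) * form_y e = form_y p * (- const (snd e))"
    by (simp only: 1 diff_self mult_zero_right right_minus_eq)
qed

lemma const_mult_variable_x:
  "const (cross p r) * variable X0 = const (fst p) * form_x r - const (fst r) * form_x p"
  "const (cross p r) * variable X1 = const (snd p) * form_x r - const (snd r) * form_x p"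
  by (simp_all add: form_x_eq cross_def const_diff const_mult algebra_simps)

lemma const_mult_variable_y:
  "const (cross p r) * variable Y0 = const (fst p) * form_y r - const (fst r) * form_y p"
  "const (cross p r) * variable Y1 = const (snd p) * form_y r - const (snd r) * form_y p"
  by (simp_all add: form_y_eq cross_def const_diff const_mult algebra_simps)

lemma form_x_nonzero:
  assumes "p \<noteq> (0, 0)"
  shows "form_x p \<noteq> 0"
proof
  assume 0: "form_x p = 0"
  have X: "Poly_Mapping.single X0 (Suc 0) \<noteq> Poly_Mapping.single X1 (Suc 0)"
    by (metis lookup_single_eq lookup_single_not_eq var.distinct(1) nat.distinct(1))
  have "Poly_Mapping.lookup (form_x p) (Poly_Mapping.single X0 1) = snd p"
    "Poly_Mapping.lookup (form_x p) (Poly_Mapping.single X1 1) = - fst p"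
    using X by (simp_all add: form_x_def lookup_minus lookup_single when_def)
  then show False using assms 0 by (simp add: prod_eq_iff)
qed

lemma form_y_nonzero:
  assumes "p \<noteq> (0, 0)"
  shows "form_y p \<noteq> 0"
proof
  assume 0: "form_y p = 0"
  have Y: "Poly_Mapping.single Y0 (Suc 0) \<noteq> Poly_Mapping.single Y1 (Suc 0)"
    by (metis lookup_single_eq lookup_single_not_eq var.distinct(11) nat.distinct(1))
  have "Poly_Mapping.lookup (form_y p) (Poly_Mapping.single Y0 1) = snd p"
    "Poly_Mapping.lookup (form_y p) (Poly_Mapping.single Y1 1) = - fst p"
    using Y by (simp_all add: form_y_def lookup_minus lookup_single when_def)
  then show False using assms 0 by (simp add: prod_eq_iff)
qed

lemma cross_nonzeroD: "cross p q \<noteq> 0 \<Longrightarrow> p \<noteq> (0, 0) \<and> q \<noteq> (0, 0)"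
  by (auto simp: cross_def)

lemma ring_ideal_dvd: "ring_ideal {F. A dvd F}"
  by (rule ring_idealI) auto

text \<open>
  The restriction map is a retraction modulo \<open>form_x p\<close> and kills this form, so \<open>form_x p\<close>
  generates its kernel.
\<close>

lemma form_x_dvd_iff:
  assumes "cross p e = 1"
  shows "form_x p dvd F \<longleftrightarrow> line_x p e F = 0"
proof
  assume "form_x p dvd F"
  then obtain G where "F = form_x p * G" by (elim dvdE)
  then have "line_x p e F = line_x p e (form_x p) * line_x p e G"
    by (simp add: line_x_def subst_mult)
  then show "line_x p e F = 0" by (simp add: line_x_form_x)
next
  assume 0: "line_x p e F = 0"
  have "F - line_x p e F \<in> {F. form_x p dvd F}"
    unfolding line_x_def
  proof (rule subst_cong_mod[OF ring_ideal_dvd])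
    fix v show "variable v - (case v of X0 \<Rightarrow> const (fst p) * form_x e
      | X1 \<Rightarrow> const (snd p) * form_x e | Y0 \<Rightarrow> variable Y0 | Y1 \<Rightarrow> variable Y1) \<in> {F. form_x p dvd F}"
      using variable_minus_dual_x[OF assms] by (cases v) simp_all
  qed
  then show "form_x p dvd F" using 0 by simp
qed

lemma form_y_dvd_iff:
  assumes "cross q f = 1"
  shows "form_y q dvd F \<longleftrightarrow> line_y q f F = 0"
proof
  assume "form_y q dvd F"
  then obtain G where "F = form_y q * G" by (elim dvdE)
  then have "line_y q f F = line_y q f (form_y q) * line_y q f G"
    by (simp add: line_y_def subst_mult)
  then show "line_y q f F = 0" by (simp add: line_y_form_y)
next
  assume 0: "line_y q f F = 0"
  have "F - line_y q f F \<in> {F. form_y q dvd F}"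
    unfolding line_y_def
  proof (rule subst_cong_mod[OF ring_ideal_dvd])
    fix v show "variable v - (case v of X0 \<Rightarrow> variable X0 | X1 \<Rightarrow> variable X1
      | Y0 \<Rightarrow> const (fst q) * form_y f | Y1 \<Rightarrow> const (snd q) * form_y f) \<in> {F. form_y q dvd F}"
      using variable_minus_dual_y[OF assms] by (cases v) simp_all
  qed
  then show "form_y q dvd F" using 0 by simp
qed

lemma minus_at_point_in_span2:
  assumes "cross p e = 1" "cross q f = 1"
  shows "F - at_point p e q f F \<in> span2 (form_x p) (form_y q)"
  unfolding at_point_def
proof (rule subst_cong_mod[OF ring_ideal_span2])
  fix v show "variable v - (case v of X0 \<Rightarrow> const (fst p) * form_x e
    | X1 \<Rightarrow> const (snd p) * form_x e | Y0 \<Rightarrow> const (fst q) * form_y f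
    | Y1 \<Rightarrow> const (snd q) * form_y f) \<in> span2 (form_x p) (form_y q)"
    unfolding var.case_distrib[of "\<lambda>F. variable v - F"]
    by (cases v) (simp_all only: var.case variable_minus_dual_x[OF assms(1)]
        variable_minus_dual_y[OF assms(2)] span2_left span2_right)
qed

text \<open>
  Restriction to a point of the grid is a homomorphism into a domain with kernel the ideal of the
  point.  In particular the ideal is prime, and non-zero-divisors modulo it are recognized by
  their restriction.
\<close>

lemma point_ideal_iff:
  assumes "cross p e = 1" "cross q f = 1"
  shows "F \<in> span2 (form_x p) (form_y q) \<longleftrightarrow> at_point p e q f F = 0"
proof
  assume "F \<in> span2 (form_x p) (form_y q)"
  then obtain u v where "F = form_x p * u + form_y q * v" by (rule span2E)
  then have "at_point p e q f F = at_point p e q f (form_x p) * at_point p e q f u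
      + at_point p e q f (form_y q) * at_point p e q f v"
    by (simp add: at_point_def subst_simps)
  then show "at_point p e q f F = 0" by (simp add: at_point_form_x at_point_form_y)
next
  assume "at_point p e q f F = 0"
  then show "F \<in> span2 (form_x p) (form_y q)"
    using minus_at_point_in_span2[OF assms, of F] by simp
qed

lemma nzd_mod_point_ideal:
  assumes "cross p e = 1" "cross q f = 1" "at_point p e q f C \<noteq> 0"
  shows "nzd_mod C (span2 (form_x p) (form_y q))"
proof (rule nzd_modI)
  fix z assume "C * z \<in> span2 (form_x p) (form_y q)"
  then have "at_point p e q f C * at_point p e q f z = 0"
    unfolding point_ideal_iff[OF assms(1,2)] by (simp add: at_point_def subst_mult)
  then show "z \<in> span2 (form_x p) (form_y q)"
    using assms(3) by (simp add: point_ideal_iff[OF assms(1,2)])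
qed

lemma nzd_mod_point_ideal_form_x:
  assumes "cross p r \<noteq> 0" "q \<noteq> (0, 0)"
  shows "nzd_mod (form_x r) (span2 (form_x p) (form_y q))"
proof -
  obtain e f where ef: "cross p e = 1" "cross q f = 1"
    using dual_point_exists cross_nonzeroD[OF assms(1)] assms(2) by meson
  then have "form_x e \<noteq> 0" by (intro form_x_nonzero) (auto simp: cross_def)
  then have "at_point p e q f (form_x r) \<noteq> 0" using assms by (simp add: at_point_form_x)
  then show ?thesis by (rule nzd_mod_point_ideal[OF ef])
qed

lemma nzd_mod_point_ideal_form_y:
  assumes "cross q s \<noteq> 0" "p \<noteq> (0, 0)"
  shows "nzd_mod (form_y s) (span2 (form_x p) (form_y q))"
proof -
  obtain e f where ef: "cross p e = 1" "cross q f = 1"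
    using dual_point_exists cross_nonzeroD[OF assms(1)] assms(2) by meson
  then have "form_y f \<noteq> 0" by (intro form_y_nonzero) (auto simp: cross_def)
  then have "at_point p e q f (form_y s) \<noteq> 0" using assms by (simp add: at_point_form_y)
  then show ?thesis by (rule nzd_mod_point_ideal[OF ef])
qed

lemma regular_pair_form_x_form_y:
  assumes "p \<noteq> (0, 0)" "q \<noteq> (0, 0)"
  shows "regular_pair (form_x p) (form_y q)"
proof (rule regular_pairI)
  show "form_x p \<noteq> 0" "form_y q \<noteq> 0"
    using assms by (simp_all add: form_x_nonzero form_y_nonzero)
  then show "form_x p dvd z" if "form_x p dvd form_y q * z" for z
  proof -
    obtain e where e: "cross p e = 1" using dual_point_exists assms(1) by blast
    have "form_y q * line_x p e z = 0"
      using that unfolding form_x_dvd_iff[OF e]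
      by (metis line_x_def line_x_form_y subst_mult)
    then show ?thesis
      using \<open>form_y q \<noteq> 0\<close> by (simp add: form_x_dvd_iff[OF e])
  qed
qed

lemma regular_pair_form_y_form_y:
  assumes "cross q s \<noteq> 0"
  shows "regular_pair (form_y q) (form_y s)"
proof (rule regular_pairI)
  have q: "q \<noteq> (0, 0)" and s: "s \<noteq> (0, 0)" using cross_nonzeroD[OF assms] by auto
  show "form_y q \<noteq> 0" "form_y s \<noteq> 0" using q s by (simp_all add: form_y_nonzero)
  show "form_y q dvd z" if "form_y q dvd form_y s * z" for z
  proof -
    obtain f where f: "cross q f = 1" using dual_point_exists q by blast
    then have "form_y f \<noteq> 0" by (intro form_y_nonzero) (auto simp: cross_def)
    moreover have "const (cross q s) * form_y f * line_y q f z = 0"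
      using that unfolding form_y_dvd_iff[OF f]
      by (metis line_y_def line_y_form_y subst_mult)
    ultimately show ?thesis
      using assms by (simp add: form_y_dvd_iff[OF f])
  qed
qed

text \<open>
  Two distinct points of the projective line have linearly independent forms.
\<close>

lemma variable_in_span2_form:
  assumes "cross p r \<noteq> 0"
  shows "variable X0 \<in> span2 (form_x p) (form_x r)" "variable X1 \<in> span2 (form_x p) (form_x r)"
    and "variable Y0 \<in> span2 (form_y p) (form_y r)" "variable Y1 \<in> span2 (form_y p) (form_y r)"
proof -
  have *: "F \<in> span2 A B" if "const (cross p r) * F = const s * B - const t * A" for F A B s t
  proof -
    have "const (cross p r) * F \<in> span2 A B"
      unfolding that
      by (intro ideal_diff[OF ring_ideal_span2])
        (metis mult.commute span2_right, metis mult.commute span2_left)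
    then have "const (inverse (cross p r)) * (const (cross p r) * F) \<in> span2 A B"
      by (rule ideal_mult_left[OF ring_ideal_span2])
    then show ?thesis
      using assms const_inverse[of "cross p r"]
      by (metis mult.assoc mult.commute mult_1)
  qed
  show "variable X0 \<in> span2 (form_x p) (form_x r)" "variable X1 \<in> span2 (form_x p) (form_x r)"
    "variable Y0 \<in> span2 (form_y p) (form_y r)" "variable Y1 \<in> span2 (form_y p) (form_y r)"
    by (rule *, rule const_mult_variable_x const_mult_variable_y)+
qed

lemma form_x_in_span2:
  assumes "cross p r \<noteq> 0"
  shows "form_x e \<in> span2 (form_x p) (form_x r)"
  unfolding form_x_eq[of e]
  by (intro ideal_diff[OF ring_ideal_span2] ideal_mult_left[OF ring_ideal_span2]
      variable_in_span2_form assms)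

section \<open>Bidegrees\<close>

lemma monom_bidegree_add:
  "monom_bidegree (s + t) = (fst (monom_bidegree s) + fst (monom_bidegree t),
     snd (monom_bidegree s) + snd (monom_bidegree t))"
  by (simp add: monom_bidegree_def lookup_add)

definition has_bidegree :: "'k::field bipoly \<Rightarrow> nat \<times> nat \<Rightarrow> bool" where
  "has_bidegree F d \<longleftrightarrow> (\<forall>t\<in>Poly_Mapping.keys F. monom_bidegree t = d)"

lemma bihomogeneous_iff: "bihomogeneous F \<longleftrightarrow> (\<exists>d. has_bidegree F d)"
  by (simp add: bihomogeneous_def has_bidegree_def)

lemma has_bidegree_bidegree:
  assumes "bihomogeneous F" "F \<noteq> 0"
  shows "has_bidegree F (bidegree F)"
proof -
  obtain d where d: "\<forall>t\<in>Poly_Mapping.keys F. monom_bidegree t = d"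
    using assms(1) by (auto simp: bihomogeneous_def)
  have "Poly_Mapping.keys F \<noteq> {}"
  proof
    assume e: "Poly_Mapping.keys F = {}"
    have "F = 0" by (subst bipoly_eq_sum_monomials[of F]) (simp add: e)
    with assms(2) show False by contradiction
  qed
  then obtain t where t: "t \<in> Poly_Mapping.keys F" by blast
  have "bidegree F = d"
    unfolding bidegree_def using d t by (intro the_equality) auto
  then show ?thesis using d by (simp add: has_bidegree_def)
qed

lemma has_bidegree_mult:
  assumes "has_bidegree F d" "has_bidegree G e"
  shows "has_bidegree (F * G) (fst d + fst e, snd d + snd e)"
  using assms keys_mult[of F G] by (fastforce simp: has_bidegree_def monom_bidegree_add)

lemma has_bidegree_1: "has_bidegree 1 (0, 0)"
  by (auto simp: has_bidegree_def monom_bidegree_def)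

lemma has_bidegree_power: "has_bidegree F d \<Longrightarrow> has_bidegree (F ^ n) (n * fst d, n * snd d)"
proof (induction n)
  case (Suc n)
  from has_bidegree_mult[OF Suc.prems Suc.IH[OF Suc.prems]] show ?case by simp
qed (simp add: has_bidegree_1)

lemma has_bidegree_prod:
  "(\<And>s. s \<in> S \<Longrightarrow> has_bidegree (F s) (d s)) \<Longrightarrow>
   has_bidegree (\<Prod>s\<in>S. F s) (\<Sum>s\<in>S. fst (d s), \<Sum>s\<in>S. snd (d s))"
proof (induction S rule: infinite_finite_induct)
  case (insert s S)
  have "has_bidegree (F s * (\<Prod>s\<in>S. F s)) (fst (d s) + (\<Sum>s\<in>S. fst (d s)), snd (d s) + (\<Sum>s\<in>S. snd (d s)))"
    using has_bidegree_mult[OF insert.prems insert.IH] insert.prems by simp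
  then show ?case using insert.hyps by simp
qed (simp_all add: has_bidegree_1)

lemma has_bidegree_form_x: "has_bidegree (form_x p) (1, 0)"
proof -
  have "Poly_Mapping.keys (form_x p) \<subseteq> {Poly_Mapping.single X0 1, Poly_Mapping.single X1 1}"
    by (auto simp: form_x_def in_keys_iff lookup_minus lookup_single when_def split: if_splits)
  then show ?thesis
    by (auto simp: has_bidegree_def monom_bidegree_def lookup_single dest!: subsetD)
qed

lemma has_bidegree_form_y: "has_bidegree (form_y p) (0, 1)"
proof -
  have "Poly_Mapping.keys (form_y p) \<subseteq> {Poly_Mapping.single Y0 1, Poly_Mapping.single Y1 1}"
    by (auto simp: form_y_def in_keys_iff lookup_minus lookup_single when_def split: if_splits)
  then show ?thesis
    by (auto simp: has_bidegree_def monom_bidegree_def lookup_single dest!: subsetD)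
qed

text \<open>
  A form of bidegree \<open>d\<close> is an eigenvector of the torus with character \<open>d\<close>.
\<close>

lemma scale_has_bidegree:
  assumes "has_bidegree F d"
  shows "scale c e F = const (c ^ fst d * e ^ snd d) * F"
proof -
  let ?L = Poly_Mapping.lookup
  have "const (?L F t) * (\<Prod>v\<in>UNIV. case_var (const c * variable X0) (const c * variable X1)
     (const e * variable Y0) (const e * variable Y1) v ^ ?L t v) =
     const (c ^ fst d * e ^ snd d) * Poly_Mapping.single t (?L F t)"
    if "t \<in> Poly_Mapping.keys F" for t
  proof -
    have d: "d = (?L t X0 + ?L t X1, ?L t Y0 + ?L t Y1)"
      using assms that by (auto simp: has_bidegree_def monom_bidegree_def)
    show ?thesis
      unfolding single_eq_const_mult_monomial[of t]
      by (simp add: UNIV_var d power_mult_distrib power_add const_mult const_power mult_ac)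
  qed
  then have "scale c e F = (\<Sum>t\<in>Poly_Mapping.keys F.
      const (c ^ fst d * e ^ snd d) * Poly_Mapping.single t (?L F t))"
    unfolding scale_def subst_def by (intro sum.cong) auto
  also have "\<dots> = const (c ^ fst d * e ^ snd d) * F"
    unfolding sum_distrib_left[symmetric] by (simp flip: bipoly_eq_sum_monomials)
  finally show ?thesis .
qed

lemma const_term_scale: "const_term (scale c e F) = const_term F"
proof -
  have "F - scale c e F \<in> {G. const_term G = 0}"
    unfolding scale_def
  proof (rule subst_cong_mod[OF ring_ideal_const_term])
    fix v show "variable v - (case v of X0 \<Rightarrow> const c * variable X0 | X1 \<Rightarrow> const c * variable X1
      | Y0 \<Rightarrow> const e * variable Y0 | Y1 \<Rightarrow> const e * variable Y1) \<in> {G. const_term G = 0}"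
      by (cases v) (simp_all add: const_term_simps)
  qed
  then show ?thesis by (simp add: const_term_simps)
qed

section \<open>Fat points as intersections of powers\<close>

text \<open>
  The locale fixes the lines only.  Multiplicities are a parameter of the ideals, because the
  induction below lowers them.
\<close>

locale grid =
  fixes a b :: nat and P Q :: "nat \<Rightarrow> 'k::field_char_0 \<times> 'k"
  assumes P_nonzero: "i \<in> {1..a} \<Longrightarrow> P i \<noteq> (0, 0)"
    and Q_nonzero: "j \<in> {1..b} \<Longrightarrow> Q j \<noteq> (0, 0)"
    and P_distinct: "\<lbrakk>i \<in> {1..a}; s \<in> {1..a}; i \<noteq> s\<rbrakk> \<Longrightarrow> cross (P i) (P s) \<noteq> 0"
    and Q_distinct: "\<lbrakk>j \<in> {1..b}; p \<in> {1..b}; j \<noteq> p\<rbrakk> \<Longrightarrow> cross (Q j) (Q p) \<noteq> 0"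
begin

abbreviation L :: "nat \<Rightarrow> 'k bipoly" where "L i \<equiv> form_x (P i)"
abbreviation B :: "nat \<Rightarrow> 'k bipoly" where "B j \<equiv> form_y (Q j)"

definition zideal :: "(nat \<Rightarrow> nat \<Rightarrow> nat) \<Rightarrow> 'k bipoly set" where
  "zideal m = {F. \<forall>i\<in>{1..a}. \<forall>j\<in>{1..b}. F \<in> pair_power (L i) (B j) (m i j)}"

lemma zidealI:
  "(\<And>i j. \<lbrakk>i \<in> {1..a}; j \<in> {1..b}\<rbrakk> \<Longrightarrow> F \<in> pair_power (L i) (B j) (m i j)) \<Longrightarrow> F \<in> zideal m"
  by (simp add: zideal_def)

lemma zidealD:
  "\<lbrakk>F \<in> zideal m; i \<in> {1..a}; j \<in> {1..b}\<rbrakk> \<Longrightarrow> F \<in> pair_power (L i) (B j) (m i j)"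
  by (simp add: zideal_def)

lemma ring_ideal_zideal: "ring_ideal (zideal m)"
  by (intro ring_idealI zidealI)
    (auto intro!: ideal_zero[OF ring_ideal_pair_power] ideal_add[OF ring_ideal_pair_power]
      ideal_mult_left[OF ring_ideal_pair_power] dest: zidealD)

lemma regular_pair_LB: "\<lbrakk>i \<in> {1..a}; j \<in> {1..b}\<rbrakk> \<Longrightarrow> regular_pair (L i) (B j)"
  by (intro regular_pair_form_x_form_y P_nonzero Q_nonzero)

text \<open>
  All associated primes of \<open>zideal m\<close> are ideals of points, so it suffices to check at the points.
\<close>

lemma nzd_mod_zideal:
  assumes "\<And>i j. \<lbrakk>i \<in> {1..a}; j \<in> {1..b}\<rbrakk> \<Longrightarrow> nzd_mod c (span2 (L i) (B j))"
  shows "nzd_mod c (zideal m)"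
proof (rule nzd_modI, rule zidealI)
  fix z i j assume "c * z \<in> zideal m" and ij: "i \<in> {1..a}" "j \<in> {1..b}"
  then have "c * z \<in> pair_power (L i) (B j) (m i j)" by (blast dest: zidealD)
  then show "z \<in> pair_power (L i) (B j) (m i j)"
    by (rule nzd_modD[OF nzd_mod_pair_power[OF regular_pair_LB[OF ij] assms[OF ij]]])
qed

lemma dvd_in_zidealI:
  assumes "\<And>i j. \<lbrakk>i \<in> {1..a}; j \<in> {1..b}\<rbrakk> \<Longrightarrow> \<exists>l k. m i j \<le> l + k \<and> L i ^ l * B j ^ k dvd F"
  shows "F \<in> zideal m"
proof (rule zidealI)
  fix i j assume "i \<in> {1..a}" "j \<in> {1..b}"
  then obtain l k where "m i j \<le> l + k" "L i ^ l * B j ^ k dvd F" using assms by blast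
  then show "F \<in> pair_power (L i) (B j) (m i j)"
    by (metis dvdE monomial_in_pair_power)
qed

lemma prod_L_in_zideal:
  "(\<And>i j. \<lbrakk>i \<in> {1..a}; j \<in> {1..b}\<rbrakk> \<Longrightarrow> m i j \<le> n i) \<Longrightarrow> (\<Prod>i=1..a. L i ^ n i) \<in> zideal m"
proof (rule dvd_in_zidealI)
  fix i j assume "i \<in> {1..a}" "j \<in> {1..b}"
    and "\<And>i j. \<lbrakk>i \<in> {1..a}; j \<in> {1..b}\<rbrakk> \<Longrightarrow> m i j \<le> n i"
  then show "\<exists>l k. m i j \<le> l + k \<and> L i ^ l * B j ^ k dvd (\<Prod>i=1..a. L i ^ n i)"
    by (intro exI[of _ "n i"] exI[of _ 0]) (auto intro!: dvd_prodI)
qed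

lemma prod_B_in_zideal:
  "(\<And>i j. \<lbrakk>i \<in> {1..a}; j \<in> {1..b}\<rbrakk> \<Longrightarrow> m i j \<le> n j) \<Longrightarrow> (\<Prod>j=1..b. B j ^ n j) \<in> zideal m"
proof (rule dvd_in_zidealI)
  fix i j assume "i \<in> {1..a}" "j \<in> {1..b}"
    and "\<And>i j. \<lbrakk>i \<in> {1..a}; j \<in> {1..b}\<rbrakk> \<Longrightarrow> m i j \<le> n j"
  then show "\<exists>l k. m i j \<le> l + k \<and> L i ^ l * B j ^ k dvd (\<Prod>j=1..b. B j ^ n j)"
    by (intro exI[of _ 0] exI[of _ "n j"]) (auto intro!: dvd_prodI)
qed

end

section \<open>Depth two forces nested multiplicities\<close>

text \<open>
  The forms \<open>form_x ex\<close> and \<open>form_y ey\<close> vanish at no point of the grid and therefore are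
  non-zero-divisors modulo \<open>zideal m\<close>.
\<close>

locale generic_grid = grid a b P Q
  for a b :: nat and P Q :: "nat \<Rightarrow> 'k::field_char_0 \<times> 'k" +
  fixes ex ey :: "'k \<times> 'k"
  assumes ex: "i \<in> {1..a} \<Longrightarrow> cross (P i) ex \<noteq> 0"
    and ey: "j \<in> {1..b} \<Longrightarrow> cross (Q j) ey \<noteq> 0"
    and ey_nonzero: "ey \<noteq> (0, 0)"
begin

text \<open>
  The sequence \<open>form_y ey, form_x ex\<close> is regular modulo \<open>zideal m\<close>.
\<close>

definition depth_cond :: "(nat \<Rightarrow> nat \<Rightarrow> nat) \<Rightarrow> bool" where
  "depth_cond m \<longleftrightarrow> nzd_mod (form_x ex) (adjoin (zideal m) (form_y ey))"

text \<open>
  Modulo \<open>zideal m\<close>, \<open>form_x ex\<close> and \<open>form_y ey\<close>, every variable is nilpotent, because the ideal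
  contains products of lines of either ruling.  So some power of each element without constant
  term multiplies \<open>z\<close> into \<open>zideal m + (form_y ey)\<close>, and the regular sequence \<open>f, g\<close> yields the
  claim by the socle argument.
\<close>

lemma depth_condI_regular_sequence:
  assumes f0: "const_term f = 0" and g0: "const_term g = 0"
    and f: "nzd_mod f (zideal m)" and g: "nzd_mod g (adjoin (zideal m) f)"
  shows "depth_cond m"
  unfolding depth_cond_def
proof (rule nzd_modI)
  let ?I = "zideal m" and ?J = "adjoin (zideal m) (form_y ey)"
  have I: "ring_ideal ?I" by (rule ring_ideal_zideal)
  have J: "ring_ideal ?J" by (rule ring_ideal_adjoin[OF I])
  fix z assume xz: "form_x ex * z \<in> ?J"
  let ?R = "{c. \<exists>k. c ^ k \<in> {c. c * z \<in> ?J}}"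
  have R: "ring_ideal ?R" by (rule ring_ideal_radical[OF ring_ideal_colon[OF J]])
  define n where "n i = (\<Sum>j=1..b. m i j)" for i
  define n' where "n' j = (\<Sum>i=1..a. m i j)" for j
  have U: "(\<Prod>i=1..a. L i ^ n i) \<in> zideal m"
    by (rule prod_L_in_zideal) (auto simp: n_def intro: member_le_sum)
  have V: "(\<Prod>j=1..b. B j ^ n' j) \<in> zideal m"
    by (rule prod_B_in_zideal) (auto simp: n'_def intro: member_le_sum)
  have rad: "c \<in> ?R" if span: "c ^ k \<in> span2 l W" and lz: "l * z \<in> ?J" and W: "W \<in> zideal m" for c k l W
  proof -
    obtain u v where ck: "c ^ k = l * u + W * v" using span by (rule span2E)
    have "c ^ k * z = u * (l * z) + (v * z) * W" by (simp add: ck algebra_simps)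
    also have "\<dots> \<in> ?J"
      using W subset_adjoin by (intro ideal_add[OF J ideal_mult_left[OF J lz] ideal_mult_left[OF J]]) auto
    finally show ?thesis by blast
  qed
  have X: "variable v \<in> ?R" if "v = X0 \<or> v = X1" for v
  proof (rule rad[OF power_in_span2_prod xz U])
    fix i assume "i \<in> {1..a}"
    then have "cross ex (P i) \<noteq> 0" using ex cross_eq_0_swap by blast
    then show "variable v \<in> span2 (form_x ex) (L i)" using that variable_in_span2_form by blast
  qed
  have yz: "form_y ey * z \<in> ?J" by (rule adjoin_gen[OF I])
  have Y: "variable v \<in> ?R" if "v = Y0 \<or> v = Y1" for v
  proof (rule rad[OF power_in_span2_prod yz V])
    fix j assume "j \<in> {1..b}"
    then have "cross ey (Q j) \<noteq> 0" using ey cross_eq_0_swap by blast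
    then show "variable v \<in> span2 (form_y ey) (B j)" using that variable_in_span2_form by blast
  qed
  have "variable v \<in> ?R" for v using X[of v] Y[of v] by (cases v) blast+
  then have "f \<in> ?R" "g \<in> ?R"
    using const_term_ideal_variables[OF R] f0 g0 by blast+
  then obtain k l where "f ^ k * z \<in> ?J" "g ^ l * z \<in> ?J" by blast
  moreover have "nzd_mod (form_y ey) ?I"
    by (intro nzd_mod_zideal nzd_mod_point_ideal_form_y ey P_nonzero)
  ultimately show "z \<in> ?J"
    using regular_sequence_socle[OF I f g] by blast
qed

text \<open>
  Let \<open>d\<close> be the sum of the multiplicities of the largest row \<open>i\<close>.  Modulo \<open>y = form_y ey\<close> all the
  \<open>B j\<close> are multiples of one form \<open>\<nu>\<close>, hence \<open>\<nu> ^ d\<close> times a product of powers of the \<open>L r\<close> with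
  \<open>r \<noteq> s\<close> lies in \<open>zideal m + (y)\<close>, for each \<open>s\<close>.  As \<open>s\<close> varies these products generate an
  ideal containing a power of \<open>form_x ex\<close>, so regularity gives \<open>\<nu> ^ d\<close> in \<open>zideal m + (y)\<close>.
  Setting the first two variables to zero maps \<open>zideal m\<close> into the multiples of
  \<open>B j ^ (Max r. m r j)\<close> for all \<open>j\<close>.  Comparing degrees modulo \<open>y\<close> shows that \<open>d\<close> is at
  least the sum of these maxima, so row \<open>i\<close> attains all of them.
\<close>

lemma depth_cond_max_row:
  assumes cond: "depth_cond m" and i: "i \<in> {1..a}"
    and max: "\<And>s. s \<in> {1..a} \<Longrightarrow> (\<Sum>j=1..b. m s j) \<le> (\<Sum>j=1..b. m i j)"
    and sj: "s \<in> {1..a}" "j \<in> {1..b}"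
  shows "m s j \<le> m i j"
proof -
  let ?I = "zideal m" and ?y = "form_y ey"
  let ?J = "adjoin ?I ?y"
  have I: "ring_ideal ?I" by (rule ring_ideal_zideal)
  have J: "ring_ideal ?J" by (rule ring_ideal_adjoin[OF I])
  obtain f where f: "cross ey f = 1" using dual_point_exists[OF ey_nonzero] by blast
  let ?\<nu> = "form_y f"
  have \<nu>: "line_y ey f ?\<nu> = ?\<nu>" "?\<nu> \<noteq> 0"
    using f by (auto simp: line_y_form_y intro!: form_y_nonzero) (simp add: cross_def)
  have y0: "line_y ey f ?y = 0" by (simp add: line_y_form_y)
  define d where "d = (\<Sum>j=1..b. m i j)"
  define C where "C n = (\<Prod>j=1..b. cross ey (Q j) ^ n j)" for n :: "nat \<Rightarrow> nat"
  have C: "C n \<noteq> 0" for n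
    unfolding C_def using ey cross_eq_0_swap[of ey] by simp
  have line_prod: "line_y ey f (\<Prod>j=1..b. B j ^ n j) = const (C n) * ?\<nu> ^ (\<Sum>j=1..b. n j)" for n
  proof -
    have "const (\<Prod>j\<in>S. c j ^ n j) = (\<Prod>j\<in>S. const (c j :: 'k) ^ n j)" for S c
      by (induction S rule: infinite_finite_induct) (simp_all add: const_mult const_power)
    then show ?thesis
      by (simp add: line_y_def subst_simps C_def power_sum)
        (simp add: line_y_form_y[unfolded line_y_def] power_mult_distrib prod.distrib)
  qed
  define n where "n r = (\<Sum>j=1..b. m r j)" for r
  \<comment> \<open>The product satisfies the conditions at the points with index other than \<open>s\<close>; those with
    index \<open>s\<close> are taken care of by \<open>\<Prod>j. B j ^ m s j\<close>, a constant times \<open>\<nu> ^ n s\<close> modulo \<open>y\<close>.\<close>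
  have single: "(\<Prod>r\<in>{1..a} - {s}. L r ^ n r) * ?\<nu> ^ d \<in> ?J" if s: "s \<in> {1..a}" for s
  proof -
    let ?G = "\<Prod>r\<in>{1..a} - {s}. L r ^ n r" and ?\<Pi> = "\<Prod>j=1..b. B j ^ m s j"
    have "?G * ?\<Pi> \<in> ?I"
    proof (rule dvd_in_zidealI)
      fix r j assume rj: "r \<in> {1..a}" "j \<in> {1..b}"
      show "\<exists>l k. m r j \<le> l + k \<and> L r ^ l * B j ^ k dvd ?G * ?\<Pi>"
      proof (cases "r = s")
        case True
        have "B j ^ m s j dvd ?\<Pi>" using rj by (intro dvd_prodI) auto
        then show ?thesis using True by (intro exI[of _ 0] exI[of _ "m s j"]) simp
      next
        case False
        then have "L r ^ n r dvd ?G" using rj by (intro dvd_prodI) auto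
        moreover have "m r j \<le> n r" unfolding n_def using rj by (intro member_le_sum) auto
        ultimately show ?thesis by (intro exI[of _ "n r"] exI[of _ 0]) simp
      qed
    qed
    moreover have "?y dvd ?\<Pi> - const (C (m s)) * ?\<nu> ^ n s"
      unfolding form_y_dvd_iff[OF f]
      using line_prod[of "m s"] \<nu> by (simp add: line_y_def subst_simps n_def)
    then obtain w where w: "?\<Pi> - const (C (m s)) * ?\<nu> ^ n s = ?y * w" by (elim dvdE)
    ultimately have "?G * ?\<Pi> - ?y * (?G * w) \<in> ?J"
      using subset_adjoin by (intro ideal_diff[OF J] adjoin_gen[OF I]) auto
    also have "?G * ?\<Pi> - ?y * (?G * w) = ?G * (?\<Pi> - ?y * w)" by (simp add: algebra_simps)
    also have "?\<Pi> - ?y * w = const (C (m s)) * ?\<nu> ^ n s" unfolding w[symmetric] by simp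
    finally have "?G * (const (C (m s)) * ?\<nu> ^ n s) * (const (inverse (C (m s))) * ?\<nu> ^ (d - n s)) \<in> ?J"
      by (rule ideal_mult_right[OF J])
    also have "?G * (const (C (m s)) * ?\<nu> ^ n s) * (const (inverse (C (m s))) * ?\<nu> ^ (d - n s)) =
        ?G * (?\<nu> ^ n s * ?\<nu> ^ (d - n s)) * (const (C (m s)) * const (inverse (C (m s))))"
      by (simp only: mult_ac)
    also have "\<dots> = ?G * ?\<nu> ^ d"
      using max[OF s] by (simp add: const_inverse[OF C] n_def d_def flip: power_add)
    finally show ?thesis .
  qed
  \<comment> \<open>The factors \<open>L r ^ n r\<close> are removed one at a time: for \<open>S\<close> enlarged by \<open>s\<close>, both
    \<open>L s ^ n s\<close> and the product over \<open>S\<close> multiply into \<open>?J\<close>, and together they generate an ideal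
    containing a power of the regular element \<open>form_x ex\<close>.\<close>
  have chain: "(\<Prod>r\<in>{1..a} - S. L r ^ n r) * ?\<nu> ^ d \<in> ?J"
    if "finite S" "S \<noteq> {}" "S \<subseteq> {1..a}" for S
    using that
  proof (induction S rule: finite_ne_induct)
    case (singleton s)
    then show ?case using single by simp
  next
    case (insert s S)
    let ?w = "(\<Prod>r\<in>{1..a} - insert s S. L r ^ n r) * ?\<nu> ^ d"
    have s: "s \<in> {1..a}" and S: "S \<subseteq> {1..a}" using insert by auto
    have "{1..a} - S = insert s ({1..a} - insert s S)" using insert by auto
    then have "(\<Prod>r\<in>{1..a} - S. L r ^ n r) = (\<Prod>r\<in>insert s ({1..a} - insert s S). L r ^ n r)"
      by (rule arg_cong)
    also have "\<dots> = L s ^ n s * (\<Prod>r\<in>{1..a} - insert s S. L r ^ n r)"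
      by (rule prod.insert) auto
    finally have split1: "(\<Prod>r\<in>{1..a} - S. L r ^ n r) =
        L s ^ n s * (\<Prod>r\<in>{1..a} - insert s S. L r ^ n r)" .
    have 1: "L s ^ n s * ?w \<in> ?J" using insert.IH[OF S] unfolding split1 mult.assoc .
    have "{1..a} - {s} = S \<union> ({1..a} - insert s S)" using insert by auto
    then have "(\<Prod>r\<in>{1..a} - {s}. L r ^ n r) =
        (\<Prod>r\<in>S \<union> ({1..a} - insert s S). L r ^ n r)"
      by (rule arg_cong)
    also have "\<dots> = (\<Prod>r\<in>S. L r ^ n r) * (\<Prod>r\<in>{1..a} - insert s S. L r ^ n r)"
      using insert.hyps by (intro prod.union_disjoint) auto
    finally have split2: "(\<Prod>r\<in>{1..a} - {s}. L r ^ n r) =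
        (\<Prod>r\<in>S. L r ^ n r) * (\<Prod>r\<in>{1..a} - insert s S. L r ^ n r)" .
    have 2: "(\<Prod>r\<in>S. L r ^ n r) * ?w \<in> ?J" using single[OF s] unfolding split2 mult.assoc .
    have "form_x ex \<in> span2 (L s) (L r)" if "r \<in> S" for r
      using that insert.hyps s S by (intro form_x_in_span2 P_distinct) auto
    then have "form_x ex ^ (\<Sum>r\<in>S. n r) \<in> span2 (L s) (\<Prod>r\<in>S. L r ^ n r)"
      by (rule power_in_span2_prod)
    then have "(form_x ex ^ (\<Sum>r\<in>S. n r)) ^ (\<Sum>r\<in>{s}. n r) \<in>
        span2 (\<Prod>r\<in>S. L r ^ n r) (\<Prod>r\<in>{s}. L r ^ n r)"
      by (intro power_in_span2_prod) (auto simp: span2_commute)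
    then obtain u v where uv: "(form_x ex ^ (\<Sum>r\<in>S. n r)) ^ n s = (\<Prod>r\<in>S. L r ^ n r) * u + L s ^ n s * v"
      by (auto elim: span2E)
    have "(form_x ex ^ (\<Sum>r\<in>S. n r)) ^ n s * ?w =
        u * ((\<Prod>r\<in>S. L r ^ n r) * ?w) + v * (L s ^ n s * ?w)"
      unfolding uv by (simp add: algebra_simps)
    also have "\<dots> \<in> ?J" by (rule ideal_add[OF J ideal_mult_left[OF J 2] ideal_mult_left[OF J 1]])
    finally have "(form_x ex ^ (\<Sum>r\<in>S. n r)) ^ n s * ?w \<in> ?J" .
    then show ?case
      by (rule nzd_modD[OF nzd_mod_power[OF nzd_mod_power[OF cond[unfolded depth_cond_def]]]])
  qed
  have "?\<nu> ^ d \<in> ?J" using chain[of "{1..a}"] i by auto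
  then obtain w where w: "?\<nu> ^ d - ?y * w \<in> ?I" by (rule adjoinE)
  let ?u = "?\<nu> ^ d - ?y * x_zero w"
  have u: "x_zero (?\<nu> ^ d - ?y * w) = ?u"
    using x_zero_form_y[of f] x_zero_form_y[of ey] by (simp add: x_zero_def subst_simps)
  have dvd_u: "B j ^ m r j dvd ?u" if rj: "r \<in> {1..a}" "j \<in> {1..b}" for r j
  proof -
    have "?\<nu> ^ d - ?y * w \<in> span2 (L r) (B j ^ m r j)"
      using zidealD[OF w rj] pair_power_subset_span2 by blast
    then obtain g h where "?\<nu> ^ d - ?y * w = L r * g + B j ^ m r j * h" by (rule span2E)
    then have "?u = x_zero (L r) * x_zero g + x_zero (B j) ^ m r j * x_zero h"
      unfolding u[symmetric] by (simp add: x_zero_def subst_simps)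
    then show ?thesis by (simp add: x_zero_form_x x_zero_form_y)
  qed
  define k where "k j = Max ((\<lambda>r. m r j) ` {1..a})" for j
  have k_ge: "m r j \<le> k j" if "r \<in> {1..a}" for r j
    unfolding k_def using that by (intro Max_ge) auto
  have "k j \<in> (\<lambda>r. m r j) ` {1..a}" for j
    unfolding k_def using i by (intro Max_in) auto
  then have "B j ^ k j dvd ?u" if "j \<in> {1..b}" for j
    using dvd_u that by (metis imageE)
  then have k_span: "?u \<in> span2 0 (B j ^ k j)" if "j \<in> {1..b}" for j
    using that by (simp add: span2_zero_left)
  have "?u \<in> span2 0 (\<Prod>j=1..b. B j ^ k j)"
  proof (rule span2_prod_power)
    show "nzd_mod (B p) (span2 0 (B q ^ k q))" if "p \<in> {1..b}" "q \<in> {1..b}" "p \<noteq> q" for p q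
    proof (rule nzd_modI)
      fix z assume "B p * z \<in> span2 0 (B q ^ k q)"
      then have "B q ^ k q dvd B p * z" by (simp only: span2_zero_left)
      moreover have "regular_pair (B q) (B p)"
        using that by (intro regular_pair_form_y_form_y Q_distinct) auto
      ultimately have "B q ^ k q dvd z" by (rule regular_pair_power_dvd_mult[rotated])
      then show "z \<in> span2 0 (B q ^ k q)" by (simp only: span2_zero_left)
    qed
  qed (use k_span in auto)
  then obtain h where "?u = (\<Prod>j=1..b. B j ^ k j) * h"
    unfolding span2_zero_left by (rule dvdE)
  then have "line_y ey f ?u = const (C k) * ?\<nu> ^ (\<Sum>j=1..b. k j) * line_y ey f h"
    using line_prod[of k] by (simp add: line_y_def subst_mult)
  also have "line_y ey f ?u = ?\<nu> ^ d"
    using \<nu>(1) y0 by (simp add: line_y_def subst_simps)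
  finally have "?\<nu> ^ (\<Sum>j=1..b. k j) dvd ?\<nu> ^ d" by simp
  then have "(\<Sum>j=1..b. k j) \<le> d"
    by (rule power_dvd_power_const_term[OF \<nu>(2), rotated]) simp
  show "m s j \<le> m i j"
  proof (rule ccontr)
    assume "\<not> m s j \<le> m i j"
    then have "m i j < k j" using k_ge[OF sj(1), of j] by simp
    then have "(\<Sum>j=1..b. m i j) < (\<Sum>j=1..b. k j)"
      using sj(2) k_ge[OF i] by (intro sum_strict_mono_ex1) auto
    with \<open>(\<Sum>j=1..b. k j) \<le> d\<close> show False by (simp add: d_def)
  qed
qed

text \<open>
  The new ideal is the colon of \<open>zideal m\<close> by \<open>L i\<close>.  From \<open>x z\<close> in the new ideal modulo
  \<open>y\<close>, regularity gives \<open>L i z = y u\<close> modulo \<open>zideal m\<close>.  Restricting to the line \<open>L i = 0\<close> shows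
  that \<open>u\<close> is a multiple of \<open>\<Prod>j. B j ^ m i j\<close> there.  Since row \<open>i\<close> dominates, this product lies
  in \<open>zideal m\<close>, so that \<open>u\<close> may be replaced by a multiple of \<open>L i\<close>.
\<close>

lemma depth_cond_remove_row:
  assumes cond: "depth_cond m" and i: "i \<in> {1..a}"
    and max: "\<And>s j. \<lbrakk>s \<in> {1..a}; j \<in> {1..b}\<rbrakk> \<Longrightarrow> m s j \<le> m i j"
  shows "depth_cond (m(i := \<lambda>j. m i j - 1))"
  unfolding depth_cond_def
proof (rule nzd_modI)
  let ?m = "m(i := \<lambda>j. m i j - 1)"
  let ?I = "zideal m" and ?I' = "zideal ?m" and ?x = "form_x ex" and ?y = "form_y ey"
  let ?\<Pi> = "\<Prod>j=1..b. B j ^ m i j"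
  have I: "ring_ideal ?I" by (rule ring_ideal_zideal)
  fix z assume "?x * z \<in> adjoin ?I' ?y"
  then obtain w where w: "?x * z - ?y * w \<in> ?I'" by (rule adjoinE)
  have "L i * (?x * z - ?y * w) \<in> ?I"
  proof (rule zidealI)
    fix s j assume sj: "s \<in> {1..a}" "j \<in> {1..b}"
    have mem: "?x * z - ?y * w \<in> pair_power (L s) (B j) (?m s j)" using w sj by (rule zidealD)
    then show "L i * (?x * z - ?y * w) \<in> pair_power (L s) (B j) (m s j)"
    proof (cases "s = i \<and> m i j > 0")
      case True
      then show ?thesis using pair_power_mult_left[of "?x * z - ?y * w" "L i" "B j" "m i j - 1"] mem by simp
    next
      case False
      then have "?m s j = m s j" by auto
      then show ?thesis using ideal_mult_left[OF ring_ideal_pair_power mem] by simp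
    qed
  qed
  then have "?x * (L i * z) \<in> adjoin ?I ?y"
    by (intro adjoinI[of _ _ "L i * w"]) (simp add: algebra_simps)
  then have "L i * z \<in> adjoin ?I ?y" by (rule nzd_modD[OF cond[unfolded depth_cond_def]])
  then obtain u where u: "L i * z - ?y * u \<in> ?I" by (rule adjoinE)
  have "u \<in> span2 (L i) ?\<Pi>"
  proof (rule span2_prod_power)
    show "nzd_mod (B p) (span2 (L i) (B q ^ m i q))" if "p \<in> {1..b}" "q \<in> {1..b}" "p \<noteq> q" for p q
    proof (rule nzd_mod_span2_power[OF regular_pair_LB[OF i that(2)]])
      show "nzd_mod (B p) (span2 (L i) (B q))"
        using that by (intro nzd_mod_point_ideal_form_y P_nonzero[OF i] Q_distinct) auto
    qed
    show "u \<in> span2 (L i) (B j ^ m i j)" if j: "j \<in> {1..b}" for j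
    proof (rule nzd_modD)
      show "nzd_mod ?y (span2 (L i) (B j ^ m i j))"
        by (intro nzd_mod_span2_power[OF regular_pair_LB[OF i j]]
            nzd_mod_point_ideal_form_y P_nonzero[OF i] ey[OF j])
      have "L i * z - ?y * u \<in> span2 (L i) (B j ^ m i j)"
        using zidealD[OF u i j] pair_power_subset_span2 by blast
      then have "L i * z - (L i * z - ?y * u) \<in> span2 (L i) (B j ^ m i j)"
        by (rule ideal_diff[OF ring_ideal_span2 span2_left])
      then show "?y * u \<in> span2 (L i) (B j ^ m i j)" by simp
    qed
  qed simp
  then obtain c d where cd: "u = L i * c + ?\<Pi> * d" by (rule span2E)
  have "?\<Pi> \<in> ?I" by (rule prod_B_in_zideal) (rule max)
  then have "(L i * z - ?y * u) + (?y * d) * ?\<Pi> \<in> ?I"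
    by (intro ideal_add[OF I u] ideal_mult_left[OF I])
  also have "(L i * z - ?y * u) + (?y * d) * ?\<Pi> = L i * (z - ?y * c)"
    by (simp add: cd algebra_simps)
  finally have v: "L i * (z - ?y * c) \<in> ?I" .
  have "z - ?y * c \<in> ?I'"
  proof (rule zidealI)
    fix s j assume sj: "s \<in> {1..a}" "j \<in> {1..b}"
    have mem: "L i * (z - ?y * c) \<in> pair_power (L s) (B j) (m s j)" using v sj by (rule zidealD)
    show "z - ?y * c \<in> pair_power (L s) (B j) (?m s j)"
    proof (cases "s = i")
      case True
      show ?thesis
      proof (cases "m i j")
        case (Suc n)
        then show ?thesis using mem pair_power_cancel[OF regular_pair_LB[OF sj]] True by simp
      qed (simp add: True)
    next
      case False
      then have "nzd_mod (L i) (span2 (L s) (B j))"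
        using sj i by (intro nzd_mod_point_ideal_form_x Q_nonzero P_distinct)
      then have "z - ?y * c \<in> pair_power (L s) (B j) (m s j)"
        using mem by (rule nzd_modD[OF nzd_mod_pair_power[OF regular_pair_LB[OF sj]]])
      then show ?thesis using False by simp
    qed
  qed
  then show "z \<in> adjoin ?I' ?y" by (rule adjoinI)
qed

text \<open>
  The 0-1 matrix with rows \<open>(i, v)\<close>, columns \<open>(j, u)\<close> and entry 1 iff \<open>v + u < m i j\<close> has no
  two-by-two minor that is a permutation matrix.  The row \<open>(r, 0)\<close> of the dominating index
  \<open>r\<close> contains every other row, so it is in no such minor; deleting it is the passage from \<open>m r j\<close>
  to \<open>m r j - 1\<close>, with the rows \<open>(r, v)\<close> renumbered.
\<close>

lemma depth_cond_nested:
  assumes "depth_cond m" and "i \<in> {1..a}" "s \<in> {1..a}" "j \<in> {1..b}" "p \<in> {1..b}"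
    and "v + u < m i j" "v' + u' < m s p"
  shows "v + u' < m i p \<or> v' + u < m s j"
  using assms
proof (induction "\<Sum>i=1..a. \<Sum>j=1..b. m i j" arbitrary: m v v' rule: less_induct)
  case less
  note i_s = less.prems(2,3) and jp = less.prems(4,5)
  obtain r where r: "r \<in> {1..a}"
    and r_max: "\<And>s. s \<in> {1..a} \<Longrightarrow> (\<Sum>j=1..b. m s j) \<le> (\<Sum>j=1..b. m r j)"
  proof -
    let ?f = "\<lambda>s. \<Sum>j=1..b. m s j"
    have "Max (?f ` {1..a}) \<in> ?f ` {1..a}" using i_s by (intro Max_in) auto
    then obtain r where r: "Max (?f ` {1..a}) = ?f r" "r \<in> {1..a}" by (rule imageE)
    show ?thesis
    proof (rule that[OF r(2)])
      fix s assume "s \<in> {1..a}"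
      then have "?f s \<le> Max (?f ` {1..a})" by (intro Max_ge) auto
      then show "?f s \<le> ?f r" by (simp only: r(1))
    qed
  qed
  have r_top: "m s j \<le> m r j" if "s \<in> {1..a}" "j \<in> {1..b}" for s j
    by (rule depth_cond_max_row[OF less.prems(1) r r_max that])
  let ?m = "m(r := \<lambda>j. m r j - 1)"
  have cond': "depth_cond ?m" by (rule depth_cond_remove_row[OF less.prems(1) r r_top])
  have "m i j \<le> m r j" by (rule r_top[OF i_s(1) jp(1)])
  then have pos: "m r j > 0" using less.prems(6) by simp
  have "(\<Sum>j=1..b. m r j - 1) < (\<Sum>j=1..b. m r j)"
    using pos jp by (intro sum_strict_mono_ex1) (auto intro!: bexI[of _ j])
  then have smaller: "(\<Sum>i=1..a. \<Sum>j=1..b. ?m i j) < (\<Sum>i=1..a. \<Sum>j=1..b. m i j)"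
    using r by (intro sum_strict_mono_ex1) (auto intro!: sum_mono bexI[of _ r])
  show ?case
  proof (cases "i = r \<and> v = 0 \<or> s = r \<and> v' = 0")
    case True
    then show ?thesis
      using r_top[OF i_s(2) jp(2)] r_top[OF i_s(1) jp(1)] less.prems(6,7) by auto
  next
    case False
    \<comment> \<open>Lowering \<open>m r\<close> by one renumbers row \<open>(r, v)\<close> as \<open>(r, v - 1)\<close>.\<close>
    define w where "w = (if i = r then v - 1 else v)"
    define w' where "w' = (if s = r then v' - 1 else v')"
    have "w + u < ?m i j" "w' + u' < ?m s p"
      using less.prems(6,7) False by (auto simp: w_def w'_def)
    then have "w + u' < ?m i p \<or> w' + u < ?m s j"
      by (rule less.hyps[OF smaller cond' i_s jp])
    then show ?thesis using False by (auto simp: w_def w'_def split: if_splits)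
  qed
qed

end

section \<open>From the Cohen-Macaulay property to a regular sequence\<close>

text \<open>
  The carrier-based ring of a type class, for which ideals, quotients and the Cohen-Macaulay
  property are defined.
\<close>

abbreviation type_ring :: "'a::comm_ring_1 ring" where
  "type_ring \<equiv> ring_of_type_algebra"

lemma type_ring_simps [simp]:
  "carrier type_ring = UNIV" "x \<otimes>\<^bsub>type_ring\<^esub> y = x * y" "x \<oplus>\<^bsub>type_ring\<^esub> y = x + y"
  "\<one>\<^bsub>type_ring\<^esub> = 1" "\<zero>\<^bsub>type_ring\<^esub> = 0"
  by (simp_all add: ring_of_type_algebra_def)

lemma cring_type_ring: "cring type_ring"
  by (rule cring_from_type_algebra)

lemma ring_type_ring: "ring type_ring"
  using cring_type_ring cring.axioms(1) by blast

lemma a_inv_type_ring [simp]: "\<ominus>\<^bsub>type_ring\<^esub> x = - (x :: 'a::comm_ring_1)"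
proof -
  interpret ring "type_ring :: 'a ring" by (rule ring_type_ring)
  show ?thesis by (rule minus_equality) simp_all
qed

lemma ideal_type_ring_iff: "ideal I type_ring \<longleftrightarrow> ring_ideal I"
proof
  assume "ideal I type_ring"
  then interpret ideal I type_ring .
  show "ring_ideal I"
    using additive_subgroup.zero_closed[OF additive_subgroup_axioms]
      additive_subgroup.a_closed[OF additive_subgroup_axioms] I_l_closed
    by (intro ring_idealI) auto
next
  assume I: "ring_ideal I"
  interpret ring "type_ring :: 'a ring" by (rule ring_type_ring)
  show "ideal I type_ring"
  proof (rule idealI)
    show "subgroup I (add_monoid type_ring)"
    proof (rule add.subgroupI)
      show "I \<noteq> {}" using ideal_zero[OF I] by blast
      show "\<ominus>\<^bsub>type_ring\<^esub> x \<in> I" if "x \<in> I" for x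
        using ideal_uminus[OF I that] by simp
    qed (use ideal_add[OF I] in auto)
  qed (use ring_type_ring ideal_mult_left[OF I] ideal_mult_right[OF I] in auto)
qed

lemma genideal_pair: "genideal type_ring {A, B} = span2 A B"
proof (rule antisym)
  interpret ring "type_ring :: 'a ring" by (rule ring_type_ring)
  have "A \<in> span2 A B" "B \<in> span2 A B"
    using span2_left[of A 1 B] span2_right[of B 1 A] by simp_all
  then show "genideal type_ring {A, B} \<subseteq> span2 A B"
    by (intro genideal_minimal) (simp_all add: ideal_type_ring_iff ring_ideal_span2)
  have J: "ring_ideal (genideal type_ring {A, B})"
    unfolding ideal_type_ring_iff[symmetric] by (rule genideal_ideal) simp
  have AB: "A \<in> genideal type_ring {A, B}" "B \<in> genideal type_ring {A, B}"
    using genideal_self[of "{A, B}"] by auto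
  show "span2 A B \<subseteq> genideal type_ring {A, B}"
  proof
    fix x assume "x \<in> span2 A B"
    then obtain u v where x: "x = A * u + B * v" by (rule span2E)
    show "x \<in> genideal type_ring {A, B}"
      unfolding x by (rule ideal_add[OF J ideal_mult_right[OF J AB(1)] ideal_mult_right[OF J AB(2)]])
  qed
qed

lemma ideal_prod_pair_power:
  "ideal_prod type_ring (pair_power A B n) (span2 A B) = pair_power A B (Suc n)"
proof (rule antisym; rule subsetI)
  fix x assume "x \<in> ideal_prod type_ring (pair_power A B n) (span2 A B)"
  then show "x \<in> pair_power A B (Suc n)"
    by (induction rule: ideal_prod.induct)
      (simp_all add: pair_power_mult_span2 ideal_add[OF ring_ideal_pair_power])
next
  fix x assume "x \<in> pair_power A B (Suc n)"
  then obtain F G where x: "x = A * F + B ^ Suc n * G" and F: "F \<in> pair_power A B n"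
    by (rule pair_power_SucE)
  have "A \<in> span2 A B" "B \<in> span2 A B"
    using span2_left[of A 1 B] span2_right[of B 1 A] by simp_all
  then have "F * A \<in> ideal_prod type_ring (pair_power A B n) (span2 A B)"
    "(B ^ n * G) * B \<in> ideal_prod type_ring (pair_power A B n) (span2 A B)"
    using ideal_prod.prod[of _ "pair_power A B n" _ "span2 A B" type_ring]
      F power_right_in_pair_power[of B n G A] by simp_all
  then have "F * A + (B ^ n * G) * B \<in> ideal_prod type_ring (pair_power A B n) (span2 A B)"
    using ideal_prod.sum[of _ type_ring "pair_power A B n" "span2 A B"] by simp
  then show "x \<in> ideal_prod type_ring (pair_power A B n) (span2 A B)"
    by (simp add: x mult_ac)
qed

lemma genideal_pair_nat_pow:
  "genideal type_ring {A, B} [^]\<^bsub>ideals_set type_ring\<^esub> (n::nat) = pair_power A B n"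
proof (induction n)
  case 0
  then show ?case by (simp add: nat_pow_def ideals_set_def)
next
  case (Suc n)
  have "genideal type_ring {A, B} [^]\<^bsub>ideals_set type_ring\<^esub> Suc n =
      ideal_prod type_ring (genideal type_ring {A, B} [^]\<^bsub>ideals_set type_ring\<^esub> n) (genideal type_ring {A, B})"
    by (simp add: nat_pow_def ideals_set_def)
  then show ?case unfolding Suc unfolding genideal_pair ideal_prod_pair_power .
qed

text \<open>
  The ideal generated by \<open>I\<close> and \<open>G\<close>, for an ideal \<open>I\<close> and a finite set \<open>G\<close>.
\<close>

definition ideal_gen :: "'a::comm_ring_1 set \<Rightarrow> 'a set \<Rightarrow> 'a set" where
  "ideal_gen I G = {F. \<exists>r. F - (\<Sum>g\<in>G. r g * g) \<in> I}"

lemma ideal_genI: "F - (\<Sum>g\<in>G. r g * g) \<in> I \<Longrightarrow> F \<in> ideal_gen I G"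
  unfolding ideal_gen_def by blast

lemma ideal_genE:
  assumes "F \<in> ideal_gen I G"
  obtains r where "F - (\<Sum>g\<in>G. r g * g) \<in> I"
  using assms unfolding ideal_gen_def by blast

lemma ring_ideal_ideal_gen:
  assumes I: "ring_ideal I"
  shows "ring_ideal (ideal_gen I G)"
proof (rule ring_idealI)
  show "0 \<in> ideal_gen I G"
    by (rule ideal_genI[of _ "\<lambda>_. 0"]) (simp add: ideal_zero[OF I])
next
  fix x y assume "x \<in> ideal_gen I G" "y \<in> ideal_gen I G"
  then obtain r s where "x - (\<Sum>g\<in>G. r g * g) \<in> I" "y - (\<Sum>g\<in>G. s g * g) \<in> I"
    by (metis ideal_genE)
  then have "(x - (\<Sum>g\<in>G. r g * g)) + (y - (\<Sum>g\<in>G. s g * g)) \<in> I" by (rule ideal_add[OF I])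
  then show "x + y \<in> ideal_gen I G"
    by (intro ideal_genI[of _ "\<lambda>g. r g + s g"]) (simp add: algebra_simps sum.distrib)
next
  fix c x assume "x \<in> ideal_gen I G"
  then obtain r where "x - (\<Sum>g\<in>G. r g * g) \<in> I" by (rule ideal_genE)
  then have "c * (x - (\<Sum>g\<in>G. r g * g)) \<in> I" by (rule ideal_mult_left[OF I])
  then show "c * x \<in> ideal_gen I G"
    by (intro ideal_genI[of _ "\<lambda>g. c * r g"]) (simp add: algebra_simps sum_distrib_left)
qed

lemma subset_ideal_gen: "I \<subseteq> ideal_gen I G"
  by (rule subsetI) (rule ideal_genI[of _ "\<lambda>_. 0"], simp)

lemma generators_in_ideal_gen:
  assumes "ring_ideal I" "finite G" "g \<in> G"
  shows "g \<in> ideal_gen I G"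
proof (rule ideal_genI)
  have "(\<Sum>h\<in>G. (if h = g then 1 else 0) * h) = (\<Sum>h\<in>G. if h = g then h else 0)"
    by (intro sum.cong) auto
  also have "\<dots> = g" using assms by simp
  finally show "g - (\<Sum>h\<in>G. (if h = g then 1 else 0) * h) \<in> I"
    by (simp add: ideal_zero[OF assms(1)])
qed

context
  fixes I :: "'a::comm_ring_1 set"
  assumes I: "ring_ideal I"
begin

interpretation R: cring "type_ring :: 'a ring" by (rule cring_type_ring)
interpretation id: ideal I "type_ring :: 'a ring" using I by (simp add: ideal_type_ring_iff)

abbreviation (input) quotient where "quotient \<equiv> type_ring Quot I"
abbreviation (input) coset where "coset x \<equiv> I +>\<^bsub>type_ring\<^esub> x"

lemma cring_quot: "cring quotient"
  by (rule id.quotient_is_cring) (rule cring_type_ring)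

lemma coset_eq_iff: "coset x = coset y \<longleftrightarrow> x - y \<in> I"
proof -
  have coset_set: "coset x = {i + x | i. i \<in> I}" for x
    by (auto simp: a_r_coset_def' )
  show ?thesis
  proof
    assume "coset x = coset y"
    moreover have "x \<in> coset x" using ideal_zero[OF I] unfolding coset_set by (auto intro!: exI[of _ 0])
    ultimately obtain i where "x = i + y" "i \<in> I" unfolding coset_set by auto
    then show "x - y \<in> I" by simp
  next
    have sub: "coset x \<subseteq> coset y" if "x - y \<in> I" for x y
    proof
      fix z assume "z \<in> coset x"
      then obtain i where z: "z = i + x" "i \<in> I" unfolding coset_set by blast
      have "z = (i + (x - y)) + y" by (simp add: z)
      moreover have "i + (x - y) \<in> I" by (rule ideal_add[OF I z(2) that])
      ultimately show "z \<in> coset y" unfolding coset_set by blast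
    qed
    assume "x - y \<in> I"
    moreover from this have "y - x \<in> I" using ideal_uminus[OF I, of "x - y"] by simp
    ultimately show "coset x = coset y" using sub by (simp add: subset_antisym)
  qed
qed

lemma quot_carrier: "carrier quotient = range coset"
  by (auto simp: FactRing_def A_RCOSETS_def')

lemma quot_hom:
  "coset x \<otimes>\<^bsub>quotient\<^esub> coset y = coset (x * y)" "coset x \<oplus>\<^bsub>quotient\<^esub> coset y = coset (x + y)"
  "\<one>\<^bsub>quotient\<^esub> = coset 1" "\<zero>\<^bsub>quotient\<^esub> = coset 0"
proof -
  have hom: "coset \<in> ring_hom type_ring quotient" by (rule id.rcos_ring_hom)
  show "coset x \<otimes>\<^bsub>quotient\<^esub> coset y = coset (x * y)" "coset x \<oplus>\<^bsub>quotient\<^esub> coset y = coset (x + y)" "\<one>\<^bsub>quotient\<^esub> = coset 1"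
    using ring_hom_mult[OF hom, of x y] ring_hom_add[OF hom, of x y] ring_hom_one[OF hom] by simp_all
  interpret h: ring_hom_ring type_ring quotient coset by (rule id.rcos_ring_hom_ring)
  show "\<zero>\<^bsub>quotient\<^esub> = coset 0" using h.hom_zero by simp
qed

lemma coset_mem_image_iff:
  assumes "ring_ideal J" "I \<subseteq> J"
  shows "coset x \<in> coset ` J \<longleftrightarrow> x \<in> J"
proof
  assume "coset x \<in> coset ` J"
  then obtain y where y: "coset x = coset y" "y \<in> J" by (rule imageE)
  then have "x - y \<in> J" using assms(2) by (auto simp: coset_eq_iff)
  then have "(x - y) + y \<in> J" using y(2) by (rule ideal_add[OF assms(1)])
  then show "x \<in> J" by simp
qed simp

lemma coset_image_subset_iff:
  assumes "ring_ideal J" "I \<subseteq> J" "ring_ideal J'" "I \<subseteq> J'"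
  shows "coset ` J \<subseteq> coset ` J' \<longleftrightarrow> J \<subseteq> J'"
  using coset_mem_image_iff[OF assms(3,4)] by blast

lemma ideal_coset_image:
  assumes "ring_ideal J"
  shows "ideal (coset ` J) quotient"
  by (rule R.ring_ideal_imp_quot_ideal) (use assms I in \<open>simp_all add: ideal_type_ring_iff\<close>)

lemma ring_ideal_vimage:
  assumes "ideal K quotient"
  shows "ring_ideal {x. coset x \<in> K}"
proof -
  interpret K: ideal K quotient by (rule assms)
  show ?thesis
  proof (rule ring_idealI)
    show "0 \<in> {x. coset x \<in> K}" using additive_subgroup.zero_closed[OF K.additive_subgroup_axioms] by (simp add: quot_hom)
  next
    fix x y assume "x \<in> {x. coset x \<in> K}" "y \<in> {x. coset x \<in> K}"
    then show "x + y \<in> {x. coset x \<in> K}"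
      using additive_subgroup.a_closed[OF K.additive_subgroup_axioms, of "coset x" "coset y"] by (simp add: quot_hom)
  next
    fix r x assume "x \<in> {x. coset x \<in> K}"
    then show "r * x \<in> {x. coset x \<in> K}"
      using K.I_l_closed[of "coset x" "coset r"] by (simp add: quot_hom quot_carrier)
  qed
qed

text \<open>
  Ideals of the quotient correspond to ideals containing \<open>I\<close>; this is the correspondence for
  finitely generated ones.
\<close>

lemma genideal_coset_image:
  assumes fin: "finite G"
  shows "genideal quotient (coset ` G) = coset ` ideal_gen I G"
proof (rule antisym)
  interpret Q: cring quotient by (rule cring_quot)
  show "genideal quotient (coset ` G) \<subseteq> coset ` ideal_gen I G"
    using generators_in_ideal_gen[OF I fin]
    by (intro Q.genideal_minimal ideal_coset_image ring_ideal_ideal_gen I) auto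
  have sub: "coset ` G \<subseteq> carrier quotient" by (auto simp: quot_carrier)
  let ?K = "genideal quotient (coset ` G)"
  have K: "ideal ?K quotient" by (rule Q.genideal_ideal[OF sub])
  then interpret K: ideal ?K quotient .
  have V: "ring_ideal {x. coset x \<in> ?K}" by (rule ring_ideal_vimage[OF K])
  have GK: "coset g \<in> ?K" if "g \<in> G" for g using Q.genideal_self[OF sub] that by blast
  have IK: "coset x \<in> ?K" if "x \<in> I" for x
  proof -
    have "coset x = coset 0" using that by (simp add: coset_eq_iff)
    then show ?thesis using additive_subgroup.zero_closed[OF K.additive_subgroup_axioms] by (simp add: quot_hom)
  qed
  show "coset ` ideal_gen I G \<subseteq> ?K"
  proof (rule image_subsetI)
    fix x assume "x \<in> ideal_gen I G"
    then obtain r where r: "x - (\<Sum>g\<in>G. r g * g) \<in> I" by (rule ideal_genE)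
    have "(x - (\<Sum>g\<in>G. r g * g)) + (\<Sum>g\<in>G. r g * g) \<in> {x. coset x \<in> ?K}"
    proof (rule ideal_add[OF V])
      show "(\<Sum>g\<in>G. r g * g) \<in> {x. coset x \<in> ?K}"
        by (rule ideal_sum[OF V], rule ideal_mult_left[OF V]) (simp add: GK)
    qed (use IK[OF r] in simp)
    then show "coset x \<in> ?K" by simp
  qed
qed

lemma primeideal_coset_image:
  assumes J: "ring_ideal J" "I \<subseteq> J" and "1 \<notin> J" and prime: "\<And>x y. x * y \<in> J \<Longrightarrow> x \<in> J \<or> y \<in> J"
  shows "primeideal (coset ` J) quotient"
proof (rule primeidealI[OF ideal_coset_image[OF J(1)] cring_quot])
  have "coset 1 \<notin> coset ` J" using coset_mem_image_iff[OF J] assms(3) by blast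
  then show "carrier quotient \<noteq> coset ` J" unfolding quot_carrier by blast
  fix a b assume "a \<in> carrier quotient" "b \<in> carrier quotient" and ab: "a \<otimes>\<^bsub>quotient\<^esub> b \<in> coset ` J"
  then obtain x y where xy: "a = coset x" "b = coset y" unfolding quot_carrier by blast
  then have "x * y \<in> J" using ab coset_mem_image_iff[OF J] by (simp add: quot_hom)
  then show "a \<in> coset ` J \<or> b \<in> coset ` J" using prime xy by blast
qed

end

text \<open>
  An ideal that contains the irrelevant ideal and an element with nonzero constant term contains
  that constant, hence a unit.
\<close>

lemma maximalideal_coset_const_term:
  fixes I :: "'k::field bipoly set"
  assumes I: "ring_ideal I" and sub: "I \<subseteq> {F. const_term F = 0}"
  shows "maximalideal ((\<lambda>F. I +>\<^bsub>coord_ring\<^esub> F) ` {F. const_term F = 0}) (coord_ring Quot I)"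
proof (rule maximalidealI)
  let ?M = "{F :: 'k bipoly. const_term F = 0}" and ?Q = "coord_ring Quot I"
  let ?\<pi> = "\<lambda>F. I +>\<^bsub>coord_ring\<^esub> F"
  have M: "ring_ideal ?M" by (rule ring_ideal_const_term)
  show "ideal (?\<pi> ` ?M) ?Q" by (rule ideal_coset_image[OF I M])
  have "?\<pi> 1 \<notin> ?\<pi> ` ?M" unfolding coset_mem_image_iff[OF I M sub] by simp
  then show "carrier ?Q \<noteq> ?\<pi> ` ?M" unfolding quot_carrier[OF I] by blast
  fix J assume J: "ideal J ?Q" "?\<pi> ` ?M \<subseteq> J" "J \<subseteq> carrier ?Q"
  show "J = ?\<pi> ` ?M \<or> J = carrier ?Q"
  proof (cases "J \<subseteq> ?\<pi> ` ?M")
    case False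
    have V: "ring_ideal {F. ?\<pi> F \<in> J}" by (rule ring_ideal_vimage[OF I J(1)])
    from False J(3) obtain F where F: "?\<pi> F \<in> J" "?\<pi> F \<notin> ?\<pi> ` ?M"
      unfolding quot_carrier[OF I] by blast
    then have c: "const_term F \<noteq> 0" by blast
    have "F - const (const_term F) \<in> ?M" by (simp add: const_term_simps)
    then have "F - const (const_term F) \<in> {F. ?\<pi> F \<in> J}" using J(2) by blast
    moreover have "F \<in> {F. ?\<pi> F \<in> J}" using F(1) by simp
    ultimately have "F - (F - const (const_term F)) \<in> {F. ?\<pi> F \<in> J}"
      by (rule ideal_diff[OF V, rotated])
    then have "const (inverse (const_term F)) * const (const_term F) \<in> {F. ?\<pi> F \<in> J}"
      by (intro ideal_mult_left[OF V]) simp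
    then have "1 \<in> {F. ?\<pi> F \<in> J}" using const_inverse[OF c] by (simp add: mult.commute)
    then have "G \<in> {F. ?\<pi> F \<in> J}" for G using ideal_mult_left[OF V, of 1 G] by simp
    then show ?thesis using J(3) unfolding quot_carrier[OF I] by blast
  qed (use J(2) in blast)
qed

lemma kernel_prime:
  fixes h :: "'k::field bipoly \<Rightarrow> 'k bipoly"
  assumes "h = subst f"
  shows "ring_ideal {F. h F = 0}" "1 \<notin> {F. h F = 0}"
    "F * G \<in> {F. h F = 0} \<Longrightarrow> F \<in> {F. h F = 0} \<or> G \<in> {F. h F = 0}"
  by (auto simp: assms subst_simps intro: ring_idealI)

text \<open>
  The chain is made of the ideal of a point, the ideal generated by the first two variables and
  \<open>form_y q\<close>, and the irrelevant ideal.  Each is the kernel of a substitution, hence prime.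
\<close>

lemma height_coset_const_term:
  fixes I :: "'k::field bipoly set"
  assumes I: "ring_ideal I" and p: "p \<noteq> (0, 0)" and q: "q \<noteq> (0, 0)"
    and sub: "I \<subseteq> span2 (form_x p) (form_y q)"
  shows "height (coord_ring Quot I) ((\<lambda>F. I +>\<^bsub>coord_ring\<^esub> F) ` {F. const_term F = 0}) \<ge> 2"
proof -
  let ?Q = "coord_ring Quot I" and ?\<pi> = "\<lambda>F. I +>\<^bsub>coord_ring\<^esub> F"
  obtain e f where ef: "cross p e = 1" "cross q f = 1"
    using dual_point_exists p q by meson
  define h1 where "h1 = subst (case_var 0 0 (const (fst q) * form_y f) (const (snd q) * form_y f))"
  define h2 :: "'k bipoly \<Rightarrow> 'k bipoly" where "h2 = subst (\<lambda>_. 0)"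
  \<comment> \<open>\<open>h1\<close> sets the first two variables to zero and restricts the other two to the point \<open>q\<close>;
    \<open>h2\<close> takes the constant term.\<close>
  define J0 J1 J2 where J: "J0 = {F. at_point p e q f F = 0}" "J1 = {F. h1 F = 0}" "J2 = {F. h2 F = 0}"
  have J2: "J2 = {F. const_term F = 0}"
    unfolding J h2_def const_const_term[symmetric] by simp
  have h1_form: "h1 (form_x r) = 0" "h1 (form_y s) = const (cross q s) * form_y f" for r s
    by (simp_all add: h1_def form_x_eq form_y_eq subst_simps cross_def const_diff const_mult algebra_simps)
  have I0: "I \<subseteq> J0" using sub unfolding J by (auto simp: point_ideal_iff[OF ef])
  have sub01: "J0 \<subseteq> J1"
  proof
    fix F assume "F \<in> J0"
    then have "F \<in> span2 (form_x p) (form_y q)" by (simp add: J point_ideal_iff[OF ef])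
    then obtain u v where "F = form_x p * u + form_y q * v" by (rule span2E)
    then have "h1 F = h1 (form_x p) * h1 u + h1 (form_y q) * h1 v" by (simp add: h1_def subst_simps)
    then show "F \<in> J1" by (simp add: J h1_form)
  qed
  have "form_x e \<in> J1" "form_x e \<notin> J0"
    using ef by (auto simp: J h1_form at_point_form_x intro!: form_x_nonzero) (auto simp: cross_def)
  then have strict01: "J0 \<subset> J1" using sub01 by blast
  have M: "ring_ideal {F :: 'k bipoly. const_term F = 0}" by (rule ring_ideal_const_term)
  have sub12: "J1 \<subseteq> J2"
  proof
    fix F assume F: "F \<in> J1"
    have "F - h1 F \<in> {F. const_term F = 0}"
      unfolding h1_def
    proof (rule subst_cong_mod[OF M])
      show "variable v - (case v of X0 \<Rightarrow> 0 | X1 \<Rightarrow> 0 | Y0 \<Rightarrow> const (fst q) * form_y f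
          | Y1 \<Rightarrow> const (snd q) * form_y f) \<in> {F. const_term F = 0}" for v
        by (cases v) (simp_all add: const_term_simps)
    qed
    then show "F \<in> J2" using F by (simp add: J2 J(2))
  qed
  have "form_y f \<noteq> 0" using ef(2) by (intro form_y_nonzero) (auto simp: cross_def)
  then have "form_y f \<notin> J1" by (simp add: J h1_form ef(2))
  moreover have "form_y f \<in> J2" by (simp add: J h2_def form_y_eq[of f] subst_simps)
  ultimately have strict12: "J1 \<subset> J2" using sub12 by blast
  have id: "ring_ideal J0" "ring_ideal J1" "ring_ideal J2"
    unfolding J by (rule kernel_prime(1), simp add: at_point_def h1_def h2_def)+
  have sub: "I \<subseteq> J0" "I \<subseteq> J1" "I \<subseteq> J2" using I0 sub01 sub12 by auto
  have prime: "primeideal (?\<pi> ` J0) ?Q" "primeideal (?\<pi> ` J1) ?Q" "primeideal (?\<pi> ` J2) ?Q"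
    by (rule primeideal_coset_image[OF I]; use id sub in \<open>simp add: J at_point_def h1_def h2_def subst_simps\<close>)+
  have "?\<pi> ` J0 \<subset> ?\<pi> ` J1" "?\<pi> ` J1 \<subset> ?\<pi> ` J2" "?\<pi> ` J0 \<subset> ?\<pi> ` J2"
    using strict01 strict12 id sub
    by (auto simp: less_le_not_le coset_image_subset_iff[OF I])
  then have "[?\<pi> ` J0, ?\<pi> ` J1, ?\<pi> ` J2] \<in> {ps. ps \<noteq> [] \<and> (\<forall>p\<in>set ps. primeideal p ?Q)
      \<and> sorted_wrt (\<subset>) ps \<and> last ps = ?\<pi> ` {F. const_term F = 0}}"
    using prime by (simp flip: J2)
  then have "enat (length [?\<pi> ` J0, ?\<pi> ` J1, ?\<pi> ` J2] - 1) \<le> height ?Q (?\<pi> ` {F. const_term F = 0})"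
    unfolding height_def by (rule SUP_upper)
  then show ?thesis by (simp add: numeral_eq_enat numeral_2_eq_2)
qed

text \<open>
  Grade equals height at the irrelevant ideal, and the height is at least two.
\<close>

lemma cohen_macaulay_regular_pair_of_forms:
  fixes I :: "'k::field bipoly set"
  assumes cm: "cohen_macaulay (coord_ring Quot I)"
    and I: "ring_ideal I" and p: "p \<noteq> (0, 0)" and q: "q \<noteq> (0, 0)"
    and sub: "I \<subseteq> span2 (form_x p) (form_y q)"
  shows "\<exists>f g. const_term f = 0 \<and> const_term g = 0 \<and> nzd_mod f I \<and> nzd_mod g (adjoin I f)"
proof -
  let ?Q = "coord_ring Quot I" and ?\<pi> = "\<lambda>F. I +>\<^bsub>coord_ring\<^esub> F"
  let ?M = "{F :: 'k bipoly. const_term F = 0}"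
  have IM: "I \<subseteq> ?M"
    using sub by (auto elim!: span2E dest!: subsetD simp: const_term_simps)
  have "maximalideal (?\<pi> ` ?M) ?Q" by (rule maximalideal_coset_const_term[OF I IM])
  then have "grade ?Q (?\<pi> ` ?M) = height ?Q (?\<pi> ` ?M)"
    using cm by (simp add: cohen_macaulay_def)
  then have "enat 1 < grade ?Q (?\<pi> ` ?M)"
    using height_coset_const_term[OF I p q sub] by (simp add: numeral_eq_enat) (erule order.strict_trans2[rotated], simp)
  then obtain rs where rs: "regular_sequence ?Q rs" "set rs \<subseteq> ?\<pi> ` ?M" "length rs > 1"
    unfolding grade_def less_SUP_iff by auto
  then have in_M: "rs ! 0 \<in> ?\<pi> ` ?M" "rs ! 1 \<in> ?\<pi> ` ?M" by (auto intro!: subsetD[OF rs(2)] nth_mem)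
  then obtain f g where f: "rs ! 0 = ?\<pi> f" "const_term f = 0" and g: "rs ! 1 = ?\<pi> g" "const_term g = 0"
    by (metis (mono_tags, lifting) imageE mem_Collect_eq)
  have reg: "y \<in> genideal ?Q (set (take i rs))"
    if "i < length rs" "y \<in> carrier ?Q" "rs ! i \<otimes>\<^bsub>?Q\<^esub> y \<in> genideal ?Q (set (take i rs))" for i y
    using rs(1) that unfolding regular_sequence_def by blast
  have gen: "ideal_gen I {} = I" "ideal_gen I {f} = adjoin I f"
  proof -
    have "F \<in> ideal_gen I {f}" if "F - f * w \<in> I" for F w
      using that by (intro ideal_genI[of _ "\<lambda>_. w"]) (simp add: mult.commute)
    then show "ideal_gen I {f} = adjoin I f"
      by (auto elim!: ideal_genE adjoinE intro: adjoinI simp: mult.commute[of _ f])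
  qed (auto simp: ideal_gen_def)
  have take: "set (take 0 rs) = ?\<pi> ` {}" "set (take 1 rs) = ?\<pi> ` {f}"
    using rs(3) f(1) by (cases rs; simp)+
  have idl: "genideal ?Q (set (take 0 rs)) = ?\<pi> ` I" "genideal ?Q (set (take 1 rs)) = ?\<pi> ` adjoin I f"
    unfolding take by (simp_all only: genideal_coset_image[OF I] finite.intros gen)
  have "nzd_mod f I"
  proof (rule nzd_modI)
    fix z assume "f * z \<in> I"
    then have "rs ! 0 \<otimes>\<^bsub>?Q\<^esub> ?\<pi> z \<in> ?\<pi> ` I" by (simp add: f(1) quot_hom[OF I])
    then have "?\<pi> z \<in> ?\<pi> ` I"
      using reg[of 0 "?\<pi> z"] rs(3) unfolding idl quot_carrier[OF I] by fastforce
    then show "z \<in> I" by (simp only: coset_mem_image_iff[OF I I order_refl])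
  qed
  moreover have "nzd_mod g (adjoin I f)"
  proof (rule nzd_modI)
    fix z assume "g * z \<in> adjoin I f"
    then have "rs ! 1 \<otimes>\<^bsub>?Q\<^esub> ?\<pi> z \<in> ?\<pi> ` adjoin I f" by (simp only: g(1) quot_hom[OF I] imageI)
    then have "?\<pi> z \<in> ?\<pi> ` adjoin I f"
      using reg[of 1 "?\<pi> z"] rs(3) unfolding idl quot_carrier[OF I] by blast
    then show "z \<in> adjoin I f"
      by (simp only: coset_mem_image_iff[OF I ring_ideal_adjoin[OF I] subset_adjoin])
  qed
  ultimately show ?thesis using f(2) g(2) by blast
qed

lemma (in grid) fat_ideal_eq: "fat_ideal a b P Q n = zideal n"
  by (auto simp: fat_ideal_def point_ideal_def genideal_pair_nat_pow zideal_def)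

section \<open>A free basis of separators\<close>

lemma scale_pair_power:
  assumes "F \<in> pair_power (form_x p) (form_y q) n"
  shows "scale c d F \<in> pair_power (form_x p) (form_y q) n"
  using assms
proof (induction n arbitrary: F)
  case (Suc n)
  from Suc.prems obtain F' G
    where F: "F = form_x p * F' + form_y q ^ Suc n * G" and F': "F' \<in> pair_power (form_x p) (form_y q) n"
    by (rule pair_power_SucE)
  have "scale c d F = scale c d (form_x p) * scale c d F' + scale c d (form_y q) ^ Suc n * scale c d G"
    by (simp only: F scale_def subst_simps)
  also have "\<dots> = form_x p * (const c * scale c d F') + form_y q ^ Suc n * (const d ^ Suc n * scale c d G)"
    by (simp only: scale_form_x scale_form_y power_mult_distrib) (simp only: mult_ac)
  also have "\<dots> \<in> pair_power (form_x p) (form_y q) (Suc n)"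
    by (intro pair_power_SucI ideal_mult_left[OF ring_ideal_pair_power] Suc.IH F')
  finally show ?case .
qed simp

text \<open>
  The numerical assumption is the consequence of nestedness that puts the products of
  lines below into the ideal \<open>zideal\<close> of the lowered multiplicities.
\<close>

locale separator_setup = grid a b P Q
  for a b :: nat and P Q :: "nat \<Rightarrow> 'k::field_char_0 \<times> 'k" +
  fixes m :: "nat \<Rightarrow> nat \<Rightarrow> nat" and i j M :: nat
  assumes i: "i \<in> {1..a}" and j: "j \<in> {1..b}" and mij: "m i j = Suc M"
    and nested: "\<And>l s p. \<lbrakk>l \<le> M; s \<in> {1..a}; p \<in> {1..b}\<rbrakk> \<Longrightarrow>
      m s p \<le> (m s j - (M - l)) + (m i p - l)"
begin

abbreviation "m' \<equiv> lower_mult m i j"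

lemma lower_mult_eq: "m' s p = (if s = i \<and> p = j then M else m s p)"
  by (simp add: lower_mult_def mij)

lemma zideal_subset: "zideal m \<subseteq> zideal m'"
proof
  fix F assume F: "F \<in> zideal m"
  show "F \<in> zideal m'"
  proof (rule zidealI)
    fix s p assume sp: "s \<in> {1..a}" "p \<in> {1..b}"
    have "m' s p \<le> m s p" by (simp add: lower_mult_eq mij)
    then show "F \<in> pair_power (L s) (B p) (m' s p)"
      using zidealD[OF F sp] pair_power_antimono by blast
  qed
qed

text \<open>
  The product of lines that, by \<open>leading_coefficient_divisible\<close> for the two lines through the
  point, divides the coefficient of \<open>L i ^ l * B j ^ (M - l)\<close>.
\<close>

definition cofactor :: "nat \<Rightarrow> 'k bipoly" where
  "cofactor l = (\<Prod>s\<in>{1..a} - {i}. L s ^ (m s j - (M - l))) * (\<Prod>p\<in>{1..b} - {j}. B p ^ (m i p - l))"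

definition separator :: "nat \<Rightarrow> 'k bipoly" where
  "separator l = L i ^ l * B j ^ (M - l) * cofactor l"

lemma separator_in_zideal:
  assumes l: "l \<le> M"
  shows "separator l \<in> zideal m'"
proof (rule dvd_in_zidealI)
  fix s p assume sp: "s \<in> {1..a}" "p \<in> {1..b}"
  \<comment> \<open>The exponents of all lines in \<open>separator l\<close>, including the two through the point.\<close>
  define e where "e s = (if s = i then l else m s j - (M - l))" for s
  define f where "f p = (if p = j then M - l else m i p - l)" for p
  have "(\<Prod>s=1..a. L s ^ e s) = L i ^ l * (\<Prod>s\<in>{1..a} - {i}. L s ^ (m s j - (M - l)))"
    using i by (subst prod.remove[of _ i]) (auto simp: e_def intro!: prod.cong)
  moreover have "(\<Prod>p=1..b. B p ^ f p) = B j ^ (M - l) * (\<Prod>p\<in>{1..b} - {j}. B p ^ (m i p - l))"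
    using j by (subst prod.remove[of _ j]) (auto simp: f_def intro!: prod.cong)
  ultimately have sep: "separator l = (\<Prod>s=1..a. L s ^ e s) * (\<Prod>p=1..b. B p ^ f p)"
    by (simp only: separator_def cofactor_def mult_ac)
  have "L s ^ e s * B p ^ f p dvd separator l"
    unfolding sep using sp by (intro mult_dvd_mono dvd_prodI) auto
  moreover have "m' s p \<le> e s + f p"
    using nested[OF l sp] l mij by (auto simp: lower_mult_eq e_def f_def)
  ultimately show "\<exists>l' k. m' s p \<le> l' + k \<and> L s ^ l' * B p ^ k dvd separator l" by blast
qed

lemma nzd_mod_cofactor: "nzd_mod (cofactor l) (span2 (L i) (B j))"
  unfolding cofactor_def
  by (intro nzd_mod_mult nzd_mod_prod nzd_mod_point_ideal_form_x nzd_mod_point_ideal_form_y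
      P_distinct Q_distinct P_nonzero Q_nonzero i j) auto

text \<open>
  Expand \<open>F\<close> in the monomials \<open>L i ^ l * B j ^ (M - l)\<close>.  On restriction to the point, the two
  factors of \<open>cofactor l\<close> become powers of the two coordinates of \<open>R / (L i, B j)\<close>.  Each of
  them divides the coefficient, and so does their product.
\<close>

lemma separators_generate:
  assumes F: "F \<in> zideal m'"
  shows "\<exists>r. F - (\<Sum>l\<le>M. r l * separator l) \<in> zideal m"
proof -
  have reg: "regular_pair (L i) (B j)" by (rule regular_pair_LB[OF i j])
  have m'ij: "m' i j = M" by (simp add: lower_mult_eq)
  have "F \<in> pair_power (L i) (B j) M" using zidealD[OF F i j] by (simp add: m'ij)
  then obtain H where H: "F = (\<Sum>l\<le>M. L i ^ l * B j ^ (M - l) * H l)"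
    using pair_power_expansion by blast
  obtain e f where ef: "cross (P i) e = 1" "cross (Q j) f = 1"
    using dual_point_exists[OF P_nonzero[OF i]] dual_point_exists[OF Q_nonzero[OF j]] by blast
  let ?\<rho> = "at_point (P i) e (Q j) f"
  note \<rho>_iff = point_ideal_iff[OF ef]
  have \<rho>_idem: "?\<rho> (?\<rho> G) = ?\<rho> G" for G
  proof -
    have "?\<rho> (G - ?\<rho> G) = 0" using minus_at_point_in_span2[OF ef, of G] by (simp only: \<rho>_iff)
    then show ?thesis by (simp add: at_point_def subst_diff)
  qed
  have nonzero: "e \<noteq> (0, 0)" "f \<noteq> (0, 0)" using ef by (auto simp: cross_def)
  have "\<exists>r. H l - cofactor l * r \<in> span2 (L i) (B j)" if l: "l \<le> M" for l
  proof -
    let ?U = "\<Prod>s\<in>{1..a} - {i}. L s ^ (m s j - (M - l))"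
    let ?V = "\<Prod>p\<in>{1..b} - {j}. B p ^ (m i p - l)"
    have "\<exists>g. H (M - (M - l)) - (\<Prod>s\<in>{1..a} - {i}. L s ^ (m' s j - (M - l))) * g \<in> span2 (B j) (L i)"
    proof (rule leading_coefficient_divisible[where n = "\<lambda>s. m' s j"])
      show "regular_pair (B j) (L s)" if "s \<in> {1..a}" for s
        by (rule regular_pair_swap[OF regular_pair_LB[OF that j]])
      show "nzd_mod (L s) (span2 (B j) (L t))" if "s \<in> {1..a}" "t \<in> {1..a}" "s \<noteq> t" for s t
        unfolding span2_commute[of "B j"]
        using that by (intro nzd_mod_point_ideal_form_x Q_nonzero[OF j] P_distinct) auto
      show "F \<in> pair_power (B j) (L s) (m' s j)" if "s \<in> {1..a}" for s
        unfolding pair_power_commute[of "B j"] using that by (rule zidealD[OF F _ j])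
      show "F = (\<Sum>u\<le>M. B j ^ u * L i ^ (M - u) * H (M - u))"
        unfolding H by (rule sum.reindex_bij_witness[of _ "\<lambda>u. M - u" "\<lambda>u. M - u"]) (auto simp: mult_ac)
    qed (use i m'ij in auto)
    moreover have "m' s j - (M - l) = m s j - (M - l)" if "s \<in> {1..a} - {i}" for s
      using that by (simp add: lower_mult_eq)
    ultimately obtain g where g: "H l - ?U * g \<in> span2 (L i) (B j)"
      using l by (auto simp: span2_commute[of "B j"])
    have "\<exists>g. H l - (\<Prod>p\<in>{1..b} - {j}. B p ^ (m' i p - l)) * g \<in> span2 (L i) (B j)"
    proof (rule leading_coefficient_divisible[where n = "\<lambda>p. m' i p"])
      show "regular_pair (L i) (B p)" if "p \<in> {1..b}" for p
        using that by (intro regular_pair_LB i)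
      show "nzd_mod (B p) (span2 (L i) (B q))" if "p \<in> {1..b}" "q \<in> {1..b}" "p \<noteq> q" for p q
        using that by (intro nzd_mod_point_ideal_form_y P_nonzero[OF i] Q_distinct) auto
      show "F \<in> pair_power (L i) (B p) (m' i p)" if "p \<in> {1..b}" for p
        using that by (rule zidealD[OF F i])
    qed (use j m'ij H l in auto)
    moreover have "m' i p - l = m i p - l" if "p \<in> {1..b} - {j}" for p
      using that by (simp add: lower_mult_eq)
    ultimately obtain h where h: "H l - ?V * h \<in> span2 (L i) (B j)" by auto
    have cp: "const (\<Prod>s\<in>S. c s ^ n s) = (\<Prod>s\<in>S. const (c s) ^ n s)"
      for S :: "nat set" and c :: "nat \<Rightarrow> 'k" and n
      by (induction S rule: infinite_finite_induct) (simp_all add: const_mult const_power)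
    define c where "c = (\<Prod>s\<in>{1..a} - {i}. cross (P i) (P s) ^ (m s j - (M - l)))"
    define d where "d = (\<Prod>p\<in>{1..b} - {j}. cross (Q j) (Q p) ^ (m i p - l))"
    define E where "E = (\<Sum>s\<in>{1..a} - {i}. m s j - (M - l))"
    define E' where "E' = (\<Sum>p\<in>{1..b} - {j}. m i p - l)"
    have "?\<rho> ?U = (\<Prod>s\<in>{1..a} - {i}. ?\<rho> (L s) ^ (m s j - (M - l)))"
      by (simp only: at_point_def subst_simps)
    then have \<rho>U: "?\<rho> ?U = const c * form_x e ^ E"
      by (simp add: at_point_form_x power_mult_distrib prod.distrib c_def cp E_def power_sum)
    have "?\<rho> ?V = (\<Prod>p\<in>{1..b} - {j}. ?\<rho> (B p) ^ (m i p - l))"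
      by (simp only: at_point_def subst_simps)
    then have \<rho>V: "?\<rho> ?V = const d * form_y f ^ E'"
      by (simp add: at_point_form_y power_mult_distrib prod.distrib d_def cp E'_def power_sum)
    have "?\<rho> (H l) = ?\<rho> ?U * ?\<rho> g"
      using g by (simp only: \<rho>_iff at_point_def subst_diff subst_mult right_minus_eq)
    then have "form_x e ^ E dvd ?\<rho> (H l)"
      unfolding \<rho>U by (simp only:) (intro dvd_mult2 dvd_mult dvd_refl)
    moreover have "?\<rho> (H l) = ?\<rho> ?V * ?\<rho> h"
      using h by (simp only: \<rho>_iff at_point_def subst_diff subst_mult right_minus_eq)
    then have "form_y f ^ E' dvd ?\<rho> (H l)"
      unfolding \<rho>V by (simp only:) (intro dvd_mult2 dvd_mult dvd_refl)
    ultimately have "form_x e ^ E * form_y f ^ E' dvd ?\<rho> (H l)"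
      by (intro regular_pair_monomial_dvd regular_pair_form_x_form_y nonzero)
    then obtain k where k: "?\<rho> (H l) = form_x e ^ E * form_y f ^ E' * k" by (elim dvdE)
    have "c \<noteq> 0" unfolding c_def using P_distinct i by auto
    moreover have "d \<noteq> 0" unfolding d_def using Q_distinct j by auto
    ultimately have cd: "const (c * d) * const (inverse (c * d)) = 1" by (intro const_inverse) simp
    define r where "r = const (inverse (c * d)) * k"
    have "?\<rho> (cofactor l) * r = form_x e ^ E * form_y f ^ E' * k * (const (c * d) * const (inverse (c * d)))"
      unfolding cofactor_def at_point_def[of "P i" e "Q j" f] subst_mult
      unfolding at_point_def[of "P i" e "Q j" f, symmetric] \<rho>U \<rho>V r_def const_mult
      by (simp only: mult_ac)
    then have "?\<rho> (H l) = ?\<rho> (cofactor l) * r" by (simp only: cd k mult_1_right)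
    then have "?\<rho> (?\<rho> (H l)) = ?\<rho> (?\<rho> (cofactor l)) * ?\<rho> r"
      by (simp only: at_point_def subst_mult)
    then have "?\<rho> (H l - cofactor l * r) = 0"
      unfolding \<rho>_idem by (simp add: at_point_def subst_diff subst_mult)
    then show ?thesis using \<rho>_iff by blast
  qed
  then obtain r where r: "H l - cofactor l * r l \<in> span2 (L i) (B j)" if "l \<le> M" for l by metis
  let ?D = "F - (\<Sum>l\<le>M. r l * separator l)"
  have D: "?D = (\<Sum>l\<le>M. L i ^ l * B j ^ (M - l) * (H l - cofactor l * r l))"
    unfolding H by (simp add: separator_def right_diff_distrib sum_subtractf mult_ac)
  have top: "?D \<in> pair_power (L i) (B j) (Suc M)"
    unfolding D
  proof (rule ideal_sum[OF ring_ideal_pair_power])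
    fix l assume "l \<in> {..M}"
    then have l: "l \<le> M" by simp
    have "L i ^ l * B j ^ (M - l) \<in> pair_power (L i) (B j) M"
      using monomial_in_pair_power[of M l "M - l" "L i" "B j" 1] l by simp
    then show "L i ^ l * B j ^ (M - l) * (H l - cofactor l * r l) \<in> pair_power (L i) (B j) (Suc M)"
      by (rule pair_power_mult_span2[OF _ r[OF l]])
  qed
  have "?D \<in> zideal m'"
    using separator_in_zideal
    by (intro ideal_diff[OF ring_ideal_zideal F] ideal_sum[OF ring_ideal_zideal]
        ideal_mult_left[OF ring_ideal_zideal]) simp
  have "?D \<in> zideal m"
  proof (rule zidealI)
    fix s p assume sp: "s \<in> {1..a}" "p \<in> {1..b}"
    show "?D \<in> pair_power (L s) (B p) (m s p)"
    proof (cases "s = i \<and> p = j")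
      case True
      then show ?thesis using top by (simp add: mij)
    next
      case False
      then show ?thesis using zidealD[OF \<open>?D \<in> zideal m'\<close> sp] by (auto simp: lower_mult_eq)
    qed
  qed
  then show ?thesis by blast
qed

text \<open>
  The classes of the separators are linearly independent over \<open>R / (L i, B j)\<close>, since the
  monomials \<open>L i ^ l * B j ^ (M - l)\<close> are and the cofactors are non-zero-divisors.  Only the
  constant terms of the coefficients are kept, as elements of the point ideal have none.
\<close>

lemma separators_independent:
  assumes "(\<Sum>l\<le>M. r l * separator l) \<in> pair_power (L i) (B j) (Suc M)" "l \<le> M"
  shows "const_term (r l) = 0"
proof -
  have eq: "(\<Sum>l\<le>M. r l * separator l) = (\<Sum>l\<le>M. L i ^ l * B j ^ (M - l) * (cofactor l * r l))"
    by (simp add: separator_def mult_ac)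
  have "cofactor l * r l \<in> span2 (L i) (B j)"
    by (rule quasi_regular[OF regular_pair_LB[OF i j] assms(1)[unfolded eq] assms(2)])
  then have "r l \<in> span2 (L i) (B j)" by (rule nzd_modD[OF nzd_mod_cofactor])
  then show ?thesis by (auto elim!: span2E simp: const_term_simps)
qed

definition separator_degree :: "nat \<Rightarrow> nat \<times> nat" where
  "separator_degree l = ((\<Sum>s=1..a. m s j - (M - l)) - 1, (\<Sum>p=1..b. m i p - l) - 1)"

lemma has_bidegree_separator:
  assumes l: "l \<le> M"
  shows "has_bidegree (separator l) (separator_degree l)"
proof -
  have "(\<Sum>s=1..a. m s j - (M - l)) = Suc l + (\<Sum>s\<in>{1..a} - {i}. m s j - (M - l))"
    using i l by (subst sum.remove[of _ i]) (auto simp: mij)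
  moreover have "(\<Sum>p=1..b. m i p - l) = Suc (M - l) + (\<Sum>p\<in>{1..b} - {j}. m i p - l)"
    using j l by (subst sum.remove[of _ j]) (auto simp: mij)
  ultimately have deg: "separator_degree l =
      (l + (\<Sum>s\<in>{1..a} - {i}. m s j - (M - l)), M - l + (\<Sum>p\<in>{1..b} - {j}. m i p - l))"
    by (simp add: separator_degree_def)
  have x: "has_bidegree (L s ^ n) (n, 0)" and y: "has_bidegree (B p ^ n) (0, n)" for s p n
    using has_bidegree_power[OF has_bidegree_form_x[of "P s"], of n]
      has_bidegree_power[OF has_bidegree_form_y[of "Q p"], of n] by simp_all
  have X: "has_bidegree (\<Prod>s\<in>S. L s ^ n s) (\<Sum>s\<in>S. n s, 0)" for S n
    using has_bidegree_prod[of S "\<lambda>s. L s ^ n s" "\<lambda>s. (n s, 0)"] x by simp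
  have Y: "has_bidegree (\<Prod>p\<in>S. B p ^ n p) (0, \<Sum>p\<in>S. n p)" for S n
    using has_bidegree_prod[of S "\<lambda>p. B p ^ n p" "\<lambda>p. (0, n p)"] y by simp
  show ?thesis
    unfolding separator_def cofactor_def deg
    using has_bidegree_mult[OF has_bidegree_mult[OF x[of i l] y[of j "M - l"]]
        has_bidegree_mult[OF X Y]] by simp
qed

text \<open>
  The torus acts on \<open>F\<close> and on each separator through its bidegree.  Comparing the two expansions
  of the transformed \<open>F\<close>, the characters of \<open>F\<close> and of every separator whose coefficient has a
  nonzero constant term agree.  In characteristic zero the characters are told apart by their
  values at (2,1) and (1,2).
\<close>

lemma degree_of_coordinate:
  assumes F: "has_bidegree F d" and r: "F - (\<Sum>l\<le>M. r l * separator l) \<in> zideal m"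
    and l: "l \<le> M" and nz: "const_term (r l) \<noteq> 0"
  shows "d = separator_degree l"
proof -
  let ?D = "F - (\<Sum>l\<le>M. r l * separator l)" and ?p = "pair_power (L i) (B j) (Suc M)"
  have *: "c ^ fst d * e ^ snd d = c ^ fst (separator_degree l) * e ^ snd (separator_degree l)"
    for c e :: 'k
  proof -
    let ?c = "\<lambda>d::nat \<times> nat. c ^ fst d * e ^ snd d"
    have D: "?D \<in> ?p" using zidealD[OF r i j] by (simp only: mij)
    have "const (?c d) * ?D - scale c e ?D \<in> ?p"
      by (intro ideal_diff[OF ring_ideal_pair_power] ideal_mult_left[OF ring_ideal_pair_power]
          scale_pair_power D)
    moreover have "scale c e ?D = const (?c d) * F -
        (\<Sum>l\<le>M. scale c e (r l) * (const (?c (separator_degree l)) * separator l))"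
    proof -
      have "scale c e ?D = scale c e F - (\<Sum>l\<le>M. scale c e (r l) * scale c e (separator l))"
        by (simp only: scale_def subst_simps)
      then show ?thesis
        by (simp add: scale_has_bidegree[OF F] scale_has_bidegree[OF has_bidegree_separator])
    qed
    then have "const (?c d) * ?D - scale c e ?D = (\<Sum>l\<le>M.
        (const (?c (separator_degree l)) * scale c e (r l) - const (?c d) * r l) * separator l)"
      by (simp add: algebra_simps sum_distrib_left sum_subtractf)
    ultimately have "(\<Sum>l\<le>M.
        (const (?c (separator_degree l)) * scale c e (r l) - const (?c d) * r l) * separator l) \<in> ?p"
      by simp
    then have "const_term (const (?c (separator_degree l)) * scale c e (r l) - const (?c d) * r l) = 0"
      using l by (rule separators_independent)
    then have "(?c (separator_degree l) - ?c d) * const_term (r l) = 0"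
      by (simp only: const_term_simps const_term_scale left_diff_distrib)
    then show ?thesis using nz by simp
  qed
  have inj: "(2 :: 'k) ^ k = 2 ^ n \<Longrightarrow> k = n" for k n
  proof -
    assume "(2 :: 'k) ^ k = 2 ^ n"
    then have "(of_nat (2 ^ k) :: 'k) = of_nat (2 ^ n)" by simp
    then have "(2 :: nat) ^ k = 2 ^ n" by (simp only: of_nat_eq_iff)
    then show "k = n" by simp
  qed
  show ?thesis using *[of 2 1] *[of 1 2] inj by (auto simp: prod_eq_iff)
qed

end

section \<open>Counting generators\<close>

lemma homogeneous_system_nontrivial_solution:
  fixes u :: "'l \<Rightarrow> 'g \<Rightarrow> 'k::field"
  assumes "finite G" "finite K" "card G < card K"
  shows "\<exists>c. (\<exists>l\<in>K. c l \<noteq> 0) \<and> (\<forall>g\<in>G. (\<Sum>l\<in>K. c l * u l g) = 0)"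
  using assms
proof (induction G arbitrary: K u rule: finite_induct)
  case empty
  then have "K \<noteq> {}" by auto
  then show ?case by (intro exI[of _ "\<lambda>_. 1"]) auto
next
  case (insert g G)
  show ?case
  proof (cases "\<forall>l\<in>K. u l g = 0")
    case True
    have "card G < card K" using insert.prems insert.hyps by simp
    then obtain c where "\<exists>l\<in>K. c l \<noteq> 0" "\<forall>g\<in>G. (\<Sum>l\<in>K. c l * u l g) = 0"
      using insert.IH[OF insert.prems(1)] by blast
    then show ?thesis using True by (intro exI[of _ c]) simp
  next
    case False
    then obtain l0 where l0: "l0 \<in> K" "u l0 g \<noteq> 0" by blast
    let ?K = "K - {l0}"
    have "card G < card ?K" using insert.prems insert.hyps l0(1) by simp
    then obtain c where c: "\<exists>l\<in>?K. c l \<noteq> 0"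
      "\<forall>h\<in>G. (\<Sum>l\<in>?K. c l * (u l h - u l g / u l0 g * u l0 h)) = 0"
      using insert.IH[of ?K "\<lambda>l h. u l h - u l g / u l0 g * u l0 h"] insert.prems(1) by auto
    \<comment> \<open>The value at \<open>l0\<close> is chosen to satisfy the equation for \<open>g\<close>.\<close>
    define c' where "c' = c(l0 := - (\<Sum>l\<in>?K. c l * u l g) / u l0 g)"
    have split: "(\<Sum>l\<in>K. c' l * u l h) =
        - (\<Sum>l\<in>?K. c l * u l g) / u l0 g * u l0 h + (\<Sum>l\<in>?K. c l * u l h)" for h
      using insert.prems(1) l0(1) by (simp add: sum.remove c'_def)
    have "(\<Sum>l\<in>K. c' l * u l h) = 0" if "h \<in> G" for h
    proof -
      have "(\<Sum>l\<in>K. c' l * u l h) = (\<Sum>l\<in>?K. c l * (u l h - u l g / u l0 g * u l0 h))"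
        unfolding split
        by (simp add: right_diff_distrib sum_subtractf sum_distrib_left sum_divide_distrib mult_ac)
      then show ?thesis using c(2) that by simp
    qed
    moreover have "(\<Sum>l\<in>K. c' l * u l g) = 0"
      unfolding split using l0(2) by simp
    moreover have "\<exists>l\<in>K. c' l \<noteq> 0" using c(1) by (auto simp: c'_def)
    ultimately show ?thesis by (intro exI[of _ c']) blast
  qed
qed

text \<open>
  The rank of an identity matrix that factors through \<open>G\<close> is at most the size of \<open>G\<close>.
\<close>

lemma identity_factors_card_le:
  fixes u :: "'l \<Rightarrow> 'g \<Rightarrow> 'k::field"
  assumes "finite G" "finite K"
    and id: "\<And>l k. \<lbrakk>l \<in> K; k \<in> K\<rbrakk> \<Longrightarrow> (\<Sum>g\<in>G. u l g * w g k) = (if l = k then 1 else 0)"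
  shows "card K \<le> card G"
proof (rule ccontr)
  assume "\<not> card K \<le> card G"
  then obtain c k where k: "k \<in> K" "c k \<noteq> 0" and c: "\<forall>g\<in>G. (\<Sum>l\<in>K. c l * u l g) = 0"
    using homogeneous_system_nontrivial_solution[OF assms(1,2)] by (metis not_le)
  have "c k = (\<Sum>l\<in>K. if l = k then c l else 0)" using k assms(2) by simp
  also have "\<dots> = (\<Sum>l\<in>K. c l * (\<Sum>g\<in>G. u l g * w g k))"
    using id k(1) by (intro sum.cong) auto
  also have "\<dots> = (\<Sum>l\<in>K. \<Sum>g\<in>G. c l * u l g * w g k)"
    by (simp add: sum_distrib_left mult.assoc)
  also have "\<dots> = (\<Sum>g\<in>G. (\<Sum>l\<in>K. c l * u l g) * w g k)"
    by (subst sum.swap) (simp add: sum_distrib_right)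
  also have "\<dots> = 0" using c by simp
  finally show False using k(2) by contradiction
qed

lemma count_image_mset_mset_set:
  "finite A \<Longrightarrow> count (image_mset f (mset_set A)) d = card {x \<in> A. f x = d}"
  by (simp add: count_image_mset vimage_def Collect_conj_eq Int_commute)

context separator_setup
begin

text \<open>
  Expressing the separators by generators and these again by separators gives the identity modulo
  the relations; taking constant terms turns it into a factorization of an identity matrix.
\<close>

lemma generating_set_coordinates:
  assumes fin: "finite G" and gen: "zideal m' = ideal_gen (zideal m) G"
  shows "\<exists>c w. (\<forall>g\<in>G. g - (\<Sum>l\<le>M. w g l * separator l) \<in> zideal m) \<and>
    (\<forall>l\<le>M. \<forall>k\<le>M. (\<Sum>g\<in>G. const_term (c l g) * const_term (w g k)) = (if l = k then 1 else 0))"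
proof -
  have I: "ring_ideal (zideal m)" by (rule ring_ideal_zideal)
  have "\<exists>r. g - (\<Sum>l\<le>M. r l * separator l) \<in> zideal m" if "g \<in> G" for g
    using separators_generate generators_in_ideal_gen[OF I fin that] gen by simp
  then obtain w where w: "g - (\<Sum>l\<le>M. w g l * separator l) \<in> zideal m" if "g \<in> G" for g
    by metis
  have "\<forall>l\<in>{..M}. \<exists>c. separator l - (\<Sum>g\<in>G. c g * g) \<in> zideal m"
    using separator_in_zideal unfolding gen by (auto elim: ideal_genE)
  then obtain c where c: "separator l - (\<Sum>g\<in>G. c l g * g) \<in> zideal m" if "l \<le> M" for l
    unfolding bchoice_iff by auto
  have "(\<Sum>g\<in>G. const_term (c l g) * const_term (w g k)) = (if l = k then 1 else 0)"
    if l: "l \<le> M" and k: "k \<le> M" for l k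
  proof -
    have "(separator l - (\<Sum>g\<in>G. c l g * g)) +
        (\<Sum>g\<in>G. c l g * (g - (\<Sum>k\<le>M. w g k * separator k))) \<in> zideal m"
      by (intro ideal_add[OF I c[OF l]] ideal_sum[OF I] ideal_mult_left[OF I] w)
    also have "(separator l - (\<Sum>g\<in>G. c l g * g)) +
        (\<Sum>g\<in>G. c l g * (g - (\<Sum>k\<le>M. w g k * separator k))) =
        separator l - (\<Sum>g\<in>G. \<Sum>k\<le>M. c l g * w g k * separator k)"
      by (simp add: right_diff_distrib sum_subtractf sum_distrib_left mult.assoc)
    also have "(\<Sum>g\<in>G. \<Sum>k\<le>M. c l g * w g k * separator k) =
        (\<Sum>k\<le>M. (\<Sum>g\<in>G. c l g * w g k) * separator k)"
      by (subst sum.swap) (simp add: sum_distrib_right)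
    also have "separator l = (\<Sum>k\<le>M. (if k = l then 1 else 0) * separator k)"
      using l by (simp add: if_distrib[of "\<lambda>x. x * _"] cong: if_cong)
    finally have "(\<Sum>k\<le>M. ((if k = l then 1 else 0) - (\<Sum>g\<in>G. c l g * w g k)) * separator k) \<in> zideal m"
      by (simp only: left_diff_distrib sum_subtractf)
    then have "(\<Sum>k\<le>M. ((if k = l then 1 else 0) - (\<Sum>g\<in>G. c l g * w g k)) * separator k)
        \<in> pair_power (L i) (B j) (Suc M)"
      unfolding mij[symmetric] by (rule zidealD[OF _ i j])
    then have "const_term ((if k = l then 1 else 0) - (\<Sum>g\<in>G. c l g * w g k)) = 0"
      using k by (rule separators_independent)
    then show ?thesis by (auto simp: const_term_simps split: if_splits)
  qed
  then show ?thesis using w by blast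
qed

lemma separators_ideal_gen: "zideal m' = ideal_gen (zideal m) (separator ` {..M})"
proof (rule antisym)
  have I: "ring_ideal (zideal m)" by (rule ring_ideal_zideal)
  let ?J = "ideal_gen (zideal m) (separator ` {..M})"
  have J: "ring_ideal ?J" by (rule ring_ideal_ideal_gen[OF I])
  show "zideal m' \<subseteq> ?J"
  proof
    fix F assume "F \<in> zideal m'"
    then obtain r where r: "F - (\<Sum>l\<le>M. r l * separator l) \<in> zideal m"
      using separators_generate by blast
    have "(\<Sum>l\<le>M. r l * separator l) \<in> ?J"
      by (intro ideal_sum[OF J] ideal_mult_left[OF J] generators_in_ideal_gen[OF I]) auto
    moreover have "F - (\<Sum>l\<le>M. r l * separator l) \<in> ?J" using r subset_ideal_gen by blast
    ultimately have "(F - (\<Sum>l\<le>M. r l * separator l)) + (\<Sum>l\<le>M. r l * separator l) \<in> ?J"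
      by (intro ideal_add[OF J])
    then show "F \<in> ?J" by simp
  qed
  show "?J \<subseteq> zideal m'"
  proof
    fix F assume "F \<in> ?J"
    then obtain r where r: "F - (\<Sum>g\<in>separator ` {..M}. r g * g) \<in> zideal m" by (rule ideal_genE)
    have "(F - (\<Sum>g\<in>separator ` {..M}. r g * g)) + (\<Sum>g\<in>separator ` {..M}. r g * g) \<in> zideal m'"
      using r zideal_subset separator_in_zideal
      by (intro ideal_add[OF ring_ideal_zideal] ideal_sum[OF ring_ideal_zideal]
          ideal_mult_left[OF ring_ideal_zideal]) auto
    then show "F \<in> zideal m'" by simp
  qed
qed

lemma generates_separators_iff:
  assumes "finite G"
  shows "generates_separators a b P Q m i j G \<longleftrightarrow> zideal m' = ideal_gen (zideal m) G"
proof -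
  have I: "ring_ideal (zideal m)" by (rule ring_ideal_zideal)
  note iff = coset_image_subset_iff[OF I]
  show ?thesis
    unfolding generates_separators_def Let_def fat_ideal_eq genideal_coset_image[OF I assms]
    using iff[OF ring_ideal_zideal zideal_subset ring_ideal_ideal_gen[OF I] subset_ideal_gen]
      iff[OF ring_ideal_ideal_gen[OF I] subset_ideal_gen ring_ideal_zideal zideal_subset]
    by (simp only: set_eq_subset)
qed

text \<open>
  For a bidegree \<open>d\<close>, only generators of bidegree \<open>d\<close> have nonzero coordinates at the separators
  of bidegree \<open>d\<close>.  So the identity matrix indexed by these separators factors through these
  generators, and every homogeneous generating set has at least as many generators of bidegree
  \<open>d\<close>.  A minimal one has no more elements than there are separators, which forces equality for
  every \<open>d\<close>.
\<close>

lemma minimal_separators_degree: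
  "has_separator_degree a b P Q m i j (image_mset separator_degree (mset_set {..M}))"
proof -
  have lower: "image_mset separator_degree (mset_set {..M}) \<subseteq># image_mset bidegree (mset_set G)"
    if fin: "finite G" and hom: "\<forall>F\<in>G. bihomogeneous F" and gen: "generates_separators a b P Q m i j G" for G
  proof (rule mset_subset_eqI)
    fix d
    obtain c w where w: "\<And>g. g \<in> G \<Longrightarrow> g - (\<Sum>l\<le>M. w g l * separator l) \<in> zideal m"
      and id: "\<And>l k. \<lbrakk>l \<le> M; k \<le> M\<rbrakk> \<Longrightarrow>
        (\<Sum>g\<in>G. const_term (c l g) * const_term (w g k)) = (if l = k then 1 else 0)"
      using generating_set_coordinates[OF fin gen[unfolded generates_separators_iff[OF fin]]] by blast
    let ?K = "{l \<in> {..M}. separator_degree l = d}" and ?G = "{g \<in> G. bidegree g = d}"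
    have "card ?K \<le> card ?G"
    proof (rule identity_factors_card_le)
      fix l k assume lk: "l \<in> ?K" "k \<in> ?K"
      have "const_term (w g k) = 0" if g: "g \<in> G - ?G" for g
      proof (rule ccontr)
        assume nz: "const_term (w g k) \<noteq> 0"
        \<comment> \<open>The zero polynomial has every bidegree, which \<open>degree_of_coordinate\<close> excludes.\<close>
        have "g \<noteq> 0"
        proof
          assume "g = 0"
          then have "has_bidegree g e" for e by (simp add: has_bidegree_def)
          then have "e = separator_degree k" for e
            using degree_of_coordinate[OF _ w _ nz] g lk by blast
          from this[of "(0, 0)"] this[of "(1, 0)"] show False by (metis prod.inject zero_neq_one)
        qed
        then have "has_bidegree g (bidegree g)" using has_bidegree_bidegree hom g by blast
        then have "bidegree g = separator_degree k"
          using degree_of_coordinate[OF _ w _ nz] g lk by blast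
        then show False using g lk by simp
      qed
      then have "(\<Sum>g\<in>?G. const_term (c l g) * const_term (w g k)) =
          (\<Sum>g\<in>G. const_term (c l g) * const_term (w g k))"
        using fin by (intro sum.mono_neutral_left) auto
      then show "(\<Sum>g\<in>?G. const_term (c l g) * const_term (w g k)) = (if l = k then 1 else 0)"
        using id lk by simp
    qed (use fin in auto)
    then show "count (image_mset separator_degree (mset_set {..M})) d
        \<le> count (image_mset bidegree (mset_set G)) d"
      using fin by (simp add: count_image_mset_mset_set)
  qed
  have card_ge: "Suc M \<le> card G" if fin: "finite G" and gen: "generates_separators a b P Q m i j G" for G
  proof -
    obtain c w :: "_ \<Rightarrow> _ \<Rightarrow> 'k bipoly" where id: "\<And>l k. \<lbrakk>l \<le> M; k \<le> M\<rbrakk> \<Longrightarrow>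
        (\<Sum>g\<in>G. const_term (c l g) * const_term (w g k)) = (if l = k then 1 else 0)"
      using generating_set_coordinates[OF fin gen[unfolded generates_separators_iff[OF fin]]] by blast
    have "card {..M} \<le> card G"
      by (rule identity_factors_card_le[OF fin finite_atMost id]) simp_all
    then show ?thesis by simp
  qed
  let ?S = "separator ` {..M}"
  have S: "finite ?S" "card ?S \<le> Suc M" "generates_separators a b P Q m i j ?S"
    using card_image_le[of "{..M}" separator] separators_ideal_gen by (simp_all add: generates_separators_iff)
  have "\<forall>F\<in>?S. bihomogeneous F"
    using has_bidegree_separator unfolding bihomogeneous_iff by blast
  then have "minimal_separators a b P Q m i j ?S"
    using S card_ge unfolding minimal_separators_def by (meson leD le_less_trans)
  moreover have "image_mset bidegree (mset_set Fs) = image_mset separator_degree (mset_set {..M})"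
    if "minimal_separators a b P Q m i j Fs" for Fs
  proof -
    have Fs: "finite Fs" "\<forall>F\<in>Fs. bihomogeneous F" "generates_separators a b P Q m i j Fs"
      "\<not> card ?S < card Fs"
      using that S(1,3) unfolding minimal_separators_def by blast+
    then have sub: "image_mset separator_degree (mset_set {..M}) \<subseteq># image_mset bidegree (mset_set Fs)"
      by (intro lower)
    have "size (image_mset bidegree (mset_set Fs)) \<le> size (image_mset separator_degree (mset_set {..M}))"
      using Fs(4) S(2) by simp
    then show ?thesis using sub mset_subset_size[of "image_mset separator_degree (mset_set {..M})"]
      by (metis not_le subset_mset.less_le)
  qed
  ultimately show ?thesis unfolding has_separator_degree_def by blast
qed

end

theorem theorem3p4:
  fixes P Q :: "nat \<Rightarrow> 'k::{alg_closed_field, field_char_0} \<times> 'k"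
    and a b i j :: nat
    and m :: "nat \<Rightarrow> nat \<Rightarrow> nat"
    and \<alpha> \<beta> :: "nat \<Rightarrow> nat"
  assumes "fat_points a b P Q m"
    and "ACM a b P Q m"
    and "i \<in> {1..a}" and "j \<in> {1..b}" and "m i j > 0"
    and "\<And>l. l < m i j \<Longrightarrow> \<alpha> l = (\<Sum>s=1..a. m s j - l)"
    and "\<And>l. l < m i j \<Longrightarrow> \<beta> l = (\<Sum>p=1..b. m i p - l)"
  shows "has_separator_degree a b P Q m i j
           {# (\<alpha> (m i j - 1 - l) - 1, \<beta> l - 1). l \<in># mset_set {0..<m i j} #}"
proof -
  have grid: "grid a b P Q"
    using assms(1) by unfold_locales (auto simp: fat_points_def cross_nonzero)
  then interpret grid a b P Q .
  obtain ex where ex: "ex \<noteq> (0, 0)" "\<forall>i\<in>{1..a}. cross (P i) ex \<noteq> 0"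
    using generic_point_exists[of "{1..a}" P] P_nonzero by auto
  obtain ey where ey: "ey \<noteq> (0, 0)" "\<forall>j\<in>{1..b}. cross (Q j) ey \<noteq> 0"
    using generic_point_exists[of "{1..b}" Q] Q_nonzero by auto
  interpret generic_grid a b P Q ex ey
    using ex ey by unfold_locales auto
  have I: "ring_ideal (zideal m)" by (rule ring_ideal_zideal)
  have "zideal m \<subseteq> pair_power (L i) (B j) (m i j)" using assms(3,4) by (auto dest: zidealD)
  also have "\<dots> \<subseteq> pair_power (L i) (B j) (Suc 0)" using assms(5) by (intro pair_power_antimono) simp
  finally have "zideal m \<subseteq> span2 (L i) (B j)" by (simp only: pair_power_one)
  then obtain f g where "const_term f = 0" "const_term g = 0"
    "nzd_mod f (zideal m)" "nzd_mod g (adjoin (zideal m) f)"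
    using cohen_macaulay_regular_pair_of_forms[OF _ I P_nonzero[OF assms(3)] Q_nonzero[OF assms(4)]]
      assms(2) unfolding ACM_def fat_ideal_eq by blast
  then have cond: "depth_cond m" by (rule depth_condI_regular_sequence)
  obtain M where M: "m i j = Suc M" using assms(5) by (cases "m i j") auto
  interpret separator_setup a b P Q m i j M
  proof unfold_locales
    fix l s p assume l: "l \<le> M" and sp: "s \<in> {1..a}" "p \<in> {1..b}"
    \<comment> \<open>Otherwise the entries \<open>(i, l), (j, M - l)\<close> and
      \<open>(s, m s j - (M - l)), (p, m i p - l)\<close> of the 0-1 matrix span a forbidden minor.\<close>
    show "m s p \<le> (m s j - (M - l)) + (m i p - l)"
    proof (rule ccontr)
      assume "\<not> ?thesis"
      then have "(m s j - (M - l)) + (m i p - l) < m s p" by simp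
      moreover have "l + (M - l) < m i j" using l M by simp
      ultimately have "l + (m i p - l) < m i p \<or> (m s j - (M - l)) + (M - l) < m s j"
        by (intro depth_cond_nested[OF cond assms(3) sp(1) assms(4) sp(2)])
      then show False by linarith
    qed
  qed (use assms(3,4) M in auto)
  have "image_mset separator_degree (mset_set {..M}) =
      {# (\<alpha> (m i j - 1 - l) - 1, \<beta> l - 1). l \<in># mset_set {0..<m i j} #}"
    (is "_ = image_mset ?d _")
  proof -
    have "{..M} = {0..<m i j}" by (auto simp: M)
    moreover have "image_mset separator_degree (mset_set {..M}) = image_mset ?d (mset_set {..M})"
    proof (rule image_mset_cong)
      fix l assume "l \<in># mset_set {..M}"
      then have "l \<le> M" by simp
      then show "separator_degree l = ?d l"
        using assms(6)[of "M - l"] assms(7)[of l] by (simp add: separator_degree_def M)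
    qed
    ultimately show ?thesis by (simp only:)
  qed
  then show ?thesis using minimal_separators_degree by simp
qed

end
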